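(* In the setting of the context, suppose $u$ and $\tilde u$ are weak entropy solutions (on $\mathbb R\times(0,\infty)\times\Gamma$) of the equation $\partial_tu+\partial_xf(u)=0$ corresponding to initial data $u_0,\tilde u_0\in L^\infty(\mathbb R\times\Gamma)$ respectively. Then there exists $\alpha>0$ depending only on $f$ and its derivatives such that for every $m>0$, $\Gamma_1\Subset\Gamma$ and $t>0$ $$\int_{|x|\le m}\int_{\Gamma_1}|u(x,t,y)-\tilde u(x,t,y)|\,\rho^2(y)\,dy\,dx\le\int_{|x|\le m+\alpha t}\int_{\Gamma_1}|u_0(x,y)-\tilde u_0(x,y)|\,\rho^2(y)\,dy\,dx .$$ In particular, for any $u_0\in L^\infty(\mathbb R\times\Gamma)$ there exists at most one weak entropy solution with initial data $u_0$.
   Context: $N\in\mathbb N$, $\Gamma=[-1,1]^N$, and $\rho(y)=\prod_{j=1}^N\rho_j(y_j):\Gamma\to[0,\infty)$ is a probability density with $\rho\in L^\infty(\Gamma)$ and $\rho>0$ a.e. in $\Gamma$. $I\subset\mathbb R$ is the interval $\pi_1(\overline D)$, the projection on the first coordinate of the closure of an open convex set $D\subset\mathbb R^2$, and $f:I\to\mathbb R$ is the $C^2$ flux $f(u)=f_1(u,e(u))$, where $f_1:\overline D\to\mathbb R$ and $e$ are $C^2$ with $(u,e(u))\in\overline D$ for $u\in I$. $\Gamma_1\Subset\Gamma$ denotes a measurable set whose closure is a compact subset of $\Gamma$. Weak entropy solution of $\partial_tu+\partial_xf(u)=0$, $u(x,0,y)=u_0(x,y)$, with $u_0\in L^\infty(\mathbb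 R\times\Gamma)$ taking values in $I$: a function $u\in L^\infty(\mathbb R\times(0,\infty)\times\Gamma)$ with values in $I$ such that (a) $\int_0^\infty\!\int_{\mathbb R}\!\int_\Gamma(u\,\partial_t\varphi+f(u)\,\partial_x\varphi)\rho\,dy\,dx\,dt+\int_{\mathbb R}\!\int_\Gamma u_0\,\varphi(x,0,y)\rho\,dy\,dx=0$ for all $\varphi\in C_c^\infty(\mathbb R\times[0,\infty)\times\Gamma)$; (b) $\int_0^\infty\!\int_{\mathbb R}\!\int_\Gamma(\ell(u)\,\partial_t\varphi+q(u)\,\partial_x\varphi)\rho\,dy\,dx\,dt\ge0$ for every convex $\ell:\mathbb R\to\mathbb R$ of class $C^2(I)$, with $q(u)=\int^u\ell'(\theta)f'(\theta)\,d\theta$, and every $0\le\varphi\in C_c^\infty(\mathbb R\times(0,\infty)\times\Gamma)$; (c) $\lim_{T\to0^+}\frac1T\int_0^T\!\int_V\!\int_\Gamma|u(x,t,y)-u_0(x,y)|\rho(y)\,dy\,dx\,dt=0$ for every $V\Subset\mathbb R$.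
   Formalization: α is uniform over solutions with values in a convex J ⊂ I where f′ is bounded (no α works otherwise, e.g. Burgers on all of ℝ); uniqueness assumes f′ bounded on bounded subsets of I; "every t" means a.e. t and every t where u, ũ have averaged time values. *)

theory Defs
  imports "HOL-Analysis.Analysis"
begin

text \<open>
  Class \<open>C\<^sup>k\<close> on a set that need not be open, by derivatives relative to the set. It is applied
  only to convex sets with nonempty interior, where relative derivatives are unique: the whole
  space, the closure of an open convex set, and a nondegenerate interval.
\<close>

primrec Ck_on :: "nat \<Rightarrow> 'a::euclidean_space set \<Rightarrow> ('a \<Rightarrow> real) \<Rightarrow> bool" where
  "Ck_on 0 S g \<longleftrightarrow> continuous_on S g"
| "Ck_on (Suc k) S g \<longleftrightarrow>
    (\<exists>g'. (\<forall>x\<in>S. (g has_derivative g' x) (at x within S)) \<and> (\<forall>v. Ck_on k S (\<lambda>x. g' x v)))"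

text \<open>
  Smooth functions with compact support in \<open>S\<close>, where \<open>S\<close> may contain part of its boundary:
  restrictions to \<open>S\<close> of functions smooth on the whole space, with support relative to \<open>S\<close> a
  compact subset of \<open>S\<close>. Nothing is required to vanish on the part of the boundary lying in \<open>S\<close>.
\<close>

definition test_functions :: "'a::euclidean_space set \<Rightarrow> ('a \<Rightarrow> real) set" where
  "test_functions S = {\<phi>. (\<forall>k. Ck_on k UNIV \<phi>) \<and>
     compact (closure {p \<in> S. \<phi> p \<noteq> 0}) \<and> closure {p \<in> S. \<phi> p \<noteq> 0} \<subseteq> S}"

definition Linf :: "'a::euclidean_space set \<Rightarrow> ('a \<Rightarrow> real) \<Rightarrow> bool" where
  "Linf S g \<longleftrightarrow> g \<in> borel_measurable (lebesgue_on S) \<and>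
     (\<exists>C. AE p in lebesgue_on S. \<bar>g p\<bar> \<le> C)"

definition compactly_inside :: "'a::euclidean_space set \<Rightarrow> 'a set \<Rightarrow> bool"
    (infix \<open>\<Subset>\<close> 50) where
  "A \<Subset> B \<longleftrightarrow> A \<in> sets lebesgue \<and> compact (closure A) \<and> closure A \<subseteq> B"

definition Gam :: "(real ^ 'n) set" where
  "Gam = {y. \<forall>j. -1 \<le> y $ j \<and> y $ j \<le> 1}"

definition product_density :: "((real ^ 'n) \<Rightarrow> real) \<Rightarrow> bool" where
  "product_density \<rho> \<longleftrightarrow>
     (\<exists>r :: 'n \<Rightarrow> real \<Rightarrow> real. \<forall>y\<in>Gam. \<rho> y = (\<Prod>j\<in>UNIV. r j (y $ j))) \<and>
     (\<forall>y\<in>Gam. 0 \<le> \<rho> y) \<and> Linf Gam \<rho> \<and> (LINT y:Gam|lebesgue. \<rho> y) = 1 \<and>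
     (AE y in lebesgue_on Gam. 0 < \<rho> y)"

text \<open>Points of the space-time-parameter domain are ordered \<open>(x, t, y)\<close>.\<close>

definition Omega :: "(real \<times> real \<times> (real ^ 'n)) set" where
  "Omega = UNIV \<times> {0<..} \<times> Gam"

text \<open>
  \<open>w\<close> is the value of \<open>u\<close> at time \<open>t\<close>, in the averaged local \<open>L\<^sup>1\<close> sense in which a solution attains
  its initial data; elements of \<open>L\<^sup>\<infinity>\<close> have no pointwise value at a given time.
\<close>

definition has_time_value ::
  "((real ^ 'n) \<Rightarrow> real) \<Rightarrow> (real \<times> real \<times> (real ^ 'n) \<Rightarrow> real) \<Rightarrow> real \<Rightarrow>
    (real \<times> (real ^ 'n) \<Rightarrow> real) \<Rightarrow> bool" where
  "has_time_value \<rho> u t w \<longleftrightarrow> (\<forall>V. V \<Subset> UNIV \<longrightarrow>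
     ((\<lambda>T. 1 / T * set_lebesgue_integral lebesgue (V \<times> {t<..<t + T} \<times> Gam)
              (\<lambda>(x, s, y). \<bar>u (x, s, y) - w (x, y)\<bar> * \<rho> y)) \<longlongrightarrow> 0) (at_right 0))"

abbreviation deriv_in :: "real set \<Rightarrow> (real \<Rightarrow> real) \<Rightarrow> real \<Rightarrow> real" where
  "deriv_in I g v \<equiv> vector_derivative g (at v within I)"

definition weak_solution ::
  "((real ^ 'n) \<Rightarrow> real) \<Rightarrow> (real \<Rightarrow> real) \<Rightarrow> (real \<times> (real ^ 'n) \<Rightarrow> real) \<Rightarrow>
    (real \<times> real \<times> (real ^ 'n) \<Rightarrow> real) \<Rightarrow> bool" where
  "weak_solution \<rho> f u0 u \<longleftrightarrow> (\<forall>\<phi> \<in> test_functions (UNIV \<times> {0..} \<times> Gam).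
     set_lebesgue_integral lebesgue Omega
       (\<lambda>(x, t, y). (u (x, t, y) * deriv (\<lambda>s. \<phi> (x, s, y)) t
                    + f (u (x, t, y)) * deriv (\<lambda>z. \<phi> (z, t, y)) x) * \<rho> y)
     + set_lebesgue_integral lebesgue (UNIV \<times> Gam)
       (\<lambda>(x, y). u0 (x, y) * \<phi> (x, 0, y) * \<rho> y) = 0)"

text \<open>
  The entropy flux is determined up to an additive constant, hence the arbitrary lower limit \<open>c\<close>.
\<close>

definition entropy_flux ::
  "real set \<Rightarrow> (real \<Rightarrow> real) \<Rightarrow> (real \<Rightarrow> real) \<Rightarrow> real \<Rightarrow> real \<Rightarrow> real" where
  "entropy_flux I f l c v = (LBINT \<theta>=ereal c..ereal v. deriv_in I l \<theta> * deriv_in I f \<theta>)"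

definition entropy_inequalities ::
  "((real ^ 'n) \<Rightarrow> real) \<Rightarrow> real set \<Rightarrow> (real \<Rightarrow> real) \<Rightarrow>
    (real \<times> real \<times> (real ^ 'n) \<Rightarrow> real) \<Rightarrow> bool" where
  "entropy_inequalities \<rho> I f u \<longleftrightarrow>
     (\<forall>l. convex_on UNIV l \<and> Ck_on 2 I l \<longrightarrow> (\<forall>c\<in>I. \<forall>\<phi> \<in> test_functions Omega.
        (\<forall>p\<in>Omega. 0 \<le> \<phi> p) \<longrightarrow>
        0 \<le> set_lebesgue_integral lebesgue Omega
          (\<lambda>(x, t, y). (l (u (x, t, y)) * deriv (\<lambda>s. \<phi> (x, s, y)) t
             + entropy_flux I f l c (u (x, t, y)) * deriv (\<lambda>z. \<phi> (z, t, y)) x) * \<rho> y)))"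

definition initial_datum :: "real set \<Rightarrow> (real \<times> (real ^ 'n) \<Rightarrow> real) \<Rightarrow> bool" where
  "initial_datum I u0 \<longleftrightarrow>
     Linf (UNIV \<times> Gam) u0 \<and> (AE p in lebesgue_on (UNIV \<times> Gam). u0 p \<in> I)"

definition weak_entropy_solution ::
  "((real ^ 'n) \<Rightarrow> real) \<Rightarrow> real set \<Rightarrow> (real \<Rightarrow> real) \<Rightarrow> (real \<times> (real ^ 'n) \<Rightarrow> real) \<Rightarrow>
    (real \<times> real \<times> (real ^ 'n) \<Rightarrow> real) \<Rightarrow> bool" where
  "weak_entropy_solution \<rho> I f u0 u \<longleftrightarrow>
     initial_datum I u0 \<and> Linf Omega u \<and> (AE p in lebesgue_on Omega. u p \<in> I) \<and>
     weak_solution \<rho> f u0 u \<and> entropy_inequalities \<rho> I f u \<and> has_time_value \<rho> u 0 u0"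

definition local_distance ::
  "((real ^ 'n) \<Rightarrow> real) \<Rightarrow> real \<Rightarrow> (real ^ 'n) set \<Rightarrow>
    (real \<times> (real ^ 'n) \<Rightarrow> real) \<Rightarrow> (real \<times> (real ^ 'n) \<Rightarrow> real) \<Rightarrow> real" where
  "local_distance \<rho> r G v w =
     set_lebesgue_integral lebesgue ({x. \<bar>x\<bar> \<le> r} \<times> G)
       (\<lambda>(x, y). \<bar>v (x, y) - w (x, y)\<bar> * (\<rho> y)\<^sup>2)"

end

theory Submission
  imports Defs
begin

text \<open>
  Kruzhkov's doubling of variables. Replacing \<open>u\<close>, \<open>v\<close>, \<open>\<rho>\<close> by Borel representatives, the smooth entropies
  \<open>sqrt ((v - k)\<^sup>2 + \<epsilon>\<^sup>2)\<close> give the Kruzhkov inequalities with \<open>\<bar>u - k\<bar>\<close> as \<open>\<epsilon>\<close> tends to \<open>0\<close>. The inequality for \<open>u\<close> with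
  \<open>k = v q\<close> and the one for \<open>v\<close> with \<open>k = u p\<close> are both tested with \<open>\<psi> p * K (p - q)\<close>, where \<open>K\<close> is a mollifier in all
  the variables \<open>(x, t, y)\<close>. In their sum the derivatives of \<open>K\<close> cancel, and as \<open>K\<close> concentrates, continuity
  of translations in \<open>L\<^sup>1\<close> gives \<open>\<bar>u - v\<bar>\<^sub>t + F(u, v)\<^sub>x \<le> 0\<close> weakly, with weight \<open>\<rho>\<^sup>2\<close> because \<open>y\<close> is doubled too.

  Since \<open>\<bar>F(u, v)\<bar> \<le> \<alpha> * \<bar>u - v\<bar>\<close>, testing with a smooth cutoff of the cone \<open>\<bar>x\<bar> < R - \<alpha> * t\<close> times functions of
  \<open>t\<close> and of \<open>y\<close> bounds a mollification in \<open>(t, y)\<close> of the mass of \<open>\<bar>u - v\<bar>\<close> in the cone by that of the initial mass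
  in \<open>[-R, R]\<close>. Hence the inequality between the masses holds for almost every \<open>(t, y)\<close> and all rational \<open>R\<close>,
  and it can be integrated over any set of parameters \<open>y\<close>.
\<close>

section \<open>Smooth functions\<close>

text \<open>The equation has no derivative in \<open>y\<close>, but the entropy inequalities hold
  only after integration in \<open>y\<close> against \<rho>, so neither solution can be frozen at a
  single parameter; this is why \<open>y\<close> is treated like \<open>x\<close> and
  \<open>t\<close>. Kernels in all variables call for functions on the whole space. The weight
  vanishes off \<open>Omega\<close>, and test functions may be nonzero on the boundary of
  \<open>Gam\<close>, so kernels can reach across that boundary. Across \<open>t = 0\<close> they
  cannot, and their radius is kept below the distance of the test function from that time. Initial
  data therefore enter only through the averages over short time intervals in which they are
  attained, and the time cutoff rises over \<open>(T, 2 * T)\<close> with height of order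
  \<open>1 / T\<close> to match these averages. The final inequality has to hold with one null set
  of times for all radii and all parameter sets; this is why it is first made pointwise in
  \<open>(t, y)\<close> and integrated in \<open>y\<close> only at the end.\<close>

abbreviation smooth :: "('a::euclidean_space \<Rightarrow> real) \<Rightarrow> bool" where
  "smooth \<phi> \<equiv> \<forall>k. Ck_on k UNIV \<phi>"

section \<open>Calculus of the classes C^k\<close>

lemma Ck_on_const: "Ck_on k S (\<lambda>x. c)"
proof (induction k arbitrary: c)
  case (Suc k)
  show ?case
    unfolding Ck_on.simps by (rule exI[of _ "\<lambda>x v. 0"]) (auto simp: Suc)
qed simp

lemma Ck_on_Suc_imp: "Ck_on (Suc k) S g \<Longrightarrow> Ck_on k S g"
proof (induction k arbitrary: g)
  case 0
  then show ?case
    by (auto simp: continuous_on_eq_continuous_within intro: has_derivative_continuous)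
next
  case (Suc k)
  then show ?case
    by (metis Ck_on.simps(2))
qed

lemma Ck_on_imp_continuous: "Ck_on k S g \<Longrightarrow> continuous_on S g"
  by (induction k) (simp_all add: Ck_on_Suc_imp del: Ck_on.simps(2))

lemma Ck_on_add: "Ck_on k S g \<Longrightarrow> Ck_on k S h \<Longrightarrow> Ck_on k S (\<lambda>x. g x + h x)"
proof (induction k arbitrary: g h)
  case 0
  then show ?case by (auto intro: continuous_intros)
next
  case (Suc k)
  from Suc.prems obtain g' h' where
    g: "\<forall>x\<in>S. (g has_derivative g' x) (at x within S)" "\<forall>v. Ck_on k S (\<lambda>x. g' x v)" and
    h: "\<forall>x\<in>S. (h has_derivative h' x) (at x within S)" "\<forall>v. Ck_on k S (\<lambda>x. h' x v)"
    by auto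
  show ?case
    unfolding Ck_on.simps
    by (rule exI[of _ "\<lambda>x v. g' x v + h' x v"]) (use g h Suc.IH in \<open>auto intro: has_derivative_add\<close>)
qed

lemma Ck_on_mult: "Ck_on k S g \<Longrightarrow> Ck_on k S h \<Longrightarrow> Ck_on k S (\<lambda>x. g x * h x)"
proof (induction k arbitrary: g h)
  case 0
  then show ?case by (auto intro: continuous_intros)
next
  case (Suc k)
  from Suc.prems obtain g' h' where
    g: "\<forall>x\<in>S. (g has_derivative g' x) (at x within S)" "\<forall>v. Ck_on k S (\<lambda>x. g' x v)" and
    h: "\<forall>x\<in>S. (h has_derivative h' x) (at x within S)" "\<forall>v. Ck_on k S (\<lambda>x. h' x v)"
    by auto
  have "Ck_on k S g" "Ck_on k S h"
    using Suc.prems Ck_on_Suc_imp by blast+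
  then have "Ck_on k S (\<lambda>x. g x * h' x v + g' x v * h x)" for v
    using g h Suc.IH by (auto intro: Ck_on_add)
  then show ?case
    unfolding Ck_on.simps
    by (intro exI[of _ "\<lambda>x v. g x * h' x v + g' x v * h x"]) (use g h in \<open>auto intro: has_derivative_mult\<close>)
qed

lemma Ck_on_prod: "finite A \<Longrightarrow> (\<And>a. a \<in> A \<Longrightarrow> Ck_on k S (g a)) \<Longrightarrow> Ck_on k S (\<lambda>x. \<Prod>a\<in>A. g a x)"
  by (induction A rule: finite_induct) (auto simp: Ck_on_const Ck_on_mult)

text \<open>Translated and reflected kernels, rescaled bumps, coordinate projections and the edges
  of the cone are all compositions with affine maps, so no general chain rule for
  \<open>Ck_on\<close> is called for.\<close>

lemma Ck_on_affine:
  fixes L :: "'b::euclidean_space \<Rightarrow> 'a::euclidean_space"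
  assumes "bounded_linear L"
  shows "Ck_on k UNIV g \<Longrightarrow> Ck_on k UNIV (\<lambda>x. g (L x + c))"
proof (induction k arbitrary: g)
  case 0
  show ?case
    using 0 assms by (auto intro!: continuous_intros continuous_on_compose2[of UNIV g]
        simp: linear_continuous_on)
next
  case (Suc k)
  then obtain g' where
    g: "\<forall>x. (g has_derivative g' x) (at x)" "\<forall>v. Ck_on k UNIV (\<lambda>x. g' x v)"
    by auto
  have "((\<lambda>x. g (L x + c)) has_derivative (\<lambda>v. g' (L x + c) (L v))) (at x)" for x
  proof -
    have "((\<lambda>x. L x + c) has_derivative L) (at x)"
      using assms by (auto intro!: derivative_eq_intros bounded_linear_imp_has_derivative)
    from has_derivative_compose[OF this, of g "g' (L x + c)"] show ?thesis
      using g(1) by simp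
  qed
  then show ?case
    unfolding Ck_on.simps
    by (intro exI[of _ "\<lambda>x v. g' (L x + c) (L v)"]) (use g Suc.IH in \<open>auto\<close>)
qed

lemma Ck_on_Suc_real:
  fixes g :: "real \<Rightarrow> real"
  assumes "\<And>x. x \<in> S \<Longrightarrow> (g has_real_derivative g' x) (at x within S)" "Ck_on k S g'"
  shows "Ck_on (Suc k) S g"
  unfolding Ck_on.simps
  by (rule exI[of _ "\<lambda>x v. g' x * v"])
     (use assms in \<open>auto simp: has_field_derivative_def intro!: Ck_on_mult Ck_on_const\<close>)

text \<open>The time cutoffs are known only as primitives, so their smoothness is read off from that
  of the derivative.\<close>

lemma smooth_antiderivative:
  fixes g :: "real \<Rightarrow> real"
  assumes "\<And>x. (g has_real_derivative g' x) (at x)" "smooth g'"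
  shows "smooth g"
proof
  fix k show "Ck_on k UNIV g"
    using Ck_on_Suc_real[of UNIV g g' k] Ck_on_Suc_imp[of k UNIV g] assms by blast
qed

lemma smooth_continuous: "smooth g \<Longrightarrow> continuous_on UNIV g"
  using Ck_on_imp_continuous by blast

lemma smooth_has_derivative:
  fixes \<phi> :: "'a::euclidean_space \<Rightarrow> real"
  assumes "smooth \<phi>"
  obtains \<phi>' where "\<And>p. (\<phi> has_derivative \<phi>' p) (at p)" "\<And>v. continuous_on UNIV (\<lambda>p. \<phi>' p v)"
proof -
  have "Ck_on (Suc 0) UNIV \<phi>" using assms by blast
  then show ?thesis using that by auto
qed

text \<open>All derivatives of \<open>exp (-1/x)\<close> are combinations of these functions, which vanish to infinite
  order at \<open>0\<close>.\<close>

definition flat :: "nat \<Rightarrow> real \<Rightarrow> real" where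
  "flat j x = (if x \<le> 0 then 0 else (1/x)^j * exp (-1/x))"

lemma flat_tendsto_0: "(flat j \<longlongrightarrow> 0) (at 0)"
proof -
  have "((\<lambda>x. flat j x) \<longlongrightarrow> 0) (at_right 0)"
  proof -
    have "((\<lambda>x::real. (inverse x)^j / exp (inverse x)) \<longlongrightarrow> 0) (at_right 0)"
      by (rule filterlim_compose[OF tendsto_power_div_exp_0 filterlim_inverse_at_top_right])
    moreover have "\<forall>\<^sub>F x in at_right 0. (inverse x)^j / exp (inverse x) = flat j x"
      by (rule eventually_at_rightI[of 0 1])
         (auto simp: flat_def exp_minus field_simps)
    ultimately show ?thesis
      by (rule Lim_transform_eventually)
  qed
  moreover have "((\<lambda>x. flat j x) \<longlongrightarrow> 0) (at_left 0)"
    by (rule Lim_transform_eventually[OF tendsto_const])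
       (rule eventually_at_leftI[of "-1" 0], auto simp: flat_def)
  ultimately show ?thesis
    by (simp add: filterlim_split_at)
qed

lemma flat_has_derivative:
  "(flat j has_real_derivative (flat (j+2) x - real j * flat (j+1) x)) (at x)"
proof -
  consider "x < 0" | "x = 0" | "x > 0" by linarith
  then show ?thesis
  proof cases
    case 1
    have "((\<lambda>x. 0) has_real_derivative 0) (at x)" by simp
    then have "(flat j has_real_derivative 0) (at x)"
      by (rule has_field_derivative_transform_within_open[of _ _ _ "{..<0}"])
         (use 1 in \<open>auto simp: flat_def\<close>)
    then show ?thesis using 1 by (simp add: flat_def)
  next
    case 2
    \<comment> \<open>At 0 the difference quotient of \<open>flat j\<close> is
      \<open>flat (Suc j)\<close>, so the limit 0 of the whole family also gives its derivatives
      there.\<close>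
    have "((\<lambda>h. (flat j (0 + h) - flat j 0) / h) \<longlongrightarrow> 0) (at 0)"
    proof (rule Lim_transform_eventually[OF flat_tendsto_0[of "Suc j"]])
      show "\<forall>\<^sub>F h in at 0. flat (Suc j) h = (flat j (0 + h) - flat j 0) / h"
        by (auto simp: flat_def eventually_at_filter)
    qed
    then show ?thesis using 2 by (simp add: DERIV_def flat_def)
  next
    case 3
    have inv: "((\<lambda>x. 1/x) has_real_derivative (- ((1/x)^2))) (at x)"
      using 3 by (auto intro!: derivative_eq_intros simp: power2_eq_square)
    have pow: "((\<lambda>x. (1/x)^j) has_real_derivative (- real j * (1/x)^(j+1))) (at x)"
    proof (cases j)
      case (Suc i)
      have "((\<lambda>x. (1/x)^Suc i) has_real_derivative ((1 + real i) * (- ((1/x)^2) * (1/x)^i))) (at x)"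
        by (rule DERIV_power_Suc[OF inv])
      moreover have "(1 + real i) * (- (y^2) * y^i) = - real (Suc i) * y^(Suc i + 1)" for y :: real
        by (simp add: power2_eq_square algebra_simps)
      ultimately show ?thesis
        unfolding Suc by metis
    qed simp
    have ex: "((\<lambda>x. exp (-1/x)) has_real_derivative ((1/x)^2 * exp (-1/x))) (at x)"
      using 3 by (auto intro!: derivative_eq_intros simp: power2_eq_square)
    have "((\<lambda>x. (1/x)^j * exp (-1/x)) has_real_derivative (flat (j+2) x - real j * flat (j+1) x)) (at x)"
      using DERIV_mult[OF pow ex] 3 by (simp add: flat_def algebra_simps power_add power2_eq_square)
    then show ?thesis
      by (rule has_field_derivative_transform_within_open[of _ _ _ "{0<..}"])
         (use 3 in \<open>auto simp: flat_def\<close>)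
  qed
qed

text \<open>Differentiation maps the family \<open>flat j\<close> into its own linear span, so the
  induction on the order of the derivative keeps \<open>j\<close> arbitrary.\<close>

lemma smooth_flat: "smooth (flat j)"
proof
  fix k show "Ck_on k UNIV (flat j)"
  proof (induction k arbitrary: j)
    case 0
    show ?case
      using flat_has_derivative[of j]
      by (auto intro!: DERIV_isCont simp: continuous_on_eq_continuous_at)
  next
    case (Suc k)
    have "Ck_on k UNIV (\<lambda>x. flat (j+2) x + (- real j) * flat (j+1) x)"
      by (intro Ck_on_add Ck_on_mult Ck_on_const Suc)
    then show ?case
      using flat_has_derivative[of j] by (intro Ck_on_Suc_real) auto
  qed
qed

lemma flat_nonneg: "0 \<le> flat j x"
  by (simp add: flat_def)

lemma flat_0_le_1: "flat 0 x \<le> 1"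
  by (simp add: flat_def)

lemma flat_0_eq_0_iff: "flat 0 x = 0 \<longleftrightarrow> x \<le> 0"
  by (simp add: flat_def)

lemma flat_0_mono: "x \<le> y \<Longrightarrow> flat 0 x \<le> flat 0 y"
  by (auto simp: flat_def field_simps)

section \<open>Bump functions supported in boxes\<close>

definition bump :: "'a::euclidean_space \<Rightarrow> 'a \<Rightarrow> 'a \<Rightarrow> real" where
  "bump a b y = (\<Prod>i\<in>Basis. flat 0 (y \<bullet> i - a \<bullet> i) * flat 0 (b \<bullet> i - y \<bullet> i))"

lemma smooth_bump: "smooth (bump a b)"
proof -
  have "Ck_on k UNIV (\<lambda>y::'a. flat 0 (y \<bullet> i - a \<bullet> i) * flat 0 (b \<bullet> i - y \<bullet> i))" for i k
  proof -
    have "Ck_on k UNIV (\<lambda>y::'a. flat 0 ((\<lambda>y. y \<bullet> i) y + - (a \<bullet> i)))"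
      by (rule Ck_on_affine) (auto simp: smooth_flat bounded_linear_inner_left)
    moreover have "Ck_on k UNIV (\<lambda>y::'a. flat 0 ((\<lambda>y. - (y \<bullet> i)) y + b \<bullet> i))"
      by (rule Ck_on_affine) (auto simp: smooth_flat intro: bounded_linear_minus bounded_linear_inner_left)
    ultimately show ?thesis
      using Ck_on_mult by fastforce
  qed
  then have "Ck_on k UNIV (\<lambda>y::'a. \<Prod>i\<in>Basis. flat 0 (y \<bullet> i - a \<bullet> i) * flat 0 (b \<bullet> i - y \<bullet> i))" for k
    by (intro Ck_on_prod) auto
  then show ?thesis
    unfolding bump_def[abs_def] by blast
qed

lemma bump_nonneg: "0 \<le> bump a b y"
  by (auto simp: bump_def intro!: prod_nonneg mult_nonneg_nonneg flat_nonneg)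

lemma bump_le_1: "bump a b y \<le> 1"
  unfolding bump_def
  by (intro prod_le_1) (auto intro!: mult_le_one mult_nonneg_nonneg flat_nonneg flat_0_le_1)

lemma bump_eq_0_iff: "bump a b y = 0 \<longleftrightarrow> y \<notin> box a b"
proof -
  have "bump a b y = 0 \<longleftrightarrow> (\<exists>i\<in>Basis. y \<bullet> i \<le> a \<bullet> i \<or> b \<bullet> i \<le> y \<bullet> i)"
    by (simp add: bump_def flat_0_eq_0_iff)
  then show ?thesis
    unfolding mem_box by (meson not_le)
qed

section \<open>Approximate identities\<close>

text \<open>Almost all integrands below are bounded with bounded support, so this criterion settles
  their integrability.\<close>

lemma integrable_bounded_support:
  fixes g :: "'a::euclidean_space \<Rightarrow> real"
  assumes g: "g \<in> borel_measurable borel" and C: "\<And>x. x \<in> S \<Longrightarrow> \<bar>g x\<bar> \<le> C"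
    and S: "bounded S" and 0: "\<And>x. x \<notin> S \<Longrightarrow> g x = 0"
  shows "integrable lborel g"
proof -
  obtain B where B: "S \<subseteq> cball 0 B"
    using bounded_subset_ballD[OF S(1), of 0] ball_subset_cball[of 0] by blast
  have ind: "integrable lborel (indicator (cball 0 B) :: 'a \<Rightarrow> real)"
    by (rule integrable_real_indicator) (simp, rule emeasure_lborel_cball_finite)
  have le: "norm (g x) \<le> norm (\<bar>C\<bar> * indicator (cball 0 B) x :: real)" for x
  proof (cases "x \<in> S")
    case True
    then have "indicator (cball 0 B) x = (1::real)" using B by auto
    then show ?thesis using C[OF True] by simp
  next
    case False
    then show ?thesis using 0 by simp
  qed
  show ?thesis
    by (rule Bochner_Integration.integrable_bound[OF integrable_mult_right[OF ind, of "\<bar>C\<bar>"]])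
       (simp add: g, rule AE_I2, rule le)
qed

lemma lborel_integral_shift:
  fixes g :: "'a::euclidean_space \<Rightarrow> real"
  assumes "g \<in> borel_measurable borel"
  shows "(\<integral>x. g (x + z) \<partial>lborel) = (\<integral>x. g x \<partial>lborel)"
proof -
  have "(\<integral>x. g x \<partial>lborel) = (\<integral>x. g x \<partial>distr lborel borel ((+) z))"
    by (simp add: lborel_distr_plus)
  also have "\<dots> = (\<integral>x. g (z + x) \<partial>lborel)"
    using assms by (intro integral_distr) auto
  finally show ?thesis by (simp add: add.commute)
qed

lemma lborel_integrable_shift:
  fixes g :: "'a::euclidean_space \<Rightarrow> real"
  assumes "integrable lborel g"
  shows "integrable lborel (\<lambda>x. g (x + z))"
proof -
  have "integrable (distr lborel borel ((+) z)) g"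
    using assms by (simp add: lborel_distr_plus)
  then show ?thesis
    using assms by (subst (asm) integrable_distr_eq) (auto simp: add.commute)
qed

lemma lborel_integral_reflect:
  fixes g :: "'a::euclidean_space \<Rightarrow> real"
  assumes "g \<in> borel_measurable borel"
  shows "(\<integral>x. g (- x) \<partial>lborel) = (\<integral>x. g x \<partial>lborel)"
proof -
  have "distr lborel borel uminus = (lborel :: 'a measure)"
    using lborel_affine[of "-1" "0::'a"] by (simp add: density_1)
  then have "(\<integral>x. g x \<partial>lborel) = (\<integral>x. g x \<partial>distr lborel borel uminus)"
    by simp
  also have "\<dots> = (\<integral>x. g (- x) \<partial>lborel)"
    using assms by (intro integral_distr) auto
  finally show ?thesis by simp
qed

section \<open>Continuity of translations in L1\<close>

definition translation_modulus :: "('a::euclidean_space \<Rightarrow> real) \<Rightarrow> 'a \<Rightarrow> real" where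
  "translation_modulus w z = (\<integral>x. \<bar>w (x + z) - w x\<bar> \<partial>lborel)"

text \<open>Translation preserves the integral, so replacing \<open>f\<close> by \<open>g\<close>
  costs the L1 distance once at \<open>x\<close> and once at \<open>x + z\<close>.\<close>

lemma translation_modulus_triangle:
  assumes f: "integrable lborel f" and g: "integrable lborel g"
  shows "translation_modulus f z \<le> translation_modulus g z + 2 * (\<integral>x. \<bar>f x - g x\<bar> \<partial>lborel)"
proof -
  note sh = lborel_integrable_shift[of _ z]
  have d: "integrable lborel (\<lambda>x. \<bar>f x - g x\<bar>)" using f g by auto
  have [measurable]: "f \<in> borel_measurable borel" "g \<in> borel_measurable borel"
    using f g by auto
  have "translation_modulus f z
      \<le> (\<integral>x. \<bar>g (x + z) - g x\<bar> + (\<bar>f (x + z) - g (x + z)\<bar> + \<bar>f x - g x\<bar>) \<partial>lborel)"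
    unfolding translation_modulus_def
    using sh[OF f] sh[OF g] f g
    by (intro integral_mono) (auto intro!: Bochner_Integration.integrable_add integrable_abs Bochner_Integration.integrable_diff)
  also have "\<dots> = translation_modulus g z + ((\<integral>x. \<bar>f (x + z) - g (x + z)\<bar> \<partial>lborel) + (\<integral>x. \<bar>f x - g x\<bar> \<partial>lborel))"
    unfolding translation_modulus_def
    using sh[OF f] sh[OF g] f g by simp
  also have "(\<integral>x. \<bar>f (x + z) - g (x + z)\<bar> \<partial>lborel) = (\<integral>x. \<bar>f x - g x\<bar> \<partial>lborel)"
    by (rule lborel_integral_shift) simp
  finally show ?thesis by simp
qed

lemma translation_modulus_nonneg: "0 \<le> translation_modulus w z"
  by (simp add: translation_modulus_def)

text \<open>The functions whose translates converge in L1 form a closed set. This carries the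
  property from open sets to Borel sets and from simple functions to integrable ones.\<close>

lemma translation_modulus_approx:
  assumes f: "integrable lborel f"
    and approx: "\<And>e. e > 0 \<Longrightarrow> \<exists>g. integrable lborel g \<and> (\<integral>x. \<bar>f x - g x\<bar> \<partial>lborel) < e \<and>
      (\<lambda>n. translation_modulus g (X n)) \<longlonglongrightarrow> 0"
  shows "(\<lambda>n. translation_modulus f (X n)) \<longlonglongrightarrow> 0"
proof (rule LIMSEQ_I)
  fix r :: real assume "r > 0"
  then obtain g where g: "integrable lborel g" "(\<integral>x. \<bar>f x - g x\<bar> \<partial>lborel) < r/4"
    and X: "(\<lambda>n. translation_modulus g (X n)) \<longlonglongrightarrow> 0"
    using approx[of "r/4"] by auto
  from LIMSEQ_D[OF X, of "r/2"] \<open>r > 0\<close> obtain N where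
    N: "\<And>n. n \<ge> N \<Longrightarrow> \<bar>translation_modulus g (X n)\<bar> < r/2" by auto
  have "norm (translation_modulus f (X n) - 0) < r" if "n \<ge> N" for n
    using translation_modulus_triangle[OF f g(1), of "X n"] N[OF that] g(2)
      translation_modulus_nonneg[of f "X n"] by auto
  then show "\<exists>no. \<forall>n\<ge>no. norm (translation_modulus f (X n) - 0) < r" by blast
qed

text \<open>For open \<open>U\<close> the indicator is lower semicontinuous, so the positive part of
  \<open>1\<^sub>U(x) - 1\<^sub>U(x + z)\<close> tends to \<open>0\<close> pointwise; the two indicators have equal integrals.\<close>

lemma translation_modulus_open:
  fixes U :: "'a::euclidean_space set"
  assumes U: "open U" "emeasure lborel U < \<infinity>" and X: "X \<longlonglongrightarrow> 0"
  shows "(\<lambda>n. translation_modulus (indicator U) (X n)) \<longlonglongrightarrow> 0"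
proof -
  let ?w = "indicator U :: 'a \<Rightarrow> real"
  have [measurable]: "U \<in> sets borel" using U by simp
  have w: "integrable lborel ?w" using U by simp
  have eq: "translation_modulus ?w z = 2 * (\<integral>x. max 0 (?w x - ?w (x + z)) \<partial>lborel)" for z
  proof -
    have i: "integrable lborel (\<lambda>x. max 0 (?w x - ?w (x + z)))"
      using w lborel_integrable_shift[OF w, of z] by (intro integrable_max) auto
    have "translation_modulus ?w z = (\<integral>x. 2 * max 0 (?w x - ?w (x + z)) + (?w (x + z) - ?w x) \<partial>lborel)"
      unfolding translation_modulus_def by (rule Bochner_Integration.integral_cong) (auto simp: indicator_def)
    also have "\<dots> = 2 * (\<integral>x. max 0 (?w x - ?w (x + z)) \<partial>lborel) + ((\<integral>x. ?w (x + z) \<partial>lborel) - (\<integral>x. ?w x \<partial>lborel))"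
      using i w lborel_integrable_shift[OF w, of z] by simp
    also have "(\<integral>x. ?w (x + z) \<partial>lborel) = (\<integral>x. ?w x \<partial>lborel)"
      by (rule lborel_integral_shift) simp
    finally show ?thesis by simp
  qed
  have "(\<lambda>n. \<integral>x. max 0 (?w x - ?w (x + X n)) \<partial>lborel) \<longlonglongrightarrow> (\<integral>x. (0::real) \<partial>(lborel :: 'a measure))"
  proof (rule integral_dominated_convergence[where w="?w"])
    show "AE x in lborel. (\<lambda>n. max 0 (?w x - ?w (x + X n))) \<longlonglongrightarrow> 0"
    proof (rule AE_I2)
      fix x :: 'a
      have "\<forall>\<^sub>F n in sequentially. max 0 (?w x - ?w (x + X n)) = 0"
      proof (cases "x \<in> U")
        case True
        have "(\<lambda>n. x + X n) \<longlonglongrightarrow> x + 0" by (intro tendsto_intros X)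
        then have "\<forall>\<^sub>F n in sequentially. x + X n \<in> U"
          using U(1) True by (auto dest: topological_tendstoD)
        then show ?thesis by eventually_elim (simp add: True)
      qed simp
      then show "(\<lambda>n. max 0 (?w x - ?w (x + X n))) \<longlonglongrightarrow> 0"
        by (simp add: tendsto_eventually)
    qed
    show "AE x in lborel. norm (max 0 (?w x - ?w (x + X n))) \<le> ?w x" for n
      by (rule AE_I2) (auto simp: indicator_def)
  qed (use w in auto)
  then show ?thesis
    unfolding eq by (auto intro: tendsto_mult_right_zero)
qed

text \<open>Induction over integrable functions. Borel sets are reduced to open ones by outer
  regularity, in place of the density of continuous functions in L1.\<close>

lemma translation_modulus_tendsto_0:
  fixes f :: "'a::euclidean_space \<Rightarrow> real"
  assumes f: "integrable lborel f" and X: "X \<longlonglongrightarrow> 0"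
  shows "(\<lambda>n. translation_modulus f (X n)) \<longlonglongrightarrow> 0"
  using f
proof (induction rule: integrable_induct)
  case (base A c)
  have A: "A \<in> sets borel" using base by simp
  have ind: "(\<lambda>n. translation_modulus (indicator A) (X n)) \<longlonglongrightarrow> 0"
  proof (rule translation_modulus_approx)
    show "integrable lborel (indicator A :: 'a \<Rightarrow> real)" using base by simp
    fix e :: real assume "e > 0"
    then obtain U where U: "open U" "A \<subseteq> U" "emeasure lborel (U - A) < ennreal e"
      using outer_regular_lborel[OF A, of e] by auto
    have fin: "emeasure lborel U < \<infinity>"
    proof -
      have "emeasure lborel U \<le> emeasure lborel A + emeasure lborel (U - A)"
        using U A by (metis Diff_partition emeasure_subadditive sets_lborel borel_open sets.Diff)
      also have "\<dots> < \<infinity>" using base U(3) by (auto simp: ennreal_add_less_top intro: order_less_trans)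
      finally show ?thesis .
    qed
    have "(\<integral>x. \<bar>indicat_real A x - indicat_real U x\<bar> \<partial>lborel) = (\<integral>x. indicat_real (U - A) x \<partial>lborel)"
      using U(2) by (intro Bochner_Integration.integral_cong) (auto simp: indicator_def)
    also have "\<dots> = measure lborel (U - A)" by simp
    also have "\<dots> < e"
    proof -
      have "emeasure lborel (U - A) \<noteq> top" using U(3) by auto
      from emeasure_eq_ennreal_measure[OF this] show ?thesis
        using U(3) by (simp add: ennreal_less_iff)
    qed
    finally have "(\<integral>x. \<bar>indicat_real A x - indicat_real U x\<bar> \<partial>lborel) < e" .
    moreover have "integrable lborel (indicator U :: 'a \<Rightarrow> real)" using U(1) fin by simp
    ultimately show "\<exists>g. integrable lborel g \<and> (\<integral>x. \<bar>indicator A x - g x\<bar> \<partial>lborel) < e \<and>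
      (\<lambda>n. translation_modulus g (X n)) \<longlonglongrightarrow> 0"
      using translation_modulus_open[OF U(1) fin X] by blast
  qed
  have "translation_modulus (\<lambda>x. indicator A x *\<^sub>R c) z = \<bar>c\<bar> * translation_modulus (indicator A) z" for z
    unfolding translation_modulus_def
    by (subst integral_mult_right_zero[symmetric])
       (auto simp: abs_mult[symmetric] algebra_simps intro!: Bochner_Integration.integral_cong)
  then show ?case using tendsto_mult_right_zero[OF ind] by simp
next
  case (add f g)
  have le: "translation_modulus (\<lambda>x. f x + g x) z \<le> translation_modulus f z + translation_modulus g z" for z
  proof -
    note sh = lborel_integrable_shift[OF add.hyps(1), of z] lborel_integrable_shift[OF add.hyps(2), of z]
    have "translation_modulus (\<lambda>x. f x + g x) z \<le> (\<integral>x. \<bar>f (x + z) - f x\<bar> + \<bar>g (x + z) - g x\<bar> \<partial>lborel)"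
      unfolding translation_modulus_def using sh add.hyps by (intro integral_mono) auto
    also have "\<dots> = translation_modulus f z + translation_modulus g z"
      unfolding translation_modulus_def using sh add.hyps by (intro Bochner_Integration.integral_add) auto
    finally show ?thesis .
  qed
  have "(\<lambda>n. translation_modulus f (X n) + translation_modulus g (X n)) \<longlonglongrightarrow> 0"
    using tendsto_add[OF add.IH] by simp
  then show ?case
    by (rule real_tendsto_sandwich[OF _ _ tendsto_const, rotated 2]) (auto simp: le translation_modulus_nonneg)
next
  case (lim f s)
  \<comment> \<open>The simple functions satisfy
    \<open>\<bar>s i x\<bar> \<le> 2 * \<bar>f x\<bar>\<close>, so
    \<open>3 * \<bar>f x\<bar>\<close> dominates the differences.\<close>
  have "(\<lambda>i. \<integral>x. \<bar>f x - s i x\<bar> \<partial>lborel) \<longlonglongrightarrow> (\<integral>x. 0 \<partial>(lborel :: 'a measure))"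
  proof (rule integral_dominated_convergence[where w="\<lambda>x. 3 * \<bar>f x\<bar>"])
    show "AE x in lborel. (\<lambda>i. \<bar>f x - s i x\<bar>) \<longlonglongrightarrow> 0"
    proof (rule AE_I2)
      fix x
      have "(\<lambda>i. \<bar>f x - s i x\<bar>) \<longlonglongrightarrow> \<bar>f x - f x\<bar>"
        by (intro tendsto_intros) (use lim in auto)
      then show "(\<lambda>i. \<bar>f x - s i x\<bar>) \<longlonglongrightarrow> 0" by simp
    qed
    show "AE x in lborel. norm \<bar>f x - s i x\<bar> \<le> 3 * \<bar>f x\<bar>" for i
    proof (rule AE_I2)
      fix x
      have "\<bar>s i x\<bar> \<le> 2 * \<bar>f x\<bar>" using lim.hyps(3)[of x i] by simp
      then show "norm \<bar>f x - s i x\<bar> \<le> 3 * \<bar>f x\<bar>" by (simp add: abs_if split: if_splits)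
    qed
  qed (use lim in auto)
  then have conv: "(\<lambda>i. \<integral>x. \<bar>f x - s i x\<bar> \<partial>lborel) \<longlonglongrightarrow> 0" by simp
  show ?case
  proof (rule translation_modulus_approx)
    fix e :: real assume "e > 0"
    from LIMSEQ_D[OF conv this] obtain i where "\<bar>\<integral>x. \<bar>f x - s i x\<bar> \<partial>lborel\<bar> < e" by auto
    then show "\<exists>g. integrable lborel g \<and> (\<integral>x. \<bar>f x - g x\<bar> \<partial>lborel) < e \<and>
      (\<lambda>n. translation_modulus g (X n)) \<longlonglongrightarrow> 0"
      using lim by (intro exI[of _ "s i"]) auto
  qed (use lim in auto)
qed

lemma local_translation_small:
  fixes w :: "'a::euclidean_space \<Rightarrow> real"
  assumes w [measurable]: "w \<in> borel_measurable borel" and bd: "\<And>x. \<bar>w x\<bar> \<le> M"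
    and S: "bounded S" "S \<in> sets borel" and "e > 0"
  shows "\<exists>d>0. \<forall>z. norm z < d \<longrightarrow> (\<integral>x. indicator S x * \<bar>w (x + z) - w x\<bar> \<partial>lborel) \<le> e"
proof -
  obtain B where B: "S \<subseteq> cball 0 B"
    using bounded_subset_ballD[OF S(1), of 0] ball_subset_cball[of 0] by blast
  \<comment> \<open>A bounded function need not be integrable, so it is cut off to a ball. The
    margin 1 keeps \<open>x + z\<close> inside for \<open>x\<close> in \<open>S\<close> and
    \<open>norm z < 1\<close>.\<close>
  let ?w = "\<lambda>x. indicator (cball 0 (B + 1)) x * w x"
  have i: "integrable lborel ?w"
    by (rule integrable_bounded_support[of _ "cball 0 (B + 1)" M]) (use bd in \<open>auto simp: indicator_def\<close>)
  have "continuous (at 0) (translation_modulus ?w)"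
    unfolding continuous_at_sequentially
    using translation_modulus_tendsto_0[OF i] by (auto simp: translation_modulus_def o_def)
  then obtain d where d: "d > 0" "\<And>z. norm z < d \<Longrightarrow> \<bar>translation_modulus ?w z\<bar> < e"
    using \<open>e > 0\<close> unfolding continuous_at_eps_delta by (auto simp: translation_modulus_def dist_norm)
  have "(\<integral>x. indicator S x * \<bar>w (x + z) - w x\<bar> \<partial>lborel) \<le> e" if z: "norm z < min d 1" for z
  proof -
    have "(\<integral>x. indicator S x * \<bar>w (x + z) - w x\<bar> \<partial>lborel) \<le> translation_modulus ?w z"
      unfolding translation_modulus_def
    proof (rule integral_mono)
      show "integrable lborel (\<lambda>x. \<bar>?w (x + z) - ?w x\<bar>)"
        using i lborel_integrable_shift[OF i, of z] by auto
      show "integrable lborel (\<lambda>x. indicator S x * \<bar>w (x + z) - w x\<bar>)"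
      proof (rule integrable_bounded_support[of _ S "2 * M"])
        fix x show "\<bar>indicator S x * \<bar>w (x + z) - w x\<bar>\<bar> \<le> 2 * M"
          using bd[of x] bd[of "x+z"] by (auto simp: indicator_def)
      qed (use S in auto)
      fix x
      show "indicator S x * \<bar>w (x + z) - w x\<bar> \<le> \<bar>?w (x + z) - ?w x\<bar>"
      proof (cases "x \<in> S")
        case True
        then have "norm x \<le> B" using B by auto
        moreover have "norm (x + z) \<le> norm x + norm z" by (rule norm_triangle_ineq)
        ultimately show ?thesis using z by (auto simp: indicator_def)
      qed simp
    qed
    also have "\<dots> \<le> e" using d(2)[of z] z by auto
    finally show ?thesis .
  qed
  then show ?thesis using d(1) by (intro exI[of _ "min d 1"]) auto
qed

section \<open>Mollifiers\<close>

text \<open>Smoothness is kept apart: it matters only where a kernel becomes part of a test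
  function, while the limit statements work with continuous kernels.\<close>

definition mollifier :: "real \<Rightarrow> ('a::euclidean_space \<Rightarrow> real) \<Rightarrow> bool" where
  "mollifier d K \<longleftrightarrow> continuous_on UNIV K \<and> (\<forall>z. 0 \<le> K z) \<and> (\<forall>z. K z \<noteq> 0 \<longrightarrow> norm z < d) \<and>
     (\<integral>z. K z \<partial>lborel) = 1"

lemma continuous_bounded_support:
  fixes g :: "'a::euclidean_space \<Rightarrow> real"
  assumes "continuous_on UNIV g" "bounded S" "\<And>x. x \<notin> S \<Longrightarrow> g x = 0"
  obtains C where "C > 0" "\<And>x. \<bar>g x\<bar> \<le> C"
proof -
  obtain B where B: "S \<subseteq> cball 0 B"
    using bounded_subset_ballD[OF assms(2), of 0] ball_subset_cball[of 0] by blast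
  have "compact (g ` cball 0 B)"
    using assms(1) by (intro compact_continuous_image) (auto intro: continuous_on_subset)
  then obtain C where C: "C > 0" "\<And>x. x \<in> cball 0 B \<Longrightarrow> \<bar>g x\<bar> \<le> C"
    using compact_imp_bounded[of "g ` cball 0 B"] unfolding bounded_pos by auto
  have "\<bar>g x\<bar> \<le> C" for x
    using C assms(3)[of x] B by (cases "x \<in> S") auto
  then show ?thesis using that C(1) by blast
qed

lemma integral_pos_continuous:
  fixes g :: "'a::euclidean_space \<Rightarrow> real"
  assumes "continuous_on UNIV g" "integrable lborel g" "\<And>x. 0 \<le> g x" "g a > 0"
  shows "0 < (\<integral>x. g x \<partial>lborel)"
proof -
  have "(\<integral>x. g x \<partial>lborel) \<noteq> 0"
  proof
    assume "(\<integral>x. g x \<partial>lborel) = 0"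
    then have ae: "AE x in lborel. g x = 0"
      using assms by (subst (asm) integral_nonneg_eq_0_iff_AE) auto
    let ?U = "{x. 0 < g x}"
    have op: "open ?U"
      using assms(1) by (intro open_Collect_less) auto
    have "AE x in lborel. x \<notin> ?U" using ae by eventually_elim auto
    then have "emeasure lborel ?U = 0"
      using op by (subst AE_iff_measurable[symmetric, where P="\<lambda>x. x \<notin> ?U"]) auto
    then have "negligible ?U"
      using op by (auto simp: negligible_iff_emeasure0 emeasure_completion)
    then show False
      using open_not_negligible[OF op] assms(4) by auto
  qed
  moreover have "0 \<le> (\<integral>x. g x \<partial>lborel)"
    using assms by (intro integral_nonneg_AE) auto
  ultimately show ?thesis by linarith
qed

lemma integrable_bump: "integrable lborel (bump a b)"
  by (rule integrable_bounded_support[of _ "box a b" 1])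
     (auto simp: bump_nonneg bump_le_1 bump_eq_0_iff intro: borel_measurable_continuous_onI
        smooth_continuous[OF smooth_bump])

lemma bump_integral_pos:
  assumes "box a b \<noteq> {}"
  shows "0 < (\<integral>x. bump a b x \<partial>lborel)"
proof -
  obtain c where "c \<in> box a b" using assms by blast
  then have "bump a b c > 0"
    using bump_eq_0_iff[of a b c] bump_nonneg[of a b c] by linarith
  then show ?thesis
    using integral_pos_continuous[OF smooth_continuous[OF smooth_bump] integrable_bump]
    by (simp add: bump_nonneg)
qed

lemma mollifier_exists:
  assumes "d > 0"
  obtains K :: "'a::euclidean_space \<Rightarrow> real" where "mollifier d K" "smooth K"
proof -
  \<comment> \<open>The Euclidean norm is at most the sum of the absolute values of the coordinates,
    so the cube of half-width \<open>c\<close> lies in the ball of radius \<open>d\<close>.\<close>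
  define c where "c = d / DIM('a)"
  have "c > 0" using assms by (simp add: c_def)
  let ?b = "bump (- (c *\<^sub>R One)) (c *\<^sub>R One) :: 'a \<Rightarrow> real"
  have "0 \<in> box (- (c *\<^sub>R One)) (c *\<^sub>R One :: 'a)"
    using \<open>c > 0\<close> by (auto simp: mem_box inner_Basis inner_sum_left_Basis)
  then have pos: "0 < (\<integral>z. ?b z \<partial>lborel)" by (intro bump_integral_pos) auto
  define K where "K z = (1 / (\<integral>z. ?b z \<partial>lborel)) * ?b z" for z
  have sm: "smooth K"
    unfolding K_def[abs_def] by (intro allI Ck_on_mult Ck_on_const smooth_bump[rule_format])
  have "norm z < d" if "K z \<noteq> 0" for z
  proof -
    have z: "z \<in> box (- (c *\<^sub>R One)) (c *\<^sub>R One)"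
      using that by (auto simp: K_def bump_eq_0_iff)
    have "norm z \<le> (\<Sum>i\<in>Basis. \<bar>z \<bullet> i\<bar>)" by (rule norm_le_l1)
    also have "\<dots> < (\<Sum>i\<in>(Basis::'a set). c)"
    proof (rule sum_strict_mono)
      fix i :: 'a assume "i \<in> Basis"
      then have "- c < z \<bullet> i" "z \<bullet> i < c" using z by (auto simp: mem_box)
      then show "\<bar>z \<bullet> i\<bar> < c" by linarith
    qed auto
    finally show ?thesis by (simp add: c_def)
  qed
  moreover have "(\<integral>z. K z \<partial>lborel) = 1"
    unfolding K_def using pos by simp
  moreover have "0 \<le> K z" for z
    using pos by (simp add: K_def bump_nonneg)
  ultimately have "mollifier d K"
    using smooth_continuous[OF sm] by (auto simp: mollifier_def)
  then show ?thesis using that sm by blast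
qed

lemma mollifier_measurable: "mollifier d K \<Longrightarrow> K \<in> borel_measurable borel"
  by (auto simp: mollifier_def intro: borel_measurable_continuous_onI)

lemma mollifier_bounded:
  assumes "mollifier d K" obtains C where "C > 0" "\<And>z. \<bar>K z\<bar> \<le> C"
proof -
  have "continuous_on UNIV K" "\<And>x. x \<notin> ball 0 d \<Longrightarrow> K x = 0"
    using assms by (auto simp: mollifier_def)
  from continuous_bounded_support[OF this(1) bounded_ball this(2)] show ?thesis
    using that by blast
qed

lemma mollifier_integrable:
  assumes "mollifier d K" shows "integrable lborel K"
proof -
  obtain C where "\<And>z. \<bar>K z\<bar> \<le> C" using mollifier_bounded[OF assms] by blast
  then show ?thesis
    using assms mollifier_measurable[OF assms]
    by (intro integrable_bounded_support[of K "ball 0 d" C]) (auto simp: mollifier_def)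
qed

lemma mollifier_reflect:
  assumes "mollifier d K" shows "mollifier d (\<lambda>z. K (- z))"
proof -
  have "continuous_on UNIV (\<lambda>z. K (- z))"
    using assms by (auto simp: mollifier_def intro!: continuous_on_compose2[of UNIV K] continuous_intros)
  moreover have "norm z < d" if "K (- z) \<noteq> 0" for z
    using assms that unfolding mollifier_def by (metis norm_minus_cancel)
  ultimately show ?thesis
    using assms lborel_integral_reflect[OF mollifier_measurable[OF assms]] by (simp add: mollifier_def)
qed

text \<open>After the substitution \<open>q = p + z\<close> and Fubini, the double integral is an
  average with density \<open>K\<close> of local translation errors, and those with
  \<open>norm z < d\<close> are at most \<open>e\<close>. The radius \<open>d\<close> therefore
  serves all kernels at once.\<close>

lemma mollification_error:
  fixes w :: "'a::euclidean_space \<Rightarrow> real"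
  assumes w [measurable]: "w \<in> borel_measurable borel" and bd: "\<And>x. \<bar>w x\<bar> \<le> M"
    and S: "bounded S" "S \<in> sets borel" and "e > 0"
  shows "\<exists>d>0. \<forall>K. mollifier d K \<longrightarrow>
    (\<integral>p. indicator S p * (\<integral>q. K (q - p) * \<bar>w q - w p\<bar> \<partial>lborel) \<partial>lborel) \<le> e"
proof -
  obtain d where d: "d > 0"
    "\<And>z. norm z < d \<Longrightarrow> (\<integral>x. indicator S x * \<bar>w (x + z) - w x\<bar> \<partial>lborel) \<le> e"
    using local_translation_small[OF w bd S \<open>e > 0\<close>] by blast
  have "(\<integral>p. indicator S p * (\<integral>q. K (q - p) * \<bar>w q - w p\<bar> \<partial>lborel) \<partial>lborel) \<le> e"
    if K: "mollifier d K" for K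
  proof -
    note [measurable] = mollifier_measurable[OF K] S(2)
    obtain C where C: "C > 0" "\<And>z. \<bar>K z\<bar> \<le> C" using mollifier_bounded[OF K] by blast
    have supp: "K z \<noteq> 0 \<Longrightarrow> norm z < d" and nn: "0 \<le> K z" for z using K by (auto simp: mollifier_def)
    have "(\<integral>q. K (q - p) * \<bar>w q - w p\<bar> \<partial>lborel) = (\<integral>z. K z * \<bar>w (p + z) - w p\<bar> \<partial>lborel)" for p
      using lborel_integral_shift[of "\<lambda>q. K (q - p) * \<bar>w q - w p\<bar>" p] by (simp add: add.commute)
    then have "(\<integral>p. indicator S p * (\<integral>q. K (q - p) * \<bar>w q - w p\<bar> \<partial>lborel) \<partial>lborel)
        = (\<integral>p. (\<integral>z. indicator S p * (K z * \<bar>w (p + z) - w p\<bar>) \<partial>lborel) \<partial>lborel)"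
      by simp
    also have "\<dots> = (\<integral>z. (\<integral>p. indicator S p * (K z * \<bar>w (p + z) - w p\<bar>) \<partial>lborel) \<partial>lborel)"
    proof (rule lborel_pair.Fubini_integral[symmetric], unfold lborel_prod)
      show "integrable lborel (\<lambda>(p, z). indicator S p * (K z * \<bar>w (p + z) - w p\<bar>))"
      proof (rule integrable_bounded_support[of _ "S \<times> ball 0 d" "C * (2 * M)"])
        show "(\<lambda>(p, z). indicator S p * (K z * \<bar>w (p + z) - w p\<bar>)) \<in> borel_measurable borel"
          unfolding borel_prod[symmetric] by measurable
        fix x :: "'a \<times> 'a"
        have "\<bar>w (fst x + snd x) - w (fst x)\<bar> \<le> 2 * M"
          using bd[of "fst x"] bd[of "fst x + snd x"] by linarith
        then have "\<bar>K (snd x)\<bar> * \<bar>w (fst x + snd x) - w (fst x)\<bar> \<le> C * (2 * M)"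
          using C by (intro mult_mono) auto
        moreover have "0 \<le> C * (2 * M)" using C bd[of 0] by auto
        ultimately show "\<bar>case x of (p, z) \<Rightarrow> indicator S p * (K z * \<bar>w (p + z) - w p\<bar>)\<bar> \<le> C * (2 * M)"
          by (auto simp: indicator_def abs_mult split: prod.split)
      qed (use S supp in \<open>auto simp: bounded_Times indicator_def\<close>)
    qed
    also have "\<dots> = (\<integral>z. K z * (\<integral>p. indicator S p * \<bar>w (p + z) - w p\<bar> \<partial>lborel) \<partial>lborel)"
      by (simp add: mult.left_commute)
    also have "\<dots> \<le> (\<integral>z. K z * e \<partial>lborel)"
    proof (rule integral_mono_AE')
      show "integrable lborel (\<lambda>z. K z * e)" using mollifier_integrable[OF K] by simp
      show "AE z in lborel. K z * (\<integral>p. indicator S p * \<bar>w (p + z) - w p\<bar> \<partial>lborel) \<le> K z * e"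
      proof (rule AE_I2)
        fix z show "K z * (\<integral>p. indicator S p * \<bar>w (p + z) - w p\<bar> \<partial>lborel) \<le> K z * e"
          using d(2)[of z] supp[of z] nn[of z] by (cases "K z = 0") (auto intro!: mult_left_mono)
      qed
      show "AE z in lborel. 0 \<le> K z * e"
        using nn \<open>e > 0\<close> by auto
    qed
    also have "\<dots> = e" using K by (simp add: mollifier_def)
    finally show ?thesis .
  qed
  then show ?thesis using d(1) by blast
qed

text \<open>This takes the place of Lebesgue's differentiation theorem. Where the mollification is
  nonnegative, the negative part of \<open>g p\<close> is at most the mean of
  \<open>\<bar>g q - g p\<bar>\<close>, and the integral of these means over \<open>S\<close> is
  arbitrarily small. One kernel for each radius suffices, so kernels of product form may be
  chosen.\<close>

lemma nonneg_if_mollified_nonneg: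
  fixes g :: "'a::euclidean_space \<Rightarrow> real"
  assumes g [measurable]: "g \<in> borel_measurable borel" and bd: "\<And>x. \<bar>g x\<bar> \<le> M"
    and S: "bounded S" "S \<in> sets borel"
    and mol: "\<And>d. d > 0 \<Longrightarrow> \<exists>K. mollifier d K \<and> (\<forall>p\<in>S. 0 \<le> (\<integral>q. K (q - p) * g q \<partial>lborel))"
  shows "AE p in lborel. p \<in> S \<longrightarrow> 0 \<le> g p"
proof -
  note [measurable] = S(2)
  let ?n = "\<lambda>p. indicator S p * max 0 (- g p)"
  have int: "integrable lborel ?n"
    by (rule integrable_bounded_support[of _ S M]) (use S bd in \<open>auto simp: indicator_def abs_le_iff intro: order_trans[OF abs_ge_zero bd]\<close>)
  have "(\<integral>p. ?n p \<partial>lborel) \<le> e" if "e > 0" for e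
  proof -
    obtain d where d: "d > 0" and err: "\<And>K. mollifier d K \<Longrightarrow>
        (\<integral>p. indicator S p * (\<integral>q. K (q - p) * \<bar>g q - g p\<bar> \<partial>lborel) \<partial>lborel) \<le> e"
      using mollification_error[OF g bd S \<open>e > 0\<close>] by blast
    obtain K where K: "mollifier d K" and pos: "\<And>p. p \<in> S \<Longrightarrow> 0 \<le> (\<integral>q. K (q - p) * g q \<partial>lborel)"
      using mol[OF d] by blast
    note [measurable] = mollifier_measurable[OF K]
    obtain C where C: "C > 0" "\<And>z. \<bar>K z\<bar> \<le> C" using mollifier_bounded[OF K] by blast
    have supp: "K z \<noteq> 0 \<Longrightarrow> norm z < d" and nn: "0 \<le> K z" for z using K by (auto simp: mollifier_def)
    have "M \<ge> 0" using bd[of 0] by auto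
    have iK: "integrable lborel (\<lambda>q. K (q - p))" for p
      using lborel_integrable_shift[OF mollifier_integrable[OF K], of "-p"] by simp
    have oneK: "(\<integral>q. K (q - p) \<partial>lborel) = 1" for p
      using lborel_integral_shift[of K "-p"] K by (simp add: mollifier_def)
    have ig: "integrable lborel (\<lambda>q. K (q - p) * g q)" for p
    proof (rule Bochner_Integration.integrable_bound)
      show "integrable lborel (\<lambda>q. K (q - p) * M)" using iK by simp
    qed (use bd nn \<open>M \<ge> 0\<close> in \<open>auto simp: abs_mult intro!: mult_left_mono\<close>)
    have id: "integrable lborel (\<lambda>q. K (q - p) * \<bar>g q - g p\<bar>)" for p
    proof -
      have "integrable lborel (\<lambda>q. \<bar>K (q - p) * g q - K (q - p) * g p\<bar>)"
        using ig iK by (intro integrable_abs Bochner_Integration.integrable_diff) auto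
      then show ?thesis using nn by (simp add: right_diff_distrib[symmetric] abs_mult)
    qed
    have le2M: "(\<integral>q. K (q - p) * \<bar>g q - g p\<bar> \<partial>lborel) \<le> 2 * M" for p
    proof -
      have "(\<integral>q. K (q - p) * \<bar>g q - g p\<bar> \<partial>lborel) \<le> (\<integral>q. K (q - p) * (2 * M) \<partial>lborel)"
      proof (rule integral_mono)
        fix q show "K (q - p) * \<bar>g q - g p\<bar> \<le> K (q - p) * (2 * M)"
          using bd[of q] bd[of p] nn by (intro mult_left_mono) auto
      qed (use id iK in auto)
      then show ?thesis using oneK by simp
    qed
    have "(\<integral>p. ?n p \<partial>lborel) \<le> (\<integral>p. indicator S p * (\<integral>q. K (q - p) * \<bar>g q - g p\<bar> \<partial>lborel) \<partial>lborel)"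
    proof (rule integral_mono[OF int])
      show "integrable lborel (\<lambda>p. indicator S p * (\<integral>q. K (q - p) * \<bar>g q - g p\<bar> \<partial>lborel))"
      proof (rule integrable_bounded_support[of _ S "2 * M"])
        fix p
        have "0 \<le> (\<integral>q. K (q - p) * \<bar>g q - g p\<bar> \<partial>lborel)" using nn by (intro integral_nonneg_AE) auto
        then show "\<bar>indicator S p * (\<integral>q. K (q - p) * \<bar>g q - g p\<bar> \<partial>lborel)\<bar> \<le> 2 * M"
          using le2M[of p] \<open>M \<ge> 0\<close> by (auto simp: indicator_def)
      qed (use S in auto)
      fix p
      show "?n p \<le> indicator S p * (\<integral>q. K (q - p) * \<bar>g q - g p\<bar> \<partial>lborel)"
      proof (cases "p \<in> S")
        case True
        have "(\<integral>q. K (q - p) * g q \<partial>lborel) - g p = (\<integral>q. K (q - p) * g q - K (q - p) * g p \<partial>lborel)"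
          using ig iK oneK by simp
        also have "\<dots> \<le> (\<integral>q. K (q - p) * \<bar>g q - g p\<bar> \<partial>lborel)"
        proof (rule integral_mono)
          fix q show "K (q - p) * g q - K (q - p) * g p \<le> K (q - p) * \<bar>g q - g p\<bar>"
            using nn[of "q - p"] by (auto simp: right_diff_distrib[symmetric] intro!: mult_left_mono)
        qed (use ig iK id in auto)
        finally have "- g p \<le> (\<integral>q. K (q - p) * \<bar>g q - g p\<bar> \<partial>lborel)"
          using pos[OF True] by linarith
        moreover have "0 \<le> (\<integral>q. K (q - p) * \<bar>g q - g p\<bar> \<partial>lborel)"
          using nn by (intro integral_nonneg_AE) auto
        ultimately show ?thesis using True by simp
      qed simp
    qed
    also have "\<dots> \<le> e" by (rule err[OF K])
    finally show ?thesis .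
  qed
  then have "(\<integral>p. ?n p \<partial>lborel) \<le> 0" by (rule field_le_epsilon) simp
  moreover have "0 \<le> (\<integral>p. ?n p \<partial>lborel)" by (intro integral_nonneg_AE) auto
  ultimately have "AE p in lborel. ?n p = 0"
    using int by (subst integral_nonneg_eq_0_iff_AE[symmetric]) auto
  then show ?thesis
    by eventually_elim (auto simp: indicator_def max_def split: if_splits)
qed

section \<open>Kruzhkov entropies\<close>

text \<open>Besides the chain rule this yields that no point of \<open>I\<close> is isolated.
  Derivatives within \<open>I\<close> are then unique, and \<open>deriv_in I f\<close> is the
  derivative constructed here.\<close>

lemma composed_flux_C1:
  fixes D :: "(real \<times> real) set" and f1 :: "real \<times> real \<Rightarrow> real"
    and e f :: "real \<Rightarrow> real" and I :: "real set"
  assumes D: "open D" "convex D"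
    and I: "I = fst ` closure D"
    and f1: "Ck_on 2 (closure D) f1"
    and e: "Ck_on 2 I e" "\<forall>v\<in>I. (v, e v) \<in> closure D"
    and f: "\<forall>v\<in>I. f v = f1 (v, e v)"
  obtains f' where "\<And>v. v \<in> I \<Longrightarrow> (f has_real_derivative f' v) (at v within I)"
    "continuous_on I f'" "\<And>v. v \<in> I \<Longrightarrow> at v within I \<noteq> bot" "convex I"
proof -
  have convI: "convex I"
    unfolding I using D by (intro convex_linear_image) (auto intro: linear_fst convex_closure)
  have perfect: "at v within I \<noteq> bot" if v: "v \<in> I" for v
  proof -
    \<comment> \<open>\<open>D\<close> is open, so around each of its points it contains a
      horizontal segment, which projects to more than one point of \<open>I\<close>. A connected set
      with two points has no isolated point.\<close>
    have "I \<noteq> {x}" for x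
    proof
      assume "I = {x}"
      have "D \<noteq> {}" using v unfolding I by auto
      then obtain p where p: "p \<in> D" by blast
      obtain a b where p_eq: "p = (a, b)" by fastforce
      obtain r where r: "r > 0" "ball p r \<subseteq> D"
        using D(1) p open_contains_ball by blast
      have "(a + r/2, b) \<in> D" "(a, b) \<in> D"
        using r p_eq p by (auto simp: dist_prod_def dist_real_def)
      then have "a + r/2 \<in> I" "a \<in> I"
        unfolding I using closure_subset by force+
      then show False using \<open>I = {x}\<close> r(1) by auto
    qed
    then show ?thesis
      using connected_imp_perfect[of I v] convI v by (auto simp: convex_connected trivial_limit_within)
  qed
  obtain g' where g': "\<And>p. p \<in> closure D \<Longrightarrow> (f1 has_derivative g' p) (at p within closure D)"
    and g'c: "\<And>w. continuous_on (closure D) (\<lambda>p. g' p w)"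
    using f1 unfolding numeral_2_eq_2 Ck_on.simps(2)[of "Suc 0"]
    by (metis Ck_on_imp_continuous)
  obtain e' where e': "\<And>v. v \<in> I \<Longrightarrow> (e has_derivative e' v) (at v within I)"
    and e'c: "\<And>w. continuous_on I (\<lambda>v. e' v w)"
    using e(1) unfolding numeral_2_eq_2 Ck_on.simps(2)[of "Suc 0"]
    by (metis Ck_on_imp_continuous)
  \<comment> \<open>The derivative of \<open>f1\<close> along the curve \<open>(v, e v)\<close>,
    whose velocity is \<open>(1, e' v 1)\<close>.\<close>
  define f' where "f' v = g' (v, e v) (1, 0) + e' v 1 * g' (v, e v) (0, 1)" for v
  have der: "(f has_real_derivative f' v) (at v within I)" if v: "v \<in> I" for v
  proof -
    have "((\<lambda>v. (v, e v)) has_derivative (\<lambda>w. (w, e' v w))) (at v within I)"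
      using e'[OF v] by (intro has_derivative_Pair has_derivative_ident)
    moreover have "(f1 has_derivative g' (v, e v)) (at (v, e v) within (\<lambda>v. (v, e v)) ` I)"
      using e(2) v by (intro has_derivative_subset[OF g']) auto
    ultimately have "((\<lambda>v. f1 (v, e v)) has_derivative (\<lambda>w. g' (v, e v) (w, e' v w))) (at v within I)"
      by (rule has_derivative_in_compose)
    then have c: "(f has_derivative (\<lambda>w. g' (v, e v) (w, e' v w))) (at v within I)"
      using f v by (auto intro: has_derivative_transform)
    have lg: "linear (g' (v, e v))" and le: "linear (e' v)"
      using g'[of "(v, e v)"] e(2) e'[OF v] v has_derivative_linear by blast+
    have "g' (v, e v) (w, e' v w) = f' v * w" for w
    proof -
      have e1: "e' v w = w * e' v 1"
        using linear_scale[OF le, of w 1] by simp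
      have "(w, e' v w) = w *\<^sub>R (1, 0) + (w * e' v 1) *\<^sub>R (0, 1)"
        by (simp add: e1)
      then have "g' (v, e v) (w, e' v w) = w * g' (v, e v) (1, 0) + (w * e' v 1) * g' (v, e v) (0, 1)"
        by (simp only: linear_add[OF lg] linear_scale[OF lg]) simp
      then show ?thesis by (simp add: f'_def algebra_simps)
    qed
    with c show ?thesis
      by (simp add: has_field_derivative_def)
  qed
  have "continuous_on I f'"
  proof -
    have ce: "continuous_on I (\<lambda>v. (v, e v))"
      using Ck_on_imp_continuous[OF e(1)] by (intro continuous_intros)
    have "continuous_on I (\<lambda>v. g' (v, e v) w)" for w
      by (rule continuous_on_compose2[OF g'c ce]) (use e(2) in auto)
    then show ?thesis
      unfolding f'_def[abs_def] by (intro continuous_intros e'c)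
  qed
  then show ?thesis using that der perfect convI by blast
qed

section \<open>Smooth approximations of the entropies \<open>\<bar>v - k\<bar>\<close>\<close>

text \<open>Entropies have to be of class C^2, which \<open>\<bar>v - k\<bar>\<close> is not at
  \<open>v = k\<close>. For positive \<epsilon> the square root is smooth and convex, and it exceeds
  \<open>\<bar>v - k\<bar>\<close> by at most \<epsilon>, uniformly in \<open>v\<close> and
  \<open>k\<close>.\<close>

definition kruzkov_entropy :: "real \<Rightarrow> real \<Rightarrow> real \<Rightarrow> real" where
  "kruzkov_entropy k \<epsilon> v = sqrt ((v - k)\<^sup>2 + \<epsilon>\<^sup>2)"

lemma kruzkov_entropy_pos: "\<epsilon> > 0 \<Longrightarrow> 0 < kruzkov_entropy k \<epsilon> v"
  by (simp add: kruzkov_entropy_def add_nonneg_pos)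

lemma kruzkov_entropy_ge: "\<bar>v - k\<bar> \<le> kruzkov_entropy k \<epsilon> v"
  by (auto simp: kruzkov_entropy_def real_sqrt_ge_abs1)

lemma kruzkov_entropy_le: "\<epsilon> > 0 \<Longrightarrow> kruzkov_entropy k \<epsilon> v \<le> \<bar>v - k\<bar> + \<epsilon>"
  unfolding kruzkov_entropy_def using sqrt_sum_squares_le_sum_abs[of "v - k" \<epsilon>] by simp

lemma kruzkov_entropy_at: "\<epsilon> > 0 \<Longrightarrow> kruzkov_entropy k \<epsilon> k = \<epsilon>"
  by (simp add: kruzkov_entropy_def)

lemma kruzkov_entropy_derivative:
  assumes "\<epsilon> > 0"
  shows "(kruzkov_entropy k \<epsilon> has_real_derivative (v - k) / kruzkov_entropy k \<epsilon> v) (at v within S)"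
proof -
  have "0 < (v - k)\<^sup>2 + \<epsilon>\<^sup>2" using assms by (simp add: add_nonneg_pos)
  then show ?thesis
    unfolding kruzkov_entropy_def[abs_def]
    by (auto intro!: derivative_eq_intros simp: field_simps) (simp add: diff_divide_distrib)
qed

lemma kruzkov_entropy_derivative2:
  assumes "\<epsilon> > 0"
  shows "((\<lambda>v. (v - k) / kruzkov_entropy k \<epsilon> v) has_real_derivative \<epsilon>\<^sup>2 / kruzkov_entropy k \<epsilon> v ^ 3) (at v within S)"
proof -
  let ?h = "kruzkov_entropy k \<epsilon> v"
  have pos: "0 < ?h" using kruzkov_entropy_pos[OF assms] .
  have sq: "?h\<^sup>2 = (v - k)\<^sup>2 + \<epsilon>\<^sup>2" by (simp add: kruzkov_entropy_def)
  have "((\<lambda>v. (v - k) / kruzkov_entropy k \<epsilon> v) has_real_derivative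
      (1 * ?h - (v - k) * ((v - k) / ?h)) / (?h * ?h)) (at v within S)"
    by (rule DERIV_divide[OF _ kruzkov_entropy_derivative[OF assms]])
       (use pos in \<open>auto intro!: derivative_eq_intros\<close>)
  moreover have "(1 * ?h - (v - k) * ((v - k) / ?h)) / (?h * ?h) = \<epsilon>\<^sup>2 / ?h ^ 3"
  proof -
    have "(1 * ?h - (v - k) * ((v - k) / ?h)) / (?h * ?h) = (?h\<^sup>2 - (v - k)\<^sup>2) / ?h ^ 3"
      using pos by (simp add: field_simps power2_eq_square power3_eq_cube)
    then show ?thesis by (simp add: sq)
  qed
  ultimately show ?thesis by simp
qed

lemma kruzkov_entropy_continuous: "\<epsilon> > 0 \<Longrightarrow> continuous_on S (kruzkov_entropy k \<epsilon>)"
  unfolding kruzkov_entropy_def[abs_def] by (intro continuous_intros)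

lemma kruzkov_entropy_Ck:
  assumes "\<epsilon> > 0" shows "Ck_on 2 S (kruzkov_entropy k \<epsilon>)"
proof -
  have "continuous_on S (\<lambda>v. \<epsilon>\<^sup>2 / kruzkov_entropy k \<epsilon> v ^ 3)"
    using kruzkov_entropy_pos[OF assms, of k] kruzkov_entropy_continuous[OF assms]
    by (intro continuous_intros) (auto simp: less_imp_neq[symmetric])
  then have "Ck_on (Suc (Suc 0)) S (kruzkov_entropy k \<epsilon>)"
    using kruzkov_entropy_derivative[OF assms] kruzkov_entropy_derivative2[OF assms]
    by (intro Ck_on_Suc_real) auto
  then show ?thesis by (simp add: numeral_2_eq_2)
qed

lemma kruzkov_entropy_convex:
  assumes "\<epsilon> > 0" shows "convex_on UNIV (kruzkov_entropy k \<epsilon>)"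
  using kruzkov_entropy_derivative[OF assms] kruzkov_entropy_derivative2[OF assms]
    kruzkov_entropy_pos[OF assms, of k]
  by (intro f''_ge0_imp_convex[where f'="\<lambda>v. (v - k) / kruzkov_entropy k \<epsilon> v"
        and f''="\<lambda>v. \<epsilon>\<^sup>2 / kruzkov_entropy k \<epsilon> v ^ 3"]) (auto simp: less_imp_le)

lemma kruzkov_entropy_slope:
  assumes "\<epsilon> > 0" shows "\<bar>(v - k) / kruzkov_entropy k \<epsilon> v\<bar> \<le> 1"
  using kruzkov_entropy_ge[of v k \<epsilon>] kruzkov_entropy_pos[OF assms, of k v] by (simp add: abs_divide)

lemma has_integral_abs_bound:
  fixes g h :: "real \<Rightarrow> real"
  assumes "(h has_integral i) S" "(g has_integral j) S" "\<And>x. x \<in> S \<Longrightarrow> \<bar>h x\<bar> \<le> g x"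
  shows "\<bar>i\<bar> \<le> j"
  using integral_norm_bound_integral[of h S g] assms
  by (auto simp: integral_unique has_integral_integrable)

section \<open>The flux on the range of the solutions\<close>

text \<open>Derivatives are taken relative to \<open>I\<close>, where \<open>f'\<close> may be
  unbounded; the bound \<open>L\<close> is asked for only on a part \<open>J\<close> that will
  contain the values of the solutions. Convexity keeps the segment between two values inside
  \<open>J\<close>, so that integrating \<open>f'\<close> along it gives Lipschitz bounds.\<close>

locale scalar_flux =
  fixes I J :: "real set" and f f' :: "real \<Rightarrow> real" and L :: real
  assumes deriv: "\<And>v. v \<in> I \<Longrightarrow> (f has_real_derivative f' v) (at v within I)"
    and cont: "continuous_on I f'" and perfect: "\<And>v. v \<in> I \<Longrightarrow> at v within I \<noteq> bot"
    and J: "J \<subseteq> I" "convex J" and L: "\<And>v. v \<in> J \<Longrightarrow> \<bar>f' v\<bar> \<le> L" "0 \<le> L"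
begin

text \<open>The Kruzhkov flux F(a, b) belonging to the entropy \<open>\<bar>a - b\<bar>\<close>. Its
  symmetry is what allows the inequalities for the two solutions to be added.\<close>

definition kflux :: "real \<Rightarrow> real \<Rightarrow> real" where
  "kflux a b = sgn (a - b) * (f a - f b)"

lemma interval_subset: "a \<in> J \<Longrightarrow> b \<in> J \<Longrightarrow> {a..b} \<subseteq> J"
  using J(2) by (meson atLeastAtMost_iff is_interval_1 is_interval_convex_1 subsetI)

lemma deriv_in_f: "v \<in> I \<Longrightarrow> deriv_in I f v = f' v"
  using deriv perfect
  by (auto intro!: vector_derivative_within simp: has_real_derivative_iff_has_vector_derivative)

lemma deriv_in_entropy:
  "v \<in> I \<Longrightarrow> \<epsilon> > 0 \<Longrightarrow> deriv_in I (kruzkov_entropy k \<epsilon>) v = (v - k) / kruzkov_entropy k \<epsilon> v"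
  using kruzkov_entropy_derivative perfect
  by (auto intro!: vector_derivative_within simp: has_real_derivative_iff_has_vector_derivative)

lemma integral_f':
  assumes "a \<in> J" "b \<in> J" "a \<le> b"
  shows "(f' has_integral (f b - f a)) {a..b}"
proof (rule fundamental_theorem_of_calculus[OF assms(3)])
  fix x assume "x \<in> {a..b}"
  then have "x \<in> I" "{a..b} \<subseteq> I" using interval_subset[OF assms(1,2)] J(1) by auto
  then show "(f has_vector_derivative f' x) (at x within {a..b})"
    using deriv by (auto simp flip: has_real_derivative_iff_has_vector_derivative intro: DERIV_subset)
qed

lemma f_lipschitz:
  assumes "a \<in> J" "b \<in> J" shows "\<bar>f a - f b\<bar> \<le> L * \<bar>a - b\<bar>"
proof -
  have "\<bar>f b - f a\<bar> \<le> L * (b - a)" if ab: "a \<in> J" "b \<in> J" "a \<le> b" for a b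
  proof -
    have "((\<lambda>_. L) has_integral L * (b - a)) {a..b}"
      using has_integral_const_real[of L a b] ab by (simp add: mult.commute)
    then show ?thesis
      using has_integral_abs_bound[OF integral_f'[OF ab]] L(1) interval_subset[OF ab(1,2)] by blast
  qed
  from this[of a b] this[of b a] show ?thesis
    using assms by (cases "a \<le> b") (auto simp: abs_minus_commute)
qed

lemma f_continuous: "continuous_on J f"
  using deriv J(1) by (meson DERIV_continuous continuous_on_eq_continuous_within continuous_on_subset)

lemma kflux_sym: "kflux a b = kflux b a"
  by (auto simp: kflux_def sgn_if)

lemma kflux_bound: "a \<in> J \<Longrightarrow> b \<in> J \<Longrightarrow> \<bar>kflux a b\<bar> \<le> L * \<bar>a - b\<bar>"
  using f_lipschitz[of a b] by (auto simp: kflux_def abs_mult abs_sgn_eq)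

text \<open>If \<open>b\<close> and \<open>c\<close> lie strictly on the same side of
  \<open>a\<close>, the difference is \<open>f b - f c\<close> up to sign. Otherwise
  \<open>a\<close> lies between them, so
  \<open>\<bar>a - b\<bar> + \<bar>a - c\<bar> = \<bar>b - c\<bar>\<close>, and the two fluxes can
  be bounded separately.\<close>

lemma kflux_lipschitz:
  assumes "a \<in> J" "b \<in> J" "c \<in> J" shows "\<bar>kflux a b - kflux a c\<bar> \<le> L * \<bar>b - c\<bar>"
proof -
  note l = f_lipschitz[OF assms(1,2)] f_lipschitz[OF assms(1,3)] f_lipschitz[OF assms(2,3)]
  consider "a < b" "a < c" | "a > b" "a > c" | "b \<le> a" "a \<le> c" | "c \<le> a" "a \<le> b" by linarith
  then show ?thesis
  proof cases
    case 3
    have "\<bar>kflux a b - kflux a c\<bar> \<le> \<bar>f a - f b\<bar> + \<bar>f a - f c\<bar>"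
      using 3 by (auto simp: kflux_def sgn_if)
    also have "\<dots> \<le> L * (\<bar>a - b\<bar> + \<bar>a - c\<bar>)" using l by (simp add: distrib_left)
    also have "\<bar>a - b\<bar> + \<bar>a - c\<bar> = \<bar>b - c\<bar>" using 3 by simp
    finally show ?thesis .
  next
    case 4
    have "\<bar>kflux a b - kflux a c\<bar> \<le> \<bar>f a - f b\<bar> + \<bar>f a - f c\<bar>"
      using 4 by (auto simp: kflux_def sgn_if)
    also have "\<dots> \<le> L * (\<bar>a - b\<bar> + \<bar>a - c\<bar>)" using l by (simp add: distrib_left)
    also have "\<bar>a - b\<bar> + \<bar>a - c\<bar> = \<bar>b - c\<bar>" using 4 by simp
    finally show ?thesis .
  qed (use l(3) in \<open>auto simp: kflux_def abs_minus_commute\<close>)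
qed

context
  fixes k \<epsilon> :: real
  assumes k: "k \<in> J" and \<epsilon>: "\<epsilon> > 0"
begin

definition slope :: "real \<Rightarrow> real" where
  "slope v = (v - k) / kruzkov_entropy k \<epsilon> v"

lemma slope_continuous: "continuous_on S slope"
  unfolding slope_def[abs_def]
  using kruzkov_entropy_pos[OF \<epsilon>, of k] kruzkov_entropy_continuous[OF \<epsilon>]
  by (intro continuous_intros) (auto simp: less_imp_neq[symmetric])

lemma integrand_continuous: "a \<in> J \<Longrightarrow> b \<in> J \<Longrightarrow> continuous_on {a..b} (\<lambda>\<theta>. slope \<theta> * f' \<theta>)"
  using interval_subset[of a b] J(1)
  by (intro continuous_intros slope_continuous continuous_on_subset[OF cont]) auto

lemma integral_slope:
  assumes "a \<le> b"
  shows "(slope has_integral (kruzkov_entropy k \<epsilon> b - kruzkov_entropy k \<epsilon> a)) {a..b}"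
  unfolding slope_def[abs_def]
  by (rule fundamental_theorem_of_calculus[OF assms])
     (use kruzkov_entropy_derivative[OF \<epsilon>] in \<open>auto simp flip: has_real_derivative_iff_has_vector_derivative\<close>)

lemma entropy_flux_eq:
  assumes v: "v \<in> J"
  shows "entropy_flux I f (kruzkov_entropy k \<epsilon>) k v = (LBINT \<theta>=ereal k..ereal v. slope \<theta> * f' \<theta>)"
  unfolding entropy_flux_def
proof (rule interval_integral_cong)
  fix x assume "x \<in> einterval (min (ereal k) (ereal v)) (max (ereal k) (ereal v))"
  then have "x \<in> {min k v..max k v}"
    by (auto simp: einterval_iff min_def max_def split: if_splits)
  then have "x \<in> I"
    using interval_subset[OF k v] interval_subset[OF v k] J(1) by (auto simp: min_def max_def split: if_splits)
  then show "deriv_in I (kruzkov_entropy k \<epsilon>) x * deriv_in I f x = slope x * f' x"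
    by (simp add: deriv_in_f deriv_in_entropy \<epsilon> slope_def)
qed

lemma LBINT_integrand:
  assumes "a \<in> J" "b \<in> J" "a \<le> b"
  shows "(LBINT \<theta>=ereal a..ereal b. slope \<theta> * f' \<theta>) = integral {a..b} (\<lambda>\<theta>. slope \<theta> * f' \<theta>)"
    "((\<lambda>\<theta>. slope \<theta> * f' \<theta>) has_integral integral {a..b} (\<lambda>\<theta>. slope \<theta> * f' \<theta>)) {a..b}"
  using integrand_continuous[OF assms(1,2)] assms(3)
  by (auto intro!: interval_integral_eq_integral borel_integrable_atLeastAtMost'
      integrable_integral integrable_continuous_real)

lemma slope_bound: "\<bar>slope v\<bar> \<le> 1"
  unfolding slope_def by (rule kruzkov_entropy_slope[OF \<epsilon>])

text \<open>For \<open>k \<le> v\<close> the difference is the integral of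
  \<open>(slope \<theta> - 1) * f' \<theta>\<close> from \<open>k\<close> to \<open>v\<close>. The
  primitive of \<open>slope\<close> is the entropy, so \<open>1 - slope\<close> integrates to
  \<open>v - k\<close> minus the increase of the entropy. As the entropy at \<open>v\<close> is at
  least \<open>v - k\<close>, this is at most its value \<epsilon> at \<open>k\<close>. The case
  \<open>v < k\<close> is the mirror image. The bound is uniform in \<open>v\<close> and
  \<open>k\<close>.\<close>

lemma entropy_flux_approx:
  assumes v: "v \<in> J"
  shows "\<bar>entropy_flux I f (kruzkov_entropy k \<epsilon>) k v - kflux v k\<bar> \<le> L * \<epsilon>"
proof (cases "k \<le> v")
  case True
  let ?i = "integral {k..v} (\<lambda>\<theta>. slope \<theta> * f' \<theta>)"
  have 1: "((\<lambda>\<theta>. f' \<theta> - slope \<theta> * f' \<theta>) has_integral (f v - f k - ?i)) {k..v}"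
    by (intro has_integral_diff integral_f' LBINT_integrand k v True)
  have 2: "((\<lambda>\<theta>. L * (1 - slope \<theta>)) has_integral
      (L * ((v - k) - (kruzkov_entropy k \<epsilon> v - kruzkov_entropy k \<epsilon> k)))) {k..v}"
    using has_integral_const_real[of "1::real" k v] True
    by (intro has_integral_mult_right has_integral_diff integral_slope) auto
  have "\<bar>f v - f k - ?i\<bar> \<le> L * ((v - k) - (kruzkov_entropy k \<epsilon> v - kruzkov_entropy k \<epsilon> k))"
  proof (rule has_integral_abs_bound[OF 1 2])
    fix \<theta> assume "\<theta> \<in> {k..v}"
    then have "\<bar>f' \<theta>\<bar> \<le> L" using L(1) interval_subset[OF k v] by blast
    then have "\<bar>f' \<theta>\<bar> * \<bar>1 - slope \<theta>\<bar> \<le> L * (1 - slope \<theta>)"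
      using slope_bound[of \<theta>] by (intro mult_mono) auto
    then show "\<bar>f' \<theta> - slope \<theta> * f' \<theta>\<bar> \<le> L * (1 - slope \<theta>)"
      by (simp add: abs_mult[symmetric] algebra_simps)
  qed
  also have "\<dots> \<le> L * \<epsilon>"
    using kruzkov_entropy_ge[of v k \<epsilon>] kruzkov_entropy_at[OF \<epsilon>, of k] L(2) by (intro mult_left_mono) auto
  moreover have "kflux v k = f v - f k" using True by (auto simp: kflux_def sgn_if)
  ultimately show ?thesis
    using True LBINT_integrand(1)[OF k v] by (simp add: entropy_flux_eq[OF v] abs_minus_commute)
next
  case False
  then have vk: "v \<le> k" by simp
  let ?i = "integral {v..k} (\<lambda>\<theta>. slope \<theta> * f' \<theta>)"
  have 1: "((\<lambda>\<theta>. f' \<theta> + slope \<theta> * f' \<theta>) has_integral (f k - f v + ?i)) {v..k}"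
    by (intro has_integral_add integral_f' LBINT_integrand k v vk)
  have 2: "((\<lambda>\<theta>. L * (1 + slope \<theta>)) has_integral
      (L * ((k - v) + (kruzkov_entropy k \<epsilon> k - kruzkov_entropy k \<epsilon> v)))) {v..k}"
    using has_integral_const_real[of "1::real" v k] vk
    by (intro has_integral_mult_right has_integral_add integral_slope) auto
  have "\<bar>f k - f v + ?i\<bar> \<le> L * ((k - v) + (kruzkov_entropy k \<epsilon> k - kruzkov_entropy k \<epsilon> v))"
  proof (rule has_integral_abs_bound[OF 1 2])
    fix \<theta> assume "\<theta> \<in> {v..k}"
    then have "\<bar>f' \<theta>\<bar> \<le> L" using L(1) interval_subset[OF v k] by blast
    then have "\<bar>f' \<theta>\<bar> * \<bar>1 + slope \<theta>\<bar> \<le> L * (1 + slope \<theta>)"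
      using slope_bound[of \<theta>] by (intro mult_mono) auto
    then show "\<bar>f' \<theta> + slope \<theta> * f' \<theta>\<bar> \<le> L * (1 + slope \<theta>)"
      by (simp add: abs_mult[symmetric] algebra_simps)
  qed
  also have "\<dots> \<le> L * \<epsilon>"
    using kruzkov_entropy_ge[of v k \<epsilon>] kruzkov_entropy_at[OF \<epsilon>, of k] L(2) by (intro mult_left_mono) auto
  moreover have "kflux v k = f k - f v" using False by (auto simp: kflux_def sgn_if)
  moreover have "(LBINT \<theta>=ereal k..ereal v. slope \<theta> * f' \<theta>) = - ?i"
    using LBINT_integrand(1)[OF v k vk] by (subst interval_integral_endpoints_reverse) simp
  ultimately show ?thesis
    by (simp add: entropy_flux_eq[OF v] abs_minus_commute)
qed

lemma entropy_flux_lipschitz: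
  assumes a: "a \<in> J" and b: "b \<in> J" and ab: "a \<le> b"
  shows "\<bar>entropy_flux I f (kruzkov_entropy k \<epsilon>) k b - entropy_flux I f (kruzkov_entropy k \<epsilon>) k a\<bar> \<le> L * (b - a)"
proof -
  let ?i = "integral {a..b} (\<lambda>\<theta>. slope \<theta> * f' \<theta>)"
  have m: "min k a \<in> J" "max k b \<in> J" using a b k by (auto simp: min_def max_def)
  have "interval_lebesgue_integrable lborel (ereal (min k a)) (ereal (max k b)) (\<lambda>\<theta>. slope \<theta> * f' \<theta>)"
    using integrand_continuous[OF m] ab by (intro interval_integrable_continuous_on) auto
  moreover have "min (ereal k) (min (ereal a) (ereal b)) = ereal (min k a)"
    "max (ereal k) (max (ereal a) (ereal b)) = ereal (max k b)"
    using ab by (auto simp: min_def max_def)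
  ultimately have "(LBINT \<theta>=ereal k..ereal a. slope \<theta> * f' \<theta>) + (LBINT \<theta>=ereal a..ereal b. slope \<theta> * f' \<theta>)
      = (LBINT \<theta>=ereal k..ereal b. slope \<theta> * f' \<theta>)"
    by (intro interval_integral_sum) simp
  then have "entropy_flux I f (kruzkov_entropy k \<epsilon>) k b - entropy_flux I f (kruzkov_entropy k \<epsilon>) k a = ?i"
    using LBINT_integrand(1)[OF a b ab] by (simp add: entropy_flux_eq a b)
  moreover have "\<bar>?i\<bar> \<le> L * (b - a)"
  proof (rule has_integral_abs_bound[OF LBINT_integrand(2)[OF a b ab]])
    show "((\<lambda>_. L) has_integral L * (b - a)) {a..b}"
      using has_integral_const_real[of L a b] ab by (simp add: mult.commute)
    fix \<theta> assume "\<theta> \<in> {a..b}"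
    then have "\<bar>f' \<theta>\<bar> \<le> L" using L(1) interval_subset[OF a b] by blast
    then have "\<bar>slope \<theta>\<bar> * \<bar>f' \<theta>\<bar> \<le> 1 * L"
      using slope_bound[of \<theta>] by (intro mult_mono) auto
    then show "\<bar>slope \<theta> * f' \<theta>\<bar> \<le> L" by (simp add: abs_mult)
  qed
  ultimately show ?thesis by simp
qed

text \<open>Continuity makes the flux measurable once it is composed with a Borel representative
  that takes values in \<open>J\<close>.\<close>

lemma entropy_flux_continuous: "continuous_on J (entropy_flux I f (kruzkov_entropy k \<epsilon>) k)"
proof -
  have "dist (entropy_flux I f (kruzkov_entropy k \<epsilon>) k a) (entropy_flux I f (kruzkov_entropy k \<epsilon>) k b)
      \<le> L * dist a b" if "a \<in> J" "b \<in> J" for a b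
    using entropy_flux_lipschitz[of a b] entropy_flux_lipschitz[of b a] that
    by (cases "a \<le> b") (auto simp: dist_real_def abs_minus_commute)
  then have "L-lipschitz_on J (entropy_flux I f (kruzkov_entropy k \<epsilon>) k)"
    using L(2) by (intro lipschitz_onI) auto
  then show ?thesis by (rule lipschitz_on_continuous_on)
qed

end

end

section \<open>Borel representatives\<close>

lemma borel_measurable_fst_comp [measurable (raw)]:
  fixes g :: "'c \<Rightarrow> 'a::second_countable_topology \<times> 'b::second_countable_topology"
  assumes "g \<in> borel_measurable M"
  shows "(\<lambda>x. fst (g x)) \<in> borel_measurable M"
  by (rule borel_measurable_continuous_on[OF _ assms]) (intro continuous_intros)

lemma borel_measurable_snd_comp [measurable (raw)]:
  fixes g :: "'c \<Rightarrow> 'a::second_countable_topology \<times> 'b::second_countable_topology"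
  assumes "g \<in> borel_measurable M"
  shows "(\<lambda>x. snd (g x)) \<in> borel_measurable M"
  by (rule borel_measurable_continuous_on[OF _ assms]) (intro continuous_intros)

lemma AE_lborel_snd:
  assumes "AE y in lborel. P y"
  shows "AE p in (lborel :: ('a::euclidean_space \<times> 'b::euclidean_space) measure). P (snd p)"
proof -
  obtain N where N: "{y. \<not> P y} \<subseteq> N" "N \<in> null_sets lborel"
    using assms by (auto simp: eventually_ae_filter)
  then have "UNIV \<times> N \<in> null_sets (lborel \<Otimes>\<^sub>M lborel :: ('a \<times> 'b) measure)"
    using lborel.emeasure_pair_measure_Times[of "UNIV :: 'a set" lborel N] by (auto simp: null_sets_def)
  then show ?thesis
    using N(1) unfolding lborel_prod by (intro AE_I') auto
qed

lemma AE_lebesgue_on_iff: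
  assumes "S \<in> sets borel"
  shows "(AE p in lebesgue_on S. P p) \<longleftrightarrow> (AE p in lborel. p \<in> S \<longrightarrow> P p)"
  using assms by (simp add: AE_restrict_space_iff AE_completion_iff)

text \<open>Completeness of Lebesgue measure transfers measurability from \<open>h\<close> to
  \<open>g\<close> across the null set, so integrands built from the given solutions need no
  measurability proof of their own.\<close>

lemma lebesgue_integral_eq_lborel:
  fixes g h :: "'a::euclidean_space \<Rightarrow> real"
  assumes h: "h \<in> borel_measurable borel" and eq: "AE p in lborel. g p = h p"
  shows "(\<integral>p. g p \<partial>lebesgue) = (\<integral>p. h p \<partial>lborel)"
proof -
  have h': "h \<in> borel_measurable lebesgue" using h by (simp add: measurable_completion)
  have eq': "AE p in lebesgue. h p = g p"
    using AE_completion[OF eq] by eventually_elim simp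
  have "g \<in> borel_measurable lebesgue" by (rule borel_measurable_AE[OF h' eq'])
  then have "(\<integral>p. g p \<partial>lebesgue) = (\<integral>p. h p \<partial>lebesgue)"
    using h' eq' by (intro integral_cong_AE) auto
  also have "\<dots> = (\<integral>p. h p \<partial>lborel)" using h by (simp add: integral_completion)
  finally show ?thesis .
qed

lemma set_lebesgue_integral_eq_lborel:
  fixes g h :: "'a::euclidean_space \<Rightarrow> real"
  assumes "h \<in> borel_measurable borel" "AE p in lborel. indicator S p * g p = h p"
  shows "set_lebesgue_integral lebesgue S g = (\<integral>p. h p \<partial>lborel)"
  unfolding set_lebesgue_integral_def using assms by (intro lebesgue_integral_eq_lborel) auto

text \<open>The exceptional set is filled with one value of \<open>J\<close>, so membership in
  \<open>J\<close> holds at every point. This matters because every value of one solution will serve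
  as the constant \<open>k\<close> in the inequality for the other, with no null set to
  discard.\<close>

lemma borel_version:
  fixes g :: "'a::euclidean_space \<Rightarrow> real"
  assumes S: "S \<in> sets borel" and g: "g \<in> borel_measurable (lebesgue_on S)"
    and gJ: "AE p in lebesgue_on S. g p \<in> J" and J: "J \<in> sets borel" "J \<noteq> {}"
  obtains g' where "g' \<in> borel_measurable borel" "\<And>p. g' p \<in> J" "AE p in lborel. p \<in> S \<longrightarrow> g p = g' p"
proof -
  obtain c where c: "c \<in> J" using J(2) by blast
  have "(\<lambda>p. indicator S p *\<^sub>R g p) \<in> borel_measurable lebesgue"
    using S g by (subst borel_measurable_restrict_space_iff[symmetric]) auto
  then obtain h where h [measurable]: "h \<in> borel_measurable borel"
    and eq: "AE p in lborel. indicator S p *\<^sub>R g p = h p"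
    using completion_ex_borel_measurable_real[of "\<lambda>p. indicator S p *\<^sub>R g p" lborel] by auto
  let ?g = "\<lambda>p. if h p \<in> J then h p else c"
  have "?g \<in> borel_measurable borel" using J(1) by measurable
  moreover have "AE p in lborel. p \<in> S \<longrightarrow> g p = ?g p"
    using eq gJ unfolding AE_lebesgue_on_iff[OF S] by eventually_elim auto
  ultimately show ?thesis using that[of ?g] c by auto
qed

lemma convex_real_borel: "convex (J :: real set) \<Longrightarrow> J \<in> sets borel"
  using is_interval_convex_1 real_interval_borel_measurable by blast

section \<open>The parameter cube, the domain and the weight\<close>

lemma Gam_cbox: "Gam = cbox (\<chi> j. -1) (\<chi> j. 1)"
  by (auto simp: Gam_def mem_box_cart)

lemma Gam_compact: "compact Gam"
  unfolding Gam_cbox by (rule compact_cbox)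

lemma Gam_borel [measurable]: "Gam \<in> sets borel"
  using Gam_compact by (rule borel_compact)

lemma Omega_borel [measurable]: "Omega \<in> sets borel"
proof -
  have "Omega = {p. 0 < fst (snd p) \<and> snd (snd p) \<in> Gam}" by (auto simp: Omega_def)
  also have "\<dots> \<in> sets borel" by measurable
  finally show ?thesis .
qed

lemma in_Omega_iff: "p \<in> Omega \<longleftrightarrow> 0 < fst (snd p) \<and> snd (snd p) \<in> Gam"
  by (cases p) (auto simp: Omega_def)

text \<open>For a density version \<open>r\<close>, which vanishes off \<open>Gam\<close>, this
  vanishes off \<open>Omega\<close>. Integrals over \<open>Omega\<close> thus become integrals over
  the whole space, where translations act.\<close>

definition weight :: "((real ^ 'n) \<Rightarrow> real) \<Rightarrow> real \<times> real \<times> (real ^ 'n) \<Rightarrow> real" where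
  "weight r p = indicator {0<..} (fst (snd p)) * r (snd (snd p))"

lemma weight_measurable [measurable (raw)]:
  assumes [measurable]: "r \<in> borel_measurable borel"
  shows "weight r \<in> borel_measurable borel"
  unfolding weight_def[abs_def] by measurable

definition density_version :: "((real ^ 'n) \<Rightarrow> real) \<Rightarrow> ((real ^ 'n) \<Rightarrow> real) \<Rightarrow> real \<Rightarrow> bool" where
  "density_version \<rho> r C \<longleftrightarrow> r \<in> borel_measurable borel \<and> (\<forall>y. 0 \<le> r y \<and> r y \<le> C) \<and>
     (\<forall>y. y \<notin> Gam \<longrightarrow> r y = 0) \<and> (AE y in lborel. y \<in> Gam \<longrightarrow> \<rho> y = r y)"

lemma weight_bounds:
  assumes "density_version \<rho> r C" shows "0 \<le> weight r p" "weight r p \<le> C"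
proof -
  have "0 \<le> r y" "r y \<le> C" for y using assms by (auto simp: density_version_def)
  then show "0 \<le> weight r p" "weight r p \<le> C"
    by (auto simp: weight_def indicator_def intro: order_trans)
qed

lemma density_version_exists:
  assumes "product_density \<rho>"
  obtains r C where "density_version \<rho> r C" "C > 0"
proof -
  have \<rho>: "\<rho> \<in> borel_measurable (lebesgue_on Gam)" "\<forall>y\<in>Gam. 0 \<le> \<rho> y"
    using assms by (auto simp: product_density_def Linf_def)
  obtain C where "AE y in lebesgue_on Gam. \<bar>\<rho> y\<bar> \<le> C"
    using assms by (auto simp: product_density_def Linf_def)
  \<comment> \<open>The maximum with 1 makes the interval nonempty and the resulting bound
    positive.\<close>
  then have ae: "AE y in lebesgue_on Gam. \<rho> y \<in> {0..max C 1}"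
    unfolding AE_lebesgue_on_iff[OF Gam_borel] by eventually_elim (use \<rho>(2) in auto)
  have "{0..max C 1} \<in> sets borel" "{0..max C 1} \<noteq> {}" by auto
  from borel_version[OF Gam_borel \<rho>(1) ae this] obtain r where
    r [measurable]: "r \<in> borel_measurable borel" and b: "\<And>y. r y \<in> {0..max C 1}"
    and eq: "AE y in lborel. y \<in> Gam \<longrightarrow> \<rho> y = r y" by metis
  have "density_version \<rho> (\<lambda>y. indicator Gam y * r y) (max C 1)"
    unfolding density_version_def
  proof (intro conjI)
    show "(\<lambda>y. indicator Gam y * r y) \<in> borel_measurable borel" by measurable
    show "AE y in lborel. y \<in> Gam \<longrightarrow> \<rho> y = indicator Gam y * r y"
      using eq by eventually_elim auto
  qed (use b in \<open>auto simp: indicator_def\<close>)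
  then show ?thesis using that by force
qed

section \<open>Kruzhkov inequalities for Borel representatives\<close>

context scalar_flux
begin

lemma J_borel: "J \<in> sets borel"
  using J(2) by (rule convex_real_borel)

text \<open>\<open>g\<close> is controlled on \<open>J\<close> only, so it is cut off by the
  indicator of this Borel set before it is composed with \<open>u\<close>.\<close>

lemma measurable_on_J:
  fixes g :: "real \<Rightarrow> real"
  assumes "continuous_on J g" "u \<in> borel_measurable M" "\<And>p. u p \<in> J"
  shows "(\<lambda>p. g (u p)) \<in> borel_measurable M"
proof -
  have "(\<lambda>p. indicator J (u p) *\<^sub>R g (u p)) \<in> borel_measurable M"
    by (rule measurable_compose[OF assms(2) borel_measurable_continuous_on_indicator[OF J_borel assms(1)]])
  then show ?thesis using assms(3) by simp
qed

lemma kflux_measurable: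
  assumes [measurable]: "u \<in> borel_measurable M" "v \<in> borel_measurable M"
    and J: "\<And>p. u p \<in> J" "\<And>p. v p \<in> J"
  shows "(\<lambda>p. kflux (u p) (v p)) \<in> borel_measurable M"
proof -
  have [measurable]: "(\<lambda>p. f (u p)) \<in> borel_measurable M" "(\<lambda>p. f (v p)) \<in> borel_measurable M"
    by (rule measurable_on_J[OF f_continuous], use J in auto)+
  show ?thesis unfolding kflux_def by measurable
qed

text \<open>The smooth entropy with parameter \<open>e\<close> changes the integrand by at most
  \<open>e\<close> times \<open>(\<bar>\<phi>t p\<bar> + L * \<bar>\<phi>x p\<bar>) * weight r
  p\<close>, whose integral is finite and free of \<open>e\<close>. A negative \<open>?X\<close> is
  then refuted by a single small \<open>e\<close>, without a limit theorem.\<close>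

lemma kruzkov_inequality:
  fixes \<rho> r :: "real ^ 'n \<Rightarrow> real"
  assumes ent: "entropy_inequalities \<rho> I f u"
    and u' [measurable]: "u' \<in> borel_measurable borel" and u'J: "\<And>p. u' p \<in> J"
    and bJ: "\<And>v. v \<in> J \<Longrightarrow> \<bar>v\<bar> \<le> M"
    and u'eq: "AE p in lborel. p \<in> Omega \<longrightarrow> u p = u' p"
    and r: "density_version \<rho> r C"
    and k: "k \<in> J"
    and \<phi>: "\<phi> \<in> test_functions Omega" "\<forall>p\<in>Omega. 0 \<le> \<phi> p"
    and \<phi>t: "\<And>x t y. ((\<lambda>s. \<phi> (x, s, y)) has_real_derivative \<phi>t (x, t, y)) (at t)"
    and \<phi>x: "\<And>x t y. ((\<lambda>z. \<phi> (z, t, y)) has_real_derivative \<phi>x (x, t, y)) (at x)"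
    and cont: "continuous_on UNIV \<phi>t" "continuous_on UNIV \<phi>x"
    and S: "bounded S" "\<And>p. p \<notin> S \<Longrightarrow> \<phi>t p = 0" "\<And>p. p \<notin> S \<Longrightarrow> \<phi>x p = 0"
  shows "0 \<le> (\<integral>p. (\<bar>u' p - k\<bar> * \<phi>t p + kflux (u' p) k * \<phi>x p) * weight r p \<partial>lborel)" (is "0 \<le> ?X")
proof -
  have [measurable]: "\<phi>t \<in> borel_measurable borel" "\<phi>x \<in> borel_measurable borel"
    using cont by (auto intro: borel_measurable_continuous_onI)
  obtain Ct where Ct: "\<And>p. \<bar>\<phi>t p\<bar> \<le> Ct" using continuous_bounded_support[OF cont(1) S(1,2)] by blast
  obtain Cx where Cx: "\<And>p. \<bar>\<phi>x p\<bar> \<le> Cx" using continuous_bounded_support[OF cont(2) S(1,3)] by blast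
  have [measurable]: "r \<in> borel_measurable borel" using r by (simp add: density_version_def)
  note w = weight_bounds[OF r]
  have int: "integrable lborel (\<lambda>p. (a p * \<phi>t p + b p * \<phi>x p) * weight r p)"
    if [measurable]: "a \<in> borel_measurable borel" "b \<in> borel_measurable borel"
      and ab: "\<And>p. \<bar>a p\<bar> \<le> A" "\<And>p. \<bar>b p\<bar> \<le> B" for a b A B
  proof (rule integrable_bounded_support[of _ S "(A * Ct + B * Cx) * C"])
    fix p
    have "A \<ge> 0" "B \<ge> 0" "Ct \<ge> 0" "Cx \<ge> 0" using ab[of p] Ct[of p] Cx[of p] by linarith+
    then have "\<bar>a p * \<phi>t p + b p * \<phi>x p\<bar> \<le> A * Ct + B * Cx"
      using ab[of p] Ct[of p] Cx[of p]
      by (intro order_trans[OF abs_triangle_ineq] add_mono) (auto simp: abs_mult intro!: mult_mono)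
    then show "\<bar>(a p * \<phi>t p + b p * \<phi>x p) * weight r p\<bar> \<le> (A * Ct + B * Cx) * C"
      using w[of p] by (simp add: abs_mult) (intro mult_mono, auto)
  qed (use S in auto)
  have \<rho>eq: "AE p in (lborel :: (real \<times> real \<times> (real ^ 'n)) measure). snd (snd p) \<in> Gam \<longrightarrow> \<rho> (snd (snd p)) = r (snd (snd p))"
    using r by (intro AE_lborel_snd) (simp add: density_version_def)
  have kM: "\<bar>k\<bar> \<le> M" and M0: "0 \<le> M" using bJ[OF k] by auto
  have kf: "\<bar>kflux (u' p) k\<bar> \<le> L * (2 * M)" for p
  proof -
    have "\<bar>u' p - k\<bar> \<le> 2 * M" using bJ[OF u'J[of p]] kM by linarith
    then have "L * \<bar>u' p - k\<bar> \<le> L * (2 * M)" using L(2) by (intro mult_left_mono) auto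
    then show ?thesis using kflux_bound[OF u'J[of p] k] by linarith
  qed
  have [measurable]: "(\<lambda>p. kflux (u' p) k) \<in> borel_measurable borel"
    using kflux_measurable[OF u', of "\<lambda>_. k"] u'J k by simp
  let ?B = "\<integral>p. (1 * \<bar>\<phi>t p\<bar> + L * \<bar>\<phi>x p\<bar>) * weight r p \<partial>lborel"
  have iB: "integrable lborel (\<lambda>p. (1 * \<bar>\<phi>t p\<bar> + L * \<bar>\<phi>x p\<bar>) * weight r p)"
  proof (rule integrable_bounded_support[of _ S "(Ct + L * Cx) * C"])
    fix p
    have "\<bar>1 * \<bar>\<phi>t p\<bar> + L * \<bar>\<phi>x p\<bar>\<bar> \<le> Ct + L * Cx"
      using Ct[of p] Cx[of p] L(2) by (auto intro!: add_mono mult_left_mono)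
    then show "\<bar>(1 * \<bar>\<phi>t p\<bar> + L * \<bar>\<phi>x p\<bar>) * weight r p\<bar> \<le> (Ct + L * Cx) * C"
      using w[of p] by (simp add: abs_mult) (intro mult_mono, auto)
  qed (use S in auto)
  have iX: "integrable lborel (\<lambda>p. (\<bar>u' p - k\<bar> * \<phi>t p + kflux (u' p) k * \<phi>x p) * weight r p)"
  proof (rule int[where A="2 * M" and B="L * (2 * M)"])
    fix p show "\<bar>\<bar>u' p - k\<bar>\<bar> \<le> 2 * M" using bJ[OF u'J[of p]] kM by linarith
  qed (use kf in auto)
  have le: "0 \<le> ?X + e * ?B" if e: "e > 0" for e
  proof -
    let ?\<eta> = "kruzkov_entropy k e" and ?q = "entropy_flux I f (kruzkov_entropy k e) k"
    let ?h = "\<lambda>p. (?\<eta> (u' p) * \<phi>t p + ?q (u' p) * \<phi>x p) * weight r p"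
    have [measurable]: "(\<lambda>p. ?\<eta> (u' p)) \<in> borel_measurable borel"
      using measurable_on_J[OF kruzkov_entropy_continuous[OF e] u'] u'J by simp
    have [measurable]: "(\<lambda>p. ?q (u' p)) \<in> borel_measurable borel"
      using measurable_on_J[OF entropy_flux_continuous[OF k e] u'] u'J by simp
    have hm: "?h \<in> borel_measurable borel" by measurable
    have d\<eta>: "\<bar>?\<eta> (u' p) - \<bar>u' p - k\<bar>\<bar> \<le> e" for p
      using kruzkov_entropy_ge[of "u' p" k e] kruzkov_entropy_le[OF e, of k "u' p"] by linarith
    have dq: "\<bar>?q (u' p) - kflux (u' p) k\<bar> \<le> L * e" for p
      using entropy_flux_approx[OF k e u'J] .
    have ih: "integrable lborel ?h"
    proof (rule int[where A="2 * M + e" and B="L * (2 * M) + L * e"])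
      fix p show "\<bar>?\<eta> (u' p)\<bar> \<le> 2 * M + e" using d\<eta>[of p] bJ[OF u'J[of p]] kM by linarith
      show "\<bar>?q (u' p)\<bar> \<le> L * (2 * M) + L * e" using dq[of p] kf[of p] by linarith
    qed measurable
    have "0 \<le> set_lebesgue_integral lebesgue Omega
          (\<lambda>(x, t, y). (?\<eta> (u (x, t, y)) * deriv (\<lambda>s. \<phi> (x, s, y)) t
             + ?q (u (x, t, y)) * deriv (\<lambda>z. \<phi> (z, t, y)) x) * \<rho> y)"
      using ent kruzkov_entropy_convex[OF e] kruzkov_entropy_Ck[OF e] k J(1) \<phi>
      unfolding entropy_inequalities_def by blast
    also have "\<dots> = (\<integral>p. ?h p \<partial>lborel)"
    proof (rule set_lebesgue_integral_eq_lborel[OF hm])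
      have d: "deriv (\<lambda>s. \<phi> (x, s, y)) t = \<phi>t (x, t, y)" "deriv (\<lambda>z. \<phi> (z, t, y)) x = \<phi>x (x, t, y)" for x t y
        using \<phi>t \<phi>x by (auto intro: DERIV_imp_deriv)
      show "AE p in lborel. indicator Omega p * (case p of (x, t, y) \<Rightarrow>
          (?\<eta> (u (x, t, y)) * deriv (\<lambda>s. \<phi> (x, s, y)) t
             + ?q (u (x, t, y)) * deriv (\<lambda>z. \<phi> (z, t, y)) x) * \<rho> y) = ?h p"
        using u'eq \<rho>eq
      proof eventually_elim
        case (elim p)
        obtain x t y where p: "p = (x, t, y)" by (cases p)
        have "weight r p = 0" if "p \<notin> Omega"
          using that r by (auto simp: p weight_def in_Omega_iff density_version_def)
        moreover have "weight r p = \<rho> y" if "p \<in> Omega"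
          using that elim by (auto simp: p weight_def in_Omega_iff)
        ultimately show ?case
          using elim by (cases "p \<in> Omega") (auto simp: p d)
      qed
    qed
    also have "\<dots> \<le> (\<integral>p. (\<bar>u' p - k\<bar> * \<phi>t p + kflux (u' p) k * \<phi>x p) * weight r p
        + e * ((1 * \<bar>\<phi>t p\<bar> + L * \<bar>\<phi>x p\<bar>) * weight r p) \<partial>lborel)"
    proof (rule integral_mono[OF ih])
      show "integrable lborel (\<lambda>p. (\<bar>u' p - k\<bar> * \<phi>t p + kflux (u' p) k * \<phi>x p) * weight r p
        + e * ((1 * \<bar>\<phi>t p\<bar> + L * \<bar>\<phi>x p\<bar>) * weight r p))"
        using iX iB by (intro Bochner_Integration.integrable_add integrable_mult_right) auto
      fix p
      have "(?\<eta> (u' p) - \<bar>u' p - k\<bar>) * \<phi>t p \<le> e * \<bar>\<phi>t p\<bar>"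
      proof -
        have "(?\<eta> (u' p) - \<bar>u' p - k\<bar>) * \<phi>t p \<le> \<bar>?\<eta> (u' p) - \<bar>u' p - k\<bar>\<bar> * \<bar>\<phi>t p\<bar>"
          by (metis abs_ge_self abs_mult)
        also have "\<dots> \<le> e * \<bar>\<phi>t p\<bar>" using d\<eta>[of p] by (intro mult_right_mono) auto
        finally show ?thesis .
      qed
      moreover have "(?q (u' p) - kflux (u' p) k) * \<phi>x p \<le> L * e * \<bar>\<phi>x p\<bar>"
      proof -
        have "(?q (u' p) - kflux (u' p) k) * \<phi>x p \<le> \<bar>?q (u' p) - kflux (u' p) k\<bar> * \<bar>\<phi>x p\<bar>"
          by (metis abs_ge_self abs_mult)
        also have "\<dots> \<le> L * e * \<bar>\<phi>x p\<bar>" using dq[of p] by (intro mult_right_mono) auto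
        finally show ?thesis .
      qed
      ultimately have "?\<eta> (u' p) * \<phi>t p + ?q (u' p) * \<phi>x p
          \<le> (\<bar>u' p - k\<bar> * \<phi>t p + kflux (u' p) k * \<phi>x p) + e * (1 * \<bar>\<phi>t p\<bar> + L * \<bar>\<phi>x p\<bar>)"
        by (simp add: algebra_simps)
      from mult_right_mono[OF this w(1)[of p]]
      show "?h p \<le> (\<bar>u' p - k\<bar> * \<phi>t p + kflux (u' p) k * \<phi>x p) * weight r p
        + e * ((1 * \<bar>\<phi>t p\<bar> + L * \<bar>\<phi>x p\<bar>) * weight r p)"
        by (simp only: distrib_right mult.assoc)
    qed
    also have "\<dots> = ?X + e * ?B"
      using iX iB by (subst Bochner_Integration.integral_add) (auto intro!: integrable_mult_right)
    finally show ?thesis .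
  qed
  have B0: "0 \<le> ?B" using w L(2) by (intro integral_nonneg_AE) auto
  show ?thesis
  proof (rule ccontr)
    assume "\<not> 0 \<le> ?X"
    then have "?X < 0" by simp
    \<comment> \<open>Chosen so that the error \<open>?e * ?B\<close> is at most half of
      \<open>- ?X\<close>; the summand 1 covers the case \<open>?B = 0\<close>.\<close>
    let ?e = "- ?X / (2 * (?B + 1))"
    have "?e > 0" using \<open>?X < 0\<close> B0 by (intro divide_pos_pos) auto
    have "?e * ?B \<le> ?e * (?B + 1)" using \<open>?e > 0\<close> by (intro mult_left_mono) auto
    also have "\<dots> = - ?X / 2" using B0 by (simp add: field_simps)
    finally show False using le[OF \<open>?e > 0\<close>] \<open>?X < 0\<close> by linarith
  qed
qed

end

section \<open>Doubling of variables\<close>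

lemma double_integrable:
  fixes H :: "'a::euclidean_space \<times> 'a \<Rightarrow> real"
  assumes H: "H \<in> borel_measurable borel" and B: "\<And>p q. \<bar>H (p, q)\<bar> \<le> B"
    and supp: "\<And>p q. H (p, q) \<noteq> 0 \<Longrightarrow> norm p \<le> R \<and> norm (p - q) < d"
  shows "integrable lborel H"
proof (rule integrable_bounded_support[OF H, of "cball 0 R \<times> cball 0 (R + d)" B])
  show "\<bar>H z\<bar> \<le> B" for z using B by (cases z) auto
  show "H z = 0" if "z \<notin> cball 0 R \<times> cball 0 (R + d)" for z
  proof (rule ccontr)
    assume "H z \<noteq> 0"
    obtain p q where z: "z = (p, q)" by fastforce
    have "norm p \<le> R" "norm (p - q) < d" using supp[of p q] \<open>H z \<noteq> 0\<close> z by auto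
    moreover have "norm q \<le> norm p + norm (p - q)"
      using norm_triangle_ineq4[of p "p - q"] by simp
    ultimately show False using that z by auto
  qed
qed (auto intro: bounded_Times)

context scalar_flux
begin

text \<open>Multiplying \<open>hu\<close> by \<open>w q\<close> and \<open>hv\<close> by
  \<open>w p\<close> and integrating turns both into inequalities for double integrals with the same
  weights. \<psi> depends on \<open>p\<close> alone, so \<open>hv\<close> contains only derivatives
  of \<open>K\<close>, with the opposite sign because \<open>K (p - q)\<close> is differentiated in
  \<open>q\<close>. By the symmetry of \<open>kflux\<close> they cancel those in \<open>hu\<close>,
  which leaves the derivatives of \<psi>.\<close>

lemma doubling:
  fixes u v w :: "'a::euclidean_space \<Rightarrow> real"
  assumes [measurable]: "u \<in> borel_measurable borel" "v \<in> borel_measurable borel" "w \<in> borel_measurable borel"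
    and uv: "\<And>p. u p \<in> J" "\<And>p. v p \<in> J" and bJ: "\<And>v. v \<in> J \<Longrightarrow> \<bar>v\<bar> \<le> M"
    and w: "\<And>p. 0 \<le> w p" "\<And>p. w p \<le> C"
    and cont: "continuous_on UNIV \<psi>" "continuous_on UNIV \<psi>t" "continuous_on UNIV \<psi>x"
      "continuous_on UNIV K" "continuous_on UNIV Kt" "continuous_on UNIV Kx"
    and \<psi>: "\<And>p. norm p > R \<Longrightarrow> \<psi> p = 0 \<and> \<psi>t p = 0 \<and> \<psi>x p = 0"
    and K: "\<And>z. norm z \<ge> d \<Longrightarrow> K z = 0 \<and> Kt z = 0 \<and> Kx z = 0"
    and hu: "\<And>q. 0 \<le> (\<integral>p. (\<bar>u p - v q\<bar> * (\<psi>t p * K (p - q) + \<psi> p * Kt (p - q)) +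
        kflux (u p) (v q) * (\<psi>x p * K (p - q) + \<psi> p * Kx (p - q))) * w p \<partial>lborel)"
    and hv: "\<And>p. 0 \<le> (\<integral>q. (\<bar>v q - u p\<bar> * (- (\<psi> p * Kt (p - q))) +
        kflux (v q) (u p) * (- (\<psi> p * Kx (p - q)))) * w q \<partial>lborel)"
  shows "0 \<le> (\<integral>z. (\<bar>u (fst z) - v (snd z)\<bar> * \<psi>t (fst z) + kflux (u (fst z)) (v (snd z)) * \<psi>x (fst z))
      * K (fst z - snd z) * w (fst z) * w (snd z) \<partial>lborel)"
proof -
  have [measurable]: "\<psi> \<in> borel_measurable borel" "\<psi>t \<in> borel_measurable borel"
    "\<psi>x \<in> borel_measurable borel" "K \<in> borel_measurable borel" "Kt \<in> borel_measurable borel"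
    "Kx \<in> borel_measurable borel"
    using cont by (auto intro: borel_measurable_continuous_onI)
  have bs: "bounded (cball 0 R :: 'a set)" "bounded (ball 0 d :: 'a set)" by auto
  have bound: "\<exists>B>0. \<forall>x. \<bar>g x\<bar> \<le> B" if "continuous_on UNIV g" "\<And>p. norm p > R \<Longrightarrow> g p = 0" for g :: "'a \<Rightarrow> real"
    using continuous_bounded_support[OF that(1) bs(1)] that(2) by (metis mem_cball_0 not_le)
  have boundK: "\<exists>B>0. \<forall>x. \<bar>g x\<bar> \<le> B" if "continuous_on UNIV g" "\<And>p. norm p \<ge> d \<Longrightarrow> g p = 0" for g :: "'a \<Rightarrow> real"
    using continuous_bounded_support[OF that(1) bs(2)] that(2) by (metis mem_ball_0 not_le)
  have M0: "M \<ge> 0" using bJ[OF uv(1)[of 0]] by linarith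
  have C0: "C \<ge> 0" using w[of 0] by linarith
  let ?k = "\<lambda>z. kflux (u (fst z)) (v (snd z))" and ?a = "\<lambda>z. \<bar>u (fst z) - v (snd z)\<bar>"
  have a: "\<bar>?a z\<bar> \<le> 2 * M" for z
    using bJ[OF uv(1)[of "fst z"]] bJ[OF uv(2)[of "snd z"]] by linarith
  have k: "\<bar>?k z\<bar> \<le> L * (2 * M)" for z
    using order_trans[OF kflux_bound[OF uv(1)[of "fst z"] uv(2)[of "snd z"]] mult_left_mono[OF a[of z, simplified] L(2)]] by simp
  have [measurable]: "?k \<in> borel_measurable borel"
    using uv by (intro kflux_measurable) measurable
  have int: "integrable lborel (\<lambda>z. A z * g (fst z) * h (fst z - snd z) * w (fst z) * w (snd z))"
    if [measurable]: "A \<in> borel_measurable borel" and A: "\<And>z. \<bar>A z\<bar> \<le> A0"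
      and g: "continuous_on UNIV g" "\<And>p. norm p > R \<Longrightarrow> g p = 0"
      and h: "continuous_on UNIV h" "\<And>p. norm p \<ge> d \<Longrightarrow> h p = 0"
    for A :: "'a \<times> 'a \<Rightarrow> real" and A0 g h
  proof -
    obtain B1 where B1: "B1 > 0" "\<And>x. \<bar>g x\<bar> \<le> B1" using bound[OF g] by blast
    obtain B2 where B2: "B2 > 0" "\<And>x. \<bar>h x\<bar> \<le> B2" using boundK[OF h] by blast
    have [measurable]: "g \<in> borel_measurable borel" "h \<in> borel_measurable borel"
      using g h by (auto intro: borel_measurable_continuous_onI)
    show ?thesis
    proof (rule double_integrable[of _ "A0 * B1 * B2 * C * C" R d])
      show "(\<lambda>z. A z * g (fst z) * h (fst z - snd z) * w (fst z) * w (snd z)) \<in> borel_measurable borel"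
        by measurable
      fix p q
      have "0 \<le> A0" using A[of "(p, q)"] by linarith
      then show "\<bar>A (p, q) * g (fst (p, q)) * h (fst (p, q) - snd (p, q)) * w (fst (p, q)) * w (snd (p, q))\<bar> \<le> A0 * B1 * B2 * C * C"
        unfolding abs_mult using A[of "(p, q)"] B1 B2 w C0
        by (intro mult_mono mult_nonneg_nonneg) auto
      assume "A (p, q) * g (fst (p, q)) * h (fst (p, q) - snd (p, q)) * w (fst (p, q)) * w (snd (p, q)) \<noteq> 0"
      then show "norm p \<le> R \<and> norm (p - q) < d"
        using g(2)[of p] h(2)[of "p - q"] by (auto simp: not_less[symmetric])
    qed
  qed
  let ?T = "\<lambda>A g h z. A z * g (fst z) * h (fst z - snd z) * w (fst z) * w (snd z)"
  have i: "integrable lborel (?T ?a \<psi>t K)" "integrable lborel (?T ?a \<psi> Kt)"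
    "integrable lborel (?T ?k \<psi>x K)" "integrable lborel (?T ?k \<psi> Kx)"
    using \<psi> K
    by (auto intro!: int[where A="?a", OF _ a] int[where A="?k", OF _ k] cont)
  let ?g1 = "\<lambda>z. (?T ?a \<psi>t K z + ?T ?a \<psi> Kt z) + (?T ?k \<psi>x K z + ?T ?k \<psi> Kx z)"
  let ?g2 = "\<lambda>z. - (?T ?a \<psi> Kt z + ?T ?k \<psi> Kx z)"
  have i1: "integrable lborel ?g1" and i2: "integrable lborel ?g2"
    using i by (auto intro!: Bochner_Integration.integrable_add integrable_minus)
  have 1: "0 \<le> (\<integral>z. ?g1 z \<partial>lborel)"
  proof -
    have "(\<integral>z. ?g1 z \<partial>lborel) = (\<integral>q. (\<integral>p. ?g1 (p, q) \<partial>lborel) \<partial>lborel)"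
      using lborel_pair.integral_snd[of "\<lambda>p q. ?g1 (p, q)"] i1 by (simp add: lborel_prod case_prod_beta')
    also have "\<dots> = (\<integral>q. w q * (\<integral>p. (\<bar>u p - v q\<bar> * (\<psi>t p * K (p - q) + \<psi> p * Kt (p - q)) +
        kflux (u p) (v q) * (\<psi>x p * K (p - q) + \<psi> p * Kx (p - q))) * w p \<partial>lborel) \<partial>lborel)"
      by (subst integral_mult_right_zero[symmetric])
         (auto intro!: Bochner_Integration.integral_cong simp: algebra_simps)
    also have "0 \<le> \<dots>" using w hu by (intro integral_nonneg_AE) auto
    finally show ?thesis .
  qed
  have 2: "0 \<le> (\<integral>z. ?g2 z \<partial>lborel)"
  proof -
    have "(\<integral>z. ?g2 z \<partial>lborel) = (\<integral>p. (\<integral>q. ?g2 (p, q) \<partial>lborel) \<partial>lborel)"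
      using lborel_pair.integral_fst[of "\<lambda>p q. ?g2 (p, q)"] i2 by (simp add: lborel_prod case_prod_beta')
    also have "\<dots> = (\<integral>p. w p * (\<integral>q. (\<bar>v q - u p\<bar> * (- (\<psi> p * Kt (p - q))) +
        kflux (v q) (u p) * (- (\<psi> p * Kx (p - q)))) * w q \<partial>lborel) \<partial>lborel)"
      by (subst integral_mult_right_zero[symmetric])
         (auto intro!: Bochner_Integration.integral_cong simp: algebra_simps kflux_sym abs_minus_commute)
    also have "0 \<le> \<dots>" using w hv by (intro integral_nonneg_AE) auto
    finally show ?thesis .
  qed
  have "(\<integral>z. (?a z * \<psi>t (fst z) + ?k z * \<psi>x (fst z)) * K (fst z - snd z) * w (fst z) * w (snd z) \<partial>lborel)
     = (\<integral>z. ?g1 z + ?g2 z \<partial>lborel)"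
    by (rule Bochner_Integration.integral_cong) (auto simp: algebra_simps)
  also have "\<dots> = (\<integral>z. ?g1 z \<partial>lborel) + (\<integral>z. ?g2 z \<partial>lborel)"
    by (rule Bochner_Integration.integral_add[OF i1 i2])
  finally show ?thesis using 1 2 by simp
qed

text \<open>Only the argument \<open>q\<close> of \<open>v\<close> and \<open>w\<close> has to be
  moved to \<open>p\<close>, since \<open>u\<close> and the test functions already stand at
  \<open>p\<close>. The integrand \<open>G p b\<close> is Lipschitz in \<open>b\<close>, so both
  replacements are bounded by mollification errors of the bounded functions \<open>v\<close> and
  \<open>w\<close>. What remains contains \<open>q\<close> in the kernel alone, which integrates to
  1.\<close>

lemma doubling_limit:
  fixes u v w :: "'a::euclidean_space \<Rightarrow> real"
  assumes [measurable]: "u \<in> borel_measurable borel" "v \<in> borel_measurable borel" "w \<in> borel_measurable borel"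
    and uv: "\<And>p. u p \<in> J" "\<And>p. v p \<in> J" and bJ: "\<And>v. v \<in> J \<Longrightarrow> \<bar>v\<bar> \<le> M"
    and w: "\<And>p. 0 \<le> w p" "\<And>p. w p \<le> C"
    and cont: "continuous_on UNIV \<psi>t" "continuous_on UNIV \<psi>x"
    and \<psi>: "\<And>p. norm p > R \<Longrightarrow> \<psi>t p = 0 \<and> \<psi>x p = 0"
    and doubled: "\<And>d. d > 0 \<Longrightarrow> \<exists>K. mollifier d K \<and>
      0 \<le> (\<integral>z. (\<bar>u (fst z) - v (snd z)\<bar> * \<psi>t (fst z) + kflux (u (fst z)) (v (snd z)) * \<psi>x (fst z))
        * K (fst z - snd z) * w (fst z) * w (snd z) \<partial>lborel)"
  shows "0 \<le> (\<integral>p. (\<bar>u p - v p\<bar> * \<psi>t p + kflux (u p) (v p) * \<psi>x p) * (w p)\<^sup>2 \<partial>lborel)" (is "0 \<le> ?X")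
proof -
  have [measurable]: "\<psi>t \<in> borel_measurable borel" "\<psi>x \<in> borel_measurable borel"
    using cont by (auto intro: borel_measurable_continuous_onI)
  let ?S = "cball 0 R :: 'a set"
  have bs: "bounded ?S" by auto
  have "\<And>p. p \<notin> ?S \<Longrightarrow> \<psi>t p = 0" "\<And>p. p \<notin> ?S \<Longrightarrow> \<psi>x p = 0" using \<psi> by auto
  then obtain Ct Cx where Ct: "Ct > 0" "\<And>p. \<bar>\<psi>t p\<bar> \<le> Ct" and Cx: "Cx > 0" "\<And>p. \<bar>\<psi>x p\<bar> \<le> Cx"
    using continuous_bounded_support[OF cont(1) bs] continuous_bounded_support[OF cont(2) bs] by metis
  have M0: "M \<ge> 0" using bJ[OF uv(1)[of 0]] by linarith
  have C0: "C \<ge> 0" using w[of 0] by linarith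
  define c where "c = Ct + L * Cx"
  have c0: "c > 0" using Ct Cx L(2) by (auto simp: c_def intro!: add_pos_nonneg)
  define G where "G p b = \<bar>u p - b\<bar> * \<psi>t p + kflux (u p) b * \<psi>x p" for p b
  have Gd: "\<bar>G p b - G p b'\<bar> \<le> c * \<bar>b - b'\<bar>" if "b \<in> J" "b' \<in> J" for p b b'
  proof -
    have "\<bar>G p b - G p b'\<bar> = \<bar>(\<bar>u p - b\<bar> - \<bar>u p - b'\<bar>) * \<psi>t p + (kflux (u p) b - kflux (u p) b') * \<psi>x p\<bar>"
      by (simp add: G_def algebra_simps)
    also have "\<dots> \<le> \<bar>\<bar>u p - b\<bar> - \<bar>u p - b'\<bar>\<bar> * \<bar>\<psi>t p\<bar> + \<bar>kflux (u p) b - kflux (u p) b'\<bar> * \<bar>\<psi>x p\<bar>"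
      by (metis abs_mult abs_triangle_ineq)
    also have "\<dots> \<le> \<bar>b - b'\<bar> * Ct + (L * \<bar>b - b'\<bar>) * Cx"
      using Ct(2)[of p] Cx(2)[of p] kflux_lipschitz[OF uv(1)[of p] that] L(2)
      by (intro add_mono mult_mono) auto
    finally show ?thesis by (simp add: c_def algebra_simps)
  qed
  have Gb: "\<bar>G p b\<bar> \<le> c * (2 * M)" if "b \<in> J" for p b
  proof -
    have "\<bar>u p - b\<bar> \<le> 2 * M" using bJ[OF uv(1)[of p]] bJ[OF that] by linarith
    \<comment> \<open>\<open>G p\<close> vanishes at \<open>b = u p\<close>, so its Lipschitz
      constant \<open>c\<close> also bounds its size.\<close>
    have "G p (u p) = 0" by (simp add: G_def kflux_def)
    then have "\<bar>G p b\<bar> \<le> c * \<bar>b - u p\<bar>" using Gd[OF that uv(1)[of p], of p] by simp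
    also have "\<dots> \<le> c * (2 * M)" using \<open>\<bar>u p - b\<bar> \<le> 2 * M\<close> c0 by (intro mult_left_mono) auto
    finally show ?thesis .
  qed
  have G0: "G p b = 0" if "norm p > R" for p b using \<psi>[OF that] by (simp add: G_def)
  have [measurable]: "(\<lambda>z. kflux (u (fst z)) (v (snd z))) \<in> borel_measurable (borel :: ('a \<times> 'a) measure)"
    "(\<lambda>z. kflux (u (fst z)) (v (fst z))) \<in> borel_measurable (borel :: ('a \<times> 'a) measure)"
    "(\<lambda>p. kflux (u p) (v p)) \<in> borel_measurable borel"
    by (intro kflux_measurable; use uv in measurable)+
  have [measurable]: "(\<lambda>z. G (fst z) (v (snd z))) \<in> borel_measurable (borel :: ('a \<times> 'a) measure)"
    "(\<lambda>z. G (fst z) (v (fst z))) \<in> borel_measurable (borel :: ('a \<times> 'a) measure)"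
    "(\<lambda>p. G p (v p)) \<in> borel_measurable borel"
    unfolding G_def by measurable
  \<comment> \<open>The first summand belongs to the error from moving \<open>v\<close>: the
    Lipschitz constant \<open>c\<close> times two weights. The second belongs to moving
    \<open>w\<close>: the bound \<open>c * (2 * M)\<close> of \<open>G\<close> times the one weight
    left.\<close>
  let ?A = "C * c * C + C * (c * (2 * M))"
  have A0: "?A \<ge> 0" using C0 c0 M0 by auto
  have X: "?X = (\<integral>p. G p (v p) * (w p)\<^sup>2 \<partial>lborel)" by (simp add: G_def)
  have le: "0 \<le> ?X + ?A * e" if "e > 0" for e
  proof -
    have S: "?S \<in> sets borel" by simp
    have wb: "\<And>p. \<bar>w p\<bar> \<le> C" using w by simp
    have vb: "\<And>p. \<bar>v p\<bar> \<le> M" using bJ uv by blast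
    obtain d1 where d1: "d1 > 0" "\<And>K. mollifier d1 K \<Longrightarrow>
        (\<integral>p. indicator ?S p * (\<integral>q. K (q - p) * \<bar>v q - v p\<bar> \<partial>lborel) \<partial>lborel) \<le> e"
      using mollification_error[of v, OF _ vb bs S \<open>e > 0\<close>] by auto
    obtain d2 where d2: "d2 > 0" "\<And>K. mollifier d2 K \<Longrightarrow>
        (\<integral>p. indicator ?S p * (\<integral>q. K (q - p) * \<bar>w q - w p\<bar> \<partial>lborel) \<partial>lborel) \<le> e"
      using mollification_error[of w, OF _ wb bs S \<open>e > 0\<close>] by auto
    define d where "d = min d1 d2"
    have "d > 0" using d1 d2 by (simp add: d_def)
    then obtain K where K: "mollifier d K" and pos:
      "0 \<le> (\<integral>z. (\<bar>u (fst z) - v (snd z)\<bar> * \<psi>t (fst z) + kflux (u (fst z)) (v (snd z)) * \<psi>x (fst z))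
        * K (fst z - snd z) * w (fst z) * w (snd z) \<partial>lborel)"
      using doubled by blast
    note [measurable] = mollifier_measurable[OF K]
    have nn: "0 \<le> K z" and supp: "K z \<noteq> 0 \<Longrightarrow> norm z < d" for z using K by (auto simp: mollifier_def)
    obtain CK where CK: "CK > 0" "\<And>z. \<bar>K z\<bar> \<le> CK" using mollifier_bounded[OF K] by blast
    \<comment> \<open>The doubled integral contains \<open>K (p - q)\<close>, the error estimate
      \<open>K (q - p)\<close>, so the estimate is applied to the reflected kernel. A kernel of
      radius \<open>d\<close> is also one of the larger radii \<open>d1\<close> and
      \<open>d2\<close>.\<close>
    have "mollifier d1 (\<lambda>z. K (- z))" "mollifier d2 (\<lambda>z. K (- z))"
      using mollifier_reflect[OF K] unfolding mollifier_def d_def by auto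
    then have err: "(\<integral>p. indicator ?S p * (\<integral>q. K (p - q) * \<bar>v q - v p\<bar> \<partial>lborel) \<partial>lborel) \<le> e"
      "(\<integral>p. indicator ?S p * (\<integral>q. K (p - q) * \<bar>w q - w p\<bar> \<partial>lborel) \<partial>lborel) \<le> e"
      using d1(2) d2(2) by fastforce+
    have int: "integrable lborel (\<lambda>z. H z * K (fst z - snd z))"
      if [measurable]: "H \<in> borel_measurable borel" and H: "\<And>z. \<bar>H z\<bar> \<le> B"
        "\<And>p q. norm p > R \<Longrightarrow> H (p, q) = 0" for H :: "'a \<times> 'a \<Rightarrow> real" and B
    proof (rule double_integrable[of _ "B * CK" R d])
      show "\<bar>H (p, q) * K (fst (p, q) - snd (p, q))\<bar> \<le> B * CK" for p q
        unfolding abs_mult using H(1)[of "(p, q)"] CK by (intro mult_mono) auto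
      show "norm p \<le> R \<and> norm (p - q) < d" if "H (p, q) * K (fst (p, q) - snd (p, q)) \<noteq> 0" for p q
        using that H(2)[of p q] supp[of "p - q"] by (auto simp: not_less[symmetric])
    qed measurable
    have [measurable]: "(\<lambda>z::'a \<times> 'a. indicat_real ?S (fst z)) \<in> borel_measurable borel"
      by (rule measurable_compose[OF borel_measurable_continuous_onI[OF continuous_on_fst[OF continuous_on_id]]])
         (rule borel_measurable_indicator[OF S])
    let ?h0 = "\<lambda>z. (G (fst z) (v (snd z)) * w (fst z) * w (snd z)) * K (fst z - snd z)"
    let ?h1 = "\<lambda>z. (G (fst z) (v (fst z)) * (w (fst z))\<^sup>2) * K (fst z - snd z)"
    let ?h2 = "\<lambda>z. (indicator ?S (fst z) * \<bar>v (snd z) - v (fst z)\<bar>) * K (fst z - snd z)"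
    let ?h3 = "\<lambda>z. (indicator ?S (fst z) * \<bar>w (snd z) - w (fst z)\<bar>) * K (fst z - snd z)"
    have i0: "integrable lborel ?h0"
    proof (rule int[of _ "c * (2 * M) * C * C"])
      show "\<bar>G (fst z) (v (snd z)) * w (fst z) * w (snd z)\<bar> \<le> c * (2 * M) * C * C" for z
        unfolding abs_mult using Gb[OF uv(2)] w C0 c0 M0 by (intro mult_mono mult_nonneg_nonneg) auto
    qed (auto simp: G0)
    have i1: "integrable lborel ?h1"
    proof (rule int[of _ "c * (2 * M) * C\<^sup>2"])
      show "\<bar>G (fst z) (v (fst z)) * (w (fst z))\<^sup>2\<bar> \<le> c * (2 * M) * C\<^sup>2" for z
        unfolding abs_mult using Gb[OF uv(2)] w C0 c0 M0
        by (intro mult_mono mult_nonneg_nonneg) (auto intro: power_mono)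
    qed (auto simp: G0)
    have i2: "integrable lborel ?h2"
    proof (rule int[of _ "2 * M"])
      show "\<bar>indicator ?S (fst z) * \<bar>v (snd z) - v (fst z)\<bar>\<bar> \<le> 2 * M" for z
        using vb[of "fst z"] vb[of "snd z"] by (auto simp: indicator_def)
    qed auto
    have i3: "integrable lborel ?h3"
    proof (rule int[of _ "2 * C"])
      show "\<bar>indicator ?S (fst z) * \<bar>w (snd z) - w (fst z)\<bar>\<bar> \<le> 2 * C" for z
        using wb[of "fst z"] wb[of "snd z"] by (auto simp: indicator_def)
    qed auto
    have "0 \<le> (\<integral>z. ?h0 z \<partial>lborel)"
      using pos by (simp add: G_def mult_ac)
    also have "\<dots> \<le> (\<integral>z. ?h1 z + (C * c * C) * ?h2 z + (C * (c * (2 * M))) * ?h3 z \<partial>lborel)"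
    proof (rule integral_mono[OF i0])
      show "integrable lborel (\<lambda>z. ?h1 z + (C * c * C) * ?h2 z + (C * (c * (2 * M))) * ?h3 z)"
        by (intro Bochner_Integration.integrable_add integrable_mult_right i1 i2 i3)
      fix z :: "'a \<times> 'a"
      obtain p q where z: "z = (p, q)" by fastforce
      have "G p (v q) * w p * w q \<le> G p (v p) * (w p)\<^sup>2 + (C * c * C) * (indicator ?S p * \<bar>v q - v p\<bar>)
          + (C * (c * (2 * M))) * (indicator ?S p * \<bar>w q - w p\<bar>)"
      proof (cases "norm p \<le> R")
        case True
        have "G p (v q) * w p * w q - G p (v p) * (w p)\<^sup>2
            = (G p (v q) - G p (v p)) * (w p * w q) + G p (v p) * (w p * (w q - w p))"
          by (simp add: algebra_simps power2_eq_square)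
        also have "\<dots> \<le> \<bar>G p (v q) - G p (v p)\<bar> * (w p * w q) + \<bar>G p (v p)\<bar> * \<bar>w p * (w q - w p)\<bar>"
        proof (rule add_mono)
          show "(G p (v q) - G p (v p)) * (w p * w q) \<le> \<bar>G p (v q) - G p (v p)\<bar> * (w p * w q)"
            using w by (intro mult_right_mono) auto
          show "G p (v p) * (w p * (w q - w p)) \<le> \<bar>G p (v p)\<bar> * \<bar>w p * (w q - w p)\<bar>"
            by (metis abs_ge_self abs_mult)
        qed
        also have "\<dots> \<le> (c * \<bar>v q - v p\<bar>) * (C * C) + (c * (2 * M)) * (C * \<bar>w q - w p\<bar>)"
          unfolding abs_mult using Gd[OF uv(2) uv(2), of p q p] Gb[OF uv(2), of p p] w C0 c0 M0
          by (intro add_mono mult_mono mult_nonneg_nonneg) auto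
        finally show ?thesis using True by (simp add: algebra_simps)
      qed (simp add: G0)
      from mult_right_mono[OF this nn[of "p - q"]]
      show "?h0 z \<le> ?h1 z + (C * c * C) * ?h2 z + (C * (c * (2 * M))) * ?h3 z"
        by (simp only: z fst_conv snd_conv distrib_right mult.assoc)
    qed
    also have "\<dots> = (\<integral>z. ?h1 z \<partial>lborel) + (C * c * C) * (\<integral>z. ?h2 z \<partial>lborel) + (C * (c * (2 * M))) * (\<integral>z. ?h3 z \<partial>lborel)"
      using i1 i2 i3 by simp
    finally have sum: "0 \<le> \<dots>" .
    have "(\<integral>z. ?h1 z \<partial>lborel) = ?X"
    proof -
      have one: "(\<integral>q. K (p - q) \<partial>lborel) = 1" for p
        using lborel_integral_shift[of "\<lambda>z. K (- z)" "- p"] mollifier_reflect[OF K] by (simp add: mollifier_def)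
      have "(\<integral>z. ?h1 z \<partial>lborel) = (\<integral>p. (\<integral>q. ?h1 (p, q) \<partial>lborel) \<partial>lborel)"
        using lborel_pair.integral_fst[of "\<lambda>p q. ?h1 (p, q)"] i1 by (simp add: lborel_prod case_prod_beta')
      then show ?thesis by (simp add: X one)
    qed
    moreover have "(\<integral>z. ?h2 z \<partial>lborel) \<le> e"
    proof -
      have "(\<integral>z. ?h2 z \<partial>lborel) = (\<integral>p. (\<integral>q. ?h2 (p, q) \<partial>lborel) \<partial>lborel)"
        using lborel_pair.integral_fst[of "\<lambda>p q. ?h2 (p, q)"] i2 by (simp add: lborel_prod case_prod_beta')
      also have "\<dots> = (\<integral>p. indicator ?S p * (\<integral>q. K (p - q) * \<bar>v q - v p\<bar> \<partial>lborel) \<partial>lborel)"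
        by (subst integral_mult_right_zero[symmetric]) (simp add: mult.commute mult.left_commute)
      finally show ?thesis using err(1) by simp
    qed
    moreover have "(\<integral>z. ?h3 z \<partial>lborel) \<le> e"
    proof -
      have "(\<integral>z. ?h3 z \<partial>lborel) = (\<integral>p. (\<integral>q. ?h3 (p, q) \<partial>lborel) \<partial>lborel)"
        using lborel_pair.integral_fst[of "\<lambda>p q. ?h3 (p, q)"] i3 by (simp add: lborel_prod case_prod_beta')
      also have "\<dots> = (\<integral>p. indicator ?S p * (\<integral>q. K (p - q) * \<bar>w q - w p\<bar> \<partial>lborel) \<partial>lborel)"
        by (subst integral_mult_right_zero[symmetric]) (simp add: mult.commute mult.left_commute)
      finally show ?thesis using err(2) by simp
    qed
    ultimately have "(C * c * C) * (\<integral>z. ?h2 z \<partial>lborel) \<le> (C * c * C) * e"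
      "(C * (c * (2 * M))) * (\<integral>z. ?h3 z \<partial>lborel) \<le> (C * (c * (2 * M))) * e"
      "(\<integral>z. ?h1 z \<partial>lborel) = ?X"
      using C0 c0 M0 by (auto intro!: mult_left_mono)
    with sum show ?thesis unfolding distrib_right by linarith
  qed
  show ?thesis
  proof (rule ccontr)
    assume "\<not> 0 \<le> ?X"
    then have "?X < 0" by simp
    let ?e = "- ?X / (2 * (?A + 1))"
    have "?e > 0" using \<open>?X < 0\<close> A0 by (intro divide_pos_pos) auto
    have "?A * ?e \<le> (?A + 1) * ?e" using \<open>?e > 0\<close> by (intro mult_right_mono) auto
    also have "\<dots> = - ?X / 2" using A0 by (simp add: field_simps)
    finally show False using le[OF \<open>?e > 0\<close>] \<open>?X < 0\<close> by linarith
  qed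
qed

end

section \<open>Partial derivatives and supports of test functions\<close>

lemma smooth_partials:
  fixes \<phi> :: "real \<times> real \<times> 'b::euclidean_space \<Rightarrow> real"
  assumes "smooth \<phi>"
  obtains \<phi>t \<phi>x where
    "\<And>x t y. ((\<lambda>s. \<phi> (x, s, y)) has_real_derivative \<phi>t (x, t, y)) (at t)"
    "\<And>x t y. ((\<lambda>z. \<phi> (z, t, y)) has_real_derivative \<phi>x (x, t, y)) (at x)"
    "continuous_on UNIV \<phi>t" "continuous_on UNIV \<phi>x"
proof -
  obtain \<phi>' where d: "\<And>p. (\<phi> has_derivative \<phi>' p) (at p)" and c: "\<And>v. continuous_on UNIV (\<lambda>p. \<phi>' p v)"
    using smooth_has_derivative[OF assms] by blast
  have lin: "linear (\<phi>' p)" for p using d has_derivative_linear by blast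
  show ?thesis
  proof (rule that[of "\<lambda>p. \<phi>' p (0, 1, 0)" "\<lambda>p. \<phi>' p (1, 0, 0)"])
    fix x t :: real and y :: 'b
    have "((\<lambda>s. (x, s, y)) has_derivative (\<lambda>h. (0, h, 0))) (at t)"
      by (intro has_derivative_Pair has_derivative_const has_derivative_ident)
    from has_derivative_compose[OF this d]
    have "((\<lambda>s. \<phi> (x, s, y)) has_derivative (\<lambda>h. \<phi>' (x, t, y) (0, h, 0))) (at t)" .
    moreover have "(\<lambda>h. \<phi>' (x, t, y) (0, h, 0)) = (*) (\<phi>' (x, t, y) (0, 1, 0))"
    proof
      fix h show "\<phi>' (x, t, y) (0, h, 0) = \<phi>' (x, t, y) (0, 1, 0) * h"
        using linear_scale[OF lin, of "(x, t, y)" h "(0, 1, 0)"] by simp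
    qed
    ultimately show "((\<lambda>s. \<phi> (x, s, y)) has_real_derivative \<phi>' (x, t, y) (0, 1, 0)) (at t)"
      unfolding has_field_derivative_def by metis
    have "((\<lambda>z. (z, t, y)) has_derivative (\<lambda>h. (h, 0, 0))) (at x)"
      by (intro has_derivative_Pair has_derivative_const has_derivative_ident)
    from has_derivative_compose[OF this d]
    have "((\<lambda>z. \<phi> (z, t, y)) has_derivative (\<lambda>h. \<phi>' (x, t, y) (h, 0, 0))) (at x)" .
    moreover have "(\<lambda>h. \<phi>' (x, t, y) (h, 0, 0)) = (*) (\<phi>' (x, t, y) (1, 0, 0))"
    proof
      fix h show "\<phi>' (x, t, y) (h, 0, 0) = \<phi>' (x, t, y) (1, 0, 0) * h"
        using linear_scale[OF lin, of "(x, t, y)" h "(1, 0, 0)"] by simp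
    qed
    ultimately show "((\<lambda>z. \<phi> (z, t, y)) has_real_derivative \<phi>' (x, t, y) (1, 0, 0)) (at x)"
      unfolding has_field_derivative_def by metis
  qed (use c in auto)
qed

lemma partials_vanish:
  fixes \<phi> :: "real \<times> real \<times> 'b::euclidean_space \<Rightarrow> real"
  assumes \<phi>t: "\<And>x t y. ((\<lambda>s. \<phi> (x, s, y)) has_real_derivative \<phi>t (x, t, y)) (at t)"
    and \<phi>x: "\<And>x t y. ((\<lambda>z. \<phi> (z, t, y)) has_real_derivative \<phi>x (x, t, y)) (at x)"
    and U: "open U" "\<And>p. p \<in> U \<Longrightarrow> \<phi> p = 0" and p: "p \<in> U"
  shows "\<phi>t p = 0" "\<phi>x p = 0"
proof -
  obtain x t y where xty: "p = (x, t, y)" by (cases p)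
  have 0: "(g has_real_derivative 0) (at a)" if "open V" "a \<in> V" "\<And>s. s \<in> V \<Longrightarrow> g s = 0" for g :: "real \<Rightarrow> real" and V a
  proof -
    have "((\<lambda>_. 0) has_real_derivative 0) (at a)" by simp
    then show ?thesis
      by (rule has_field_derivative_transform_within_open[of _ _ _ V]) (use that in auto)
  qed
  have "open ((\<lambda>s. (x, s, y)) -` U)" "open ((\<lambda>z. (z, t, y)) -` U)"
    using U(1) by (auto intro!: open_vimage continuous_intros)
  then show "\<phi>t p = 0" "\<phi>x p = 0"
    using DERIV_unique[OF \<phi>t 0, of "(\<lambda>s. (x, s, y)) -` U" t x y]
      DERIV_unique[OF \<phi>x 0, of "(\<lambda>z. (z, t, y)) -` U" x t y] U(2) p xty by auto
qed

text \<open>\<open>Gam\<close> is compact and \<open>Omega\<close> contains the points over its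
  boundary, so \<phi> may be nonzero there. Boundedness and a positive distance from
  \<open>t = 0\<close> already make the support relative to \<open>Omega\<close> a compact subset of
  it.\<close>

lemma test_functions_Omega:
  fixes \<phi> :: "real \<times> real \<times> (real ^ 'n) \<Rightarrow> real"
  assumes \<phi>: "smooth \<phi>" and a: "a > 0" and supp: "\<And>p. \<phi> p \<noteq> 0 \<Longrightarrow> norm p \<le> B \<and> a \<le> fst (snd p)"
  shows "\<phi> \<in> test_functions Omega"
proof -
  let ?y = "\<lambda>p :: real \<times> real \<times> (real ^ 'n). snd (snd p)"
  let ?C = "cball 0 B \<inter> {p. a \<le> fst (snd p)} \<inter> ?y -` Gam"
  have "continuous_on UNIV ?y" by (intro continuous_intros)
  then have "closed (?y -` Gam)"
    using closed_vimage[OF compact_imp_closed[OF Gam_compact]] by blast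
  then have "closed ?C"
    by (intro closed_Int closed_cball closed_Collect_le continuous_intros compact_imp_closed[OF Gam_compact])
  then have sub: "closure {p \<in> Omega. \<phi> p \<noteq> 0} \<subseteq> ?C"
    using supp by (intro closure_minimal) (auto simp: in_Omega_iff)
  then have "compact (closure {p \<in> Omega. \<phi> p \<noteq> 0})"
    by (meson bounded_cball bounded_subset closed_closure compact_eq_bounded_closed inf_le1 order_trans)
  moreover have "?C \<subseteq> Omega" using a by (auto simp: in_Omega_iff)
  ultimately show ?thesis
    using \<phi> sub unfolding test_functions_def by auto
qed

section \<open>The inequality for the difference of two solutions\<close>

text \<open>The entropy inequalities concern \<open>u\<close> and \<open>v\<close>; all estimates
  are carried out for the representatives \<open>u'\<close> and \<open>v'\<close>. One set
  \<open>J\<close> holds the values of both, because each supplies the constants for the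
  other.\<close>

locale entropy_pair = scalar_flux I J f f' L
  for I J :: "real set" and f f' :: "real \<Rightarrow> real" and L :: real +
  fixes \<rho> r :: "real ^ 'n \<Rightarrow> real" and C M \<alpha> :: real
    and u v u' v' :: "real \<times> real \<times> (real ^ 'n) \<Rightarrow> real"
  assumes r: "density_version \<rho> r C"
    and bJ: "\<And>v. v \<in> J \<Longrightarrow> \<bar>v\<bar> \<le> M"
    and \<alpha>: "L \<le> \<alpha>" "0 < \<alpha>"
    and ent: "entropy_inequalities \<rho> I f u" "entropy_inequalities \<rho> I f v"
    and u' [measurable]: "u' \<in> borel_measurable borel" and v' [measurable]: "v' \<in> borel_measurable borel"
    and u'J: "\<And>p. u' p \<in> J" and v'J: "\<And>p. v' p \<in> J"
    and u'eq: "AE p in lborel. p \<in> Omega \<longrightarrow> u p = u' p"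
    and v'eq: "AE p in lborel. p \<in> Omega \<longrightarrow> v p = v' p"
begin

lemma r_measurable [measurable]: "r \<in> borel_measurable borel"
  and r_nonneg: "0 \<le> r y" and r_le: "r y \<le> C"
  using r by (auto simp: density_version_def)

lemma C_nonneg: "0 \<le> C"
  using r_nonneg r_le order_trans by blast

lemma M_nonneg: "0 \<le> M"
  using bJ[OF u'J[of 0]] by linarith

lemma kato_inequality:
  assumes \<psi>: "smooth \<psi>" "\<And>p. 0 \<le> \<psi> p" and a: "a > 0"
    and supp: "\<And>p. \<psi> p \<noteq> 0 \<Longrightarrow> norm p \<le> R \<and> a \<le> fst (snd p)"
    and \<psi>t: "\<And>x t y. ((\<lambda>s. \<psi> (x, s, y)) has_real_derivative \<psi>t (x, t, y)) (at t)"
    and \<psi>x: "\<And>x t y. ((\<lambda>z. \<psi> (z, t, y)) has_real_derivative \<psi>x (x, t, y)) (at x)"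
    and cont: "continuous_on UNIV \<psi>t" "continuous_on UNIV \<psi>x"
  shows "0 \<le> (\<integral>p. (\<bar>u' p - v' p\<bar> * \<psi>t p + kflux (u' p) (v' p) * \<psi>x p) * (weight r p)\<^sup>2 \<partial>lborel)"
proof (rule doubling_limit[where M=M and C=C and R=R])
  have far: "open (- cball 0 R :: (real \<times> real \<times> (real ^ 'n)) set)" by auto
  have "\<And>p. p \<in> - cball 0 R \<Longrightarrow> \<psi> p = 0" using supp by fastforce
  note van = partials_vanish[OF \<psi>t \<psi>x far this]
  show \<psi>0: "\<psi>t p = 0 \<and> \<psi>x p = 0" if "norm p > R" for p
    using van[of p] that by auto
  fix d :: real assume "d > 0"
  \<comment> \<open>In the inequality for \<open>v\<close> the test function
    \<open>\<psi> p * K (p - q)\<close> is a function of \<open>q\<close>, so its support can lie up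
    to \<open>d'\<close> earlier than that of \<psi>. With \<open>d' \<le> a/2\<close> it still
    vanishes for times below \<open>a/2\<close>.\<close>
  define d' where "d' = min d (a/2)"
  have d': "d' > 0" "d' \<le> d" "d' \<le> a/2" using \<open>d > 0\<close> a by (auto simp: d'_def)
  obtain K :: "real \<times> real \<times> (real ^ 'n) \<Rightarrow> real" where K: "mollifier d' K" "smooth K"
    using mollifier_exists[OF d'(1)] by blast
  obtain Kt Kx where Kt: "\<And>x t y. ((\<lambda>s. K (x, s, y)) has_real_derivative Kt (x, t, y)) (at t)"
    and Kx: "\<And>x t y. ((\<lambda>z. K (z, t, y)) has_real_derivative Kx (x, t, y)) (at x)"
    and Kc: "continuous_on UNIV Kt" "continuous_on UNIV Kx"
    using smooth_partials[OF K(2)] by blast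
  have nn: "0 \<le> K z" and Ksupp: "K z \<noteq> 0 \<Longrightarrow> norm z < d'" for z using K(1) unfolding mollifier_def by blast+
  have "open (- cball 0 d' :: (real \<times> real \<times> (real ^ 'n)) set)" by auto
  moreover have "\<And>p. p \<in> - cball 0 d' \<Longrightarrow> K p = 0" using Ksupp by fastforce
  ultimately have Kvan: "p \<in> - cball 0 d' \<Longrightarrow> Kt p = 0" "p \<in> - cball 0 d' \<Longrightarrow> Kx p = 0" for p
    using partials_vanish[OF Kt Kx] by blast+
  have "mollifier d K" using K(1) d'(2) unfolding mollifier_def by (meson order_less_le_trans)
  moreover have "0 \<le> (\<integral>z. (\<bar>u' (fst z) - v' (snd z)\<bar> * \<psi>t (fst z) + kflux (u' (fst z)) (v' (snd z)) * \<psi>x (fst z))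
        * K (fst z - snd z) * weight r (fst z) * weight r (snd z) \<partial>lborel)"
  \<comment> \<open>The derivatives of \<open>K\<close> are obtained as 0 only on the open set
    \<open>norm z > d'\<close>; the radius \<open>2 * d'\<close> turns this into a condition with a
    non-strict inequality.\<close>
  proof (rule doubling[where M=M and C=C and R=R and d="2 * d'" and \<psi>=\<psi> and Kt=Kt and Kx=Kx])
    show "K z = 0 \<and> Kt z = 0 \<and> Kx z = 0" if "2 * d' \<le> norm z" for z
      using Kvan[of z] Ksupp[of z] that d'(1) by (cases "K z = 0") auto
    show "\<psi> p = 0 \<and> \<psi>t p = 0 \<and> \<psi>x p = 0" if "R < norm p" for p
      using supp[of p] \<psi>0[OF that] that by force
    fix q
    have comp: "continuous_on UNIV (\<lambda>p. g (p - q))" if "continuous_on UNIV g" for g :: "real \<times> real \<times> (real ^ 'n) \<Rightarrow> real"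
      by (rule continuous_on_compose2[OF that]) (auto intro: continuous_intros)
    have sm: "smooth (\<lambda>p. \<psi> p * K (p - q))"
    proof
      fix k
      have "Ck_on k UNIV (\<lambda>p. K (id p + - q))"
        using K(2) by (intro Ck_on_affine) (auto simp: id_def)
      then show "Ck_on k UNIV (\<lambda>p. \<psi> p * K (p - q))"
        using \<psi>(1) by (intro Ck_on_mult) auto
    qed
    obtain x' t' y' where q: "q = (x', t', y')" by (cases q)
    show "0 \<le> (\<integral>p. (\<bar>u' p - v' q\<bar> * (\<psi>t p * K (p - q) + \<psi> p * Kt (p - q)) +
        kflux (u' p) (v' q) * (\<psi>x p * K (p - q) + \<psi> p * Kx (p - q))) * weight r p \<partial>lborel)"
    proof (rule kruzkov_inequality[OF ent(1) u' u'J bJ u'eq r v'J, where \<phi>="\<lambda>p. \<psi> p * K (p - q)" and S="cball 0 R"])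
      show "(\<lambda>p. \<psi> p * K (p - q)) \<in> test_functions Omega"
        using supp by (intro test_functions_Omega[OF sm a]) auto
      show "\<forall>p\<in>Omega. 0 \<le> \<psi> p * K (p - q)" using \<psi>(2) nn by auto
      fix x t :: real and y :: "real ^ 'n"
      have "((\<lambda>s. K (x - x', s - t', y - y')) has_real_derivative Kt (x - x', t - t', y - y') * 1) (at t)"
        by (rule DERIV_chain2[OF Kt]) (auto intro!: derivative_eq_intros)
      from DERIV_mult[OF \<psi>t[of x y t] this]
      show "((\<lambda>s. \<psi> (x, s, y) * K ((x, s, y) - q)) has_real_derivative
          \<psi>t (x, t, y) * K ((x, t, y) - q) + \<psi> (x, t, y) * Kt ((x, t, y) - q)) (at t)"
        by (simp add: q algebra_simps)
      have "((\<lambda>s. K (s - x', t - t', y - y')) has_real_derivative Kx (x - x', t - t', y - y') * 1) (at x)"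
        by (rule DERIV_chain2[OF Kx]) (auto intro!: derivative_eq_intros)
      from DERIV_mult[OF \<psi>x[of t y x] this]
      show "((\<lambda>z. \<psi> (z, t, y) * K ((z, t, y) - q)) has_real_derivative
          \<psi>x (x, t, y) * K ((x, t, y) - q) + \<psi> (x, t, y) * Kx ((x, t, y) - q)) (at x)"
        by (simp add: q algebra_simps)
    next
      show "continuous_on UNIV (\<lambda>p. \<psi>t p * K (p - q) + \<psi> p * Kt (p - q))"
        "continuous_on UNIV (\<lambda>p. \<psi>x p * K (p - q) + \<psi> p * Kx (p - q))"
        by (intro continuous_on_add continuous_on_mult cont comp Kc smooth_continuous[OF \<psi>(1)] smooth_continuous[OF K(2)])+
      show "\<psi>t p * K (p - q) + \<psi> p * Kt (p - q) = 0" "\<psi>x p * K (p - q) + \<psi> p * Kx (p - q) = 0"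
        if "p \<notin> cball 0 R" for p
        using \<psi>0[of p] supp[of p] that by auto
    qed auto
  next
    fix p
    have comp: "continuous_on UNIV (\<lambda>q. g (p - q))" if "continuous_on UNIV g" for g :: "real \<times> real \<times> (real ^ 'n) \<Rightarrow> real"
      by (rule continuous_on_compose2[OF that]) (auto intro: continuous_intros)
    have sm: "smooth (\<lambda>q. \<psi> p * K (p - q))"
    proof
      fix k
      have "Ck_on k UNIV (\<lambda>q. K (- q + p))"
        using K(2) by (intro Ck_on_affine) (auto intro: bounded_linear_minus bounded_linear_ident)
      then show "Ck_on k UNIV (\<lambda>q. \<psi> p * K (p - q))"
        by (intro Ck_on_mult Ck_on_const) auto
    qed
    obtain x' t' y' where p: "p = (x', t', y')" by (cases p)
    show "0 \<le> (\<integral>q. (\<bar>v' q - u' p\<bar> * (- (\<psi> p * Kt (p - q))) +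
        kflux (v' q) (u' p) * (- (\<psi> p * Kx (p - q)))) * weight r q \<partial>lborel)"
    proof (rule kruzkov_inequality[OF ent(2) v' v'J bJ v'eq r u'J, where \<phi>="\<lambda>q. \<psi> p * K (p - q)" and S="cball 0 (R + 2 * d')"])
      show "(\<lambda>q. \<psi> p * K (p - q)) \<in> test_functions Omega"
      proof (rule test_functions_Omega[OF sm, where a="a/2" and B="R + d'"])
        fix q assume "\<psi> p * K (p - q) \<noteq> 0"
        then have 1: "norm p \<le> R" "a \<le> fst (snd p)" "norm (p - q) < d'"
          using supp[of p] Ksupp[of "p - q"] by auto
        have "norm q \<le> norm p + norm (p - q)"
          using norm_triangle_ineq4[of p "p - q"] by simp
        moreover have "\<bar>fst (snd (p - q))\<bar> \<le> norm (p - q)"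
          using norm_fst_le[of "fst (snd (p - q))" "snd (snd (p - q))"] norm_snd_le[of "snd (p - q)" "fst (p - q)"]
          by (simp del: fst_diff snd_diff)
        ultimately show "norm q \<le> R + d' \<and> a/2 \<le> fst (snd q)"
          using 1 d'(3) by auto
      qed (use a in auto)
      show "\<forall>q\<in>Omega. 0 \<le> \<psi> p * K (p - q)" using \<psi>(2) nn by auto
      fix x t :: real and y :: "real ^ 'n"
      have "((\<lambda>s. K (x' - x, t' - s, y' - y)) has_real_derivative Kt (x' - x, t' - t, y' - y) * (- 1)) (at t)"
        by (rule DERIV_chain2[OF Kt]) (auto intro!: derivative_eq_intros)
      from DERIV_cmult[OF this, of "\<psi> p"]
      show "((\<lambda>s. \<psi> p * K (p - (x, s, y))) has_real_derivative - (\<psi> p * Kt (p - (x, t, y)))) (at t)"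
        by (simp add: p)
      have "((\<lambda>s. K (x' - s, t' - t, y' - y)) has_real_derivative Kx (x' - x, t' - t, y' - y) * (- 1)) (at x)"
        by (rule DERIV_chain2[OF Kx]) (auto intro!: derivative_eq_intros)
      from DERIV_cmult[OF this, of "\<psi> p"]
      show "((\<lambda>z. \<psi> p * K (p - (z, t, y))) has_real_derivative - (\<psi> p * Kx (p - (x, t, y)))) (at x)"
        by (simp add: p)
    next
      show "continuous_on UNIV (\<lambda>q. - (\<psi> p * Kt (p - q)))" "continuous_on UNIV (\<lambda>q. - (\<psi> p * Kx (p - q)))"
        by (intro continuous_on_minus continuous_on_mult continuous_on_const comp Kc)+
      show "- (\<psi> p * Kt (p - q)) = 0" "- (\<psi> p * Kx (p - q)) = 0" if "q \<notin> cball 0 (R + 2 * d')" for q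
      proof -
        have "\<psi> p = 0 \<or> p - q \<in> - cball 0 d'"
        proof (rule ccontr)
          assume "\<not> ?thesis"
          then have "norm p \<le> R" "norm (p - q) \<le> d'" using supp[of p] by auto
          moreover have "norm q \<le> norm p + norm (p - q)"
            using norm_triangle_ineq4[of p "p - q"] by simp
          ultimately show False using that d'(1) by auto
        qed
        then show "- (\<psi> p * Kt (p - q)) = 0" "- (\<psi> p * Kx (p - q)) = 0" using Kvan[of "p - q"] by auto
      qed
    qed auto
  qed (use u'J v'J bJ weight_bounds[OF r] cont Kc smooth_continuous[OF \<psi>(1)] smooth_continuous[OF K(2)] in auto)
  ultimately show "\<exists>K. mollifier d K \<and> 0 \<le> (\<integral>z. (\<bar>u' (fst z) - v' (snd z)\<bar> * \<psi>t (fst z) + kflux (u' (fst z)) (v' (snd z)) * \<psi>x (fst z))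
        * K (fst z - snd z) * weight r (fst z) * weight r (snd z) \<partial>lborel)" by blast
qed (use u'J v'J bJ weight_bounds[OF r] cont in auto)

end

section \<open>Contraction in the backward cone\<close>

lemma unit_step_primitive:
  fixes g :: "real \<Rightarrow> real"
  assumes g: "continuous_on UNIV g" "\<And>s. 0 \<le> g s" and supp: "\<And>s. g s \<noteq> 0 \<Longrightarrow> a \<le> s \<and> s \<le> b"
    and one: "(\<integral>s. g s \<partial>lborel) = 1"
  obtains P where "\<And>t. (P has_real_derivative g t) (at t)" "\<And>t. 0 \<le> P t" "\<And>t. P t \<le> 1"
    "\<And>t. t < a \<Longrightarrow> P t = 0" "\<And>t. t > b \<Longrightarrow> P t = 1"
proof -
  \<comment> \<open>Starting at \<open>a - 1\<close> instead of \<open>a\<close> makes every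
    \<open>t \<ge> a\<close> an interior point of \<open>{a - 1..t + 1}\<close>, which gives the
    two-sided derivative.\<close>
  define P where "P t = integral {a - 1..t} g" for t
  have io: "g integrable_on {x..y}" for x y
    using g(1) by (auto intro!: integrable_continuous_real intro: continuous_on_subset)
  obtain B where B: "\<And>x. \<bar>g x\<bar> \<le> B"
    using continuous_bounded_support[OF g(1), of "{a..b}"] supp by (metis atLeastAtMost_iff bounded_closed_interval)
  have "integrable lborel g"
    using g(1) B supp by (intro integrable_bounded_support[of g "{a..b}" B])
      (auto intro: borel_measurable_continuous_onI)
  from has_integral_integral_lborel[OF this] have U: "(g has_integral 1) UNIV" using one by simp
  have zero: "P t = 0" if "t < a" for t
  proof -
    have "P t = integral {a - 1..t} (\<lambda>_. 0)"
      unfolding P_def using that supp by (intro integral_cong) force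
    then show ?thesis by simp
  qed
  have der: "(P has_real_derivative g t) (at t)" for t
  proof (cases "t < a")
    case True
    have "((\<lambda>_. 0) has_real_derivative 0) (at t)" by simp
    then have "(P has_real_derivative 0) (at t)"
      by (rule has_field_derivative_transform_within_open[of _ _ _ "{..<a}"]) (use zero True in auto)
    moreover have "g t = 0" using supp[of t] True by force
    ultimately show ?thesis by simp
  next
    case False
    have "(P has_real_derivative g t) (at t within {a - 1..t + 1})"
      unfolding P_def[abs_def] using False g(1)
      by (intro integral_has_real_derivative) (auto intro: continuous_on_subset)
    moreover have "t \<in> interior {a - 1..t + 1}" using False by (simp add: interior_atLeastAtMost_real)
    ultimately show ?thesis by (metis at_within_interior)
  qed
  have "0 \<le> P t" for t
    unfolding P_def using g(2) io by (intro Henstock_Kurzweil_Integration.integral_nonneg) auto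
  moreover have "P t \<le> 1" for t
  proof -
    have "P t \<le> integral UNIV g"
      unfolding P_def using U io g(2) by (intro integral_subset_le) (auto simp: has_integral_integrable)
    then show ?thesis using U by (simp add: integral_unique)
  qed
  moreover have "P t = 1" if "t > b" for t
  proof -
    have "integral {a - 1..t} g = integral UNIV g"
      using that supp by (intro integral_spike_set negligible_subset[OF negligible_empty]) force+
    then show ?thesis using U by (simp add: P_def integral_unique)
  qed
  ultimately show ?thesis using that der zero by blast
qed

text \<open>The difference of two unit steps: it climbs along \<open>g\<close> and descends along
  \<open>h\<close>. It is nonnegative because the first step is complete before the second begins at
  \<open>c\<close>. Its derivative \<open>g - h\<close> will set the mass near the initial time
  against the mass near a later time.\<close>

lemma time_cutoff_exists:
  fixes g h :: "real \<Rightarrow> real"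
  assumes g: "smooth g" "\<And>s. 0 \<le> g s" "\<And>s. g s \<noteq> 0 \<Longrightarrow> a \<le> s \<and> s \<le> b" "(\<integral>s. g s \<partial>lborel) = 1"
    and h: "smooth h" "\<And>s. 0 \<le> h s" "\<And>s. h s \<noteq> 0 \<Longrightarrow> c \<le> s \<and> s \<le> e" "(\<integral>s. h s \<partial>lborel) = 1"
    and le: "a \<le> c" "b < c"
  obtains A where "smooth A" "\<And>t. (A has_real_derivative g t - h t) (at t)" "\<And>t. 0 \<le> A t"
    "\<And>t. A t \<noteq> 0 \<Longrightarrow> a \<le> t \<and> t \<le> e"
proof -
  obtain P where P: "\<And>t. (P has_real_derivative g t) (at t)" "\<And>t. 0 \<le> P t" "\<And>t. P t \<le> 1"
    "\<And>t. t < a \<Longrightarrow> P t = 0" "\<And>t. t > b \<Longrightarrow> P t = 1"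
    using unit_step_primitive[OF smooth_continuous[OF g(1)] g(2,3,4)] by blast
  obtain Q where Q: "\<And>t. (Q has_real_derivative h t) (at t)" "\<And>t. 0 \<le> Q t" "\<And>t. Q t \<le> 1"
    "\<And>t. t < c \<Longrightarrow> Q t = 0" "\<And>t. t > e \<Longrightarrow> Q t = 1"
    using unit_step_primitive[OF smooth_continuous[OF h(1)] h(2,3,4)] by blast
  have be: "c \<le> e"
  proof (rule ccontr)
    assume "\<not> c \<le> e"
    then have "h = (\<lambda>_. 0)" using h(3) by force
    then show False using h(4) by simp
  qed
  have der: "((\<lambda>t. P t - Q t) has_real_derivative g t - h t) (at t)" for t
    by (intro DERIV_diff P Q)
  have sd: "smooth (\<lambda>t. g t - h t)"
  proof
    fix k
    have "Ck_on k UNIV (\<lambda>t. g t + (-1) * h t)"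
      using g(1) h(1) by (intro Ck_on_add Ck_on_mult Ck_on_const) auto
    then show "Ck_on k UNIV (\<lambda>t. g t - h t)" by simp
  qed
  show ?thesis
  proof (rule that[of "\<lambda>t. P t - Q t"])
    show "smooth (\<lambda>t. P t - Q t)" using smooth_antiderivative[OF der sd] .
    fix t
    show "((\<lambda>t. P t - Q t) has_real_derivative g t - h t) (at t)" by (rule der)
    show "0 \<le> P t - Q t"
      using P(2)[of t] P(5)[of t] Q(3)[of t] Q(4)[of t] le by (cases "t < c") auto
    show "a \<le> t \<and> t \<le> e" if "P t - Q t \<noteq> 0"
    proof (rule ccontr)
      assume "\<not> (a \<le> t \<and> t \<le> e)"
      then consider "t < a" "t < c" | "t > e" "t > b" using le be by linarith
      then show False using that P(4)[of t] P(5)[of t] Q(4)[of t] Q(5)[of t] by cases auto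
    qed
  qed
qed

lemma mult_le_abs_mult: "x * y \<le> \<bar>x\<bar> * \<bar>y\<bar>" for x y :: real
  by (metis abs_ge_self abs_mult)

lemma norm_triple_le: "norm (x, t, y) \<le> \<bar>x\<bar> + \<bar>t\<bar> + norm y" for x t :: real
  using norm_Pair_le[of x "(t, y)"] norm_Pair_le[of t y] by simp

section \<open>The smoothed backward cone\<close>

context entropy_pair
begin

text \<open>As \<open>n\<close> grows this increases to the indicator of
  \<open>\<bar>x\<bar> < R - \<alpha> * t\<close>. Both edges move inwards with speed \<alpha>, so
  the time derivative is -\<alpha> times a nonnegative quantity that dominates the absolute value of
  the space derivative.\<close>

definition cone_cutoff :: "real \<Rightarrow> real \<Rightarrow> real \<Rightarrow> real \<Rightarrow> real" where
  "cone_cutoff n R x t = flat 0 (n * (R - \<alpha> * t - x)) * flat 0 (n * (R - \<alpha> * t + x))"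

lemma cone_bounds: "0 \<le> cone_cutoff n R x t" "cone_cutoff n R x t \<le> 1"
  by (auto simp: cone_cutoff_def intro!: mult_nonneg_nonneg mult_le_one flat_nonneg flat_0_le_1)

lemma cone_support: "n > 0 \<Longrightarrow> cone_cutoff n R x t \<noteq> 0 \<Longrightarrow> \<bar>x\<bar> < R - \<alpha> * t"
  by (auto simp: cone_cutoff_def flat_0_eq_0_iff not_le zero_less_mult_iff)

lemma cone_measurable [measurable (raw)]:
  assumes [measurable]: "a \<in> borel_measurable N" "b \<in> borel_measurable N"
  shows "(\<lambda>p. cone_cutoff n R (a p) (b p)) \<in> borel_measurable N"
proof -
  have [measurable]: "flat 0 \<in> borel_measurable borel"
    by (intro borel_measurable_continuous_onI smooth_continuous smooth_flat)
  show ?thesis unfolding cone_cutoff_def by measurable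
qed

text \<open>Differentiating the cone cutoff contributes nothing positive: the flux through the
  moving edges is at most \<alpha> times \<open>\<bar>u' p - v' p\<bar>\<close>, and that much is
  removed by the motion of the edges. Only the derivative of the time factor \<open>A\<close>
  survives.\<close>

lemma cone_inequality:
  assumes A: "smooth A" "\<And>t. (A has_real_derivative A' t) (at t)" "continuous_on UNIV A'" "\<And>t. 0 \<le> A t"
      "\<And>t. A t \<noteq> 0 \<Longrightarrow> a \<le> t \<and> t \<le> b" "a > 0"
    and \<xi>: "smooth \<xi>" "\<And>y. 0 \<le> \<xi> y" "\<And>y. \<xi> y \<noteq> 0 \<Longrightarrow> norm y \<le> Y"
    and n: "n > 0"
  shows "0 \<le> (\<integral>p. \<bar>u' p - v' p\<bar> * (A' (fst (snd p)) * cone_cutoff n R (fst p) (fst (snd p)) * \<xi> (snd (snd p)))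
      * (weight r p)\<^sup>2 \<partial>lborel)"
proof -
  let ?x = "\<lambda>p :: real \<times> real \<times> (real ^ 'n). fst p" and ?t = "\<lambda>p :: real \<times> real \<times> (real ^ 'n). fst (snd p)"
    and ?y = "\<lambda>p :: real \<times> real \<times> (real ^ 'n). snd (snd p)"
  let ?m = "\<lambda>p. n * (R - \<alpha> * ?t p - ?x p)" and ?p = "\<lambda>p. n * (R - \<alpha> * ?t p + ?x p)"
  let ?\<psi> = "\<lambda>p. A (?t p) * cone_cutoff n R (?x p) (?t p) * \<xi> (?y p)"
  \<comment> \<open>The time derivative of the cone cutoff is \<open>- \<alpha> * ?w p\<close>; here
    \<open>flat 2\<close> appears as the derivative of \<open>flat 0\<close>.\<close>
  let ?w = "\<lambda>p. n * (flat 2 (?m p) * flat 0 (?p p) + flat 0 (?m p) * flat 2 (?p p))"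
  let ?\<psi>t = "\<lambda>p. (A' (?t p) * cone_cutoff n R (?x p) (?t p) - \<alpha> * A (?t p) * ?w p) * \<xi> (?y p)"
  let ?\<psi>x = "\<lambda>p. A (?t p) * (n * (flat 0 (?m p) * flat 2 (?p p) - flat 2 (?m p) * flat 0 (?p p))) * \<xi> (?y p)"
  have flatc: "continuous_on UNIV (\<lambda>p. flat j (g p))" if "continuous_on UNIV g" for j and g :: "real \<times> real \<times> (real ^ 'n) \<Rightarrow> real"
    by (rule continuous_on_compose2[OF smooth_continuous[OF smooth_flat] that]) auto
  have compc: "continuous_on UNIV (\<lambda>p. h (g p))" if "continuous_on UNIV h" "continuous_on UNIV g"
    for h :: "'c::topological_space \<Rightarrow> real" and g :: "real \<times> real \<times> (real ^ 'n) \<Rightarrow> 'c"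
    by (rule continuous_on_compose2[OF that]) auto
  have sm: "smooth ?\<psi>"
  proof
    fix k
    have "Ck_on k UNIV (\<lambda>p. A (?t p + 0))"
      using A(1) by (intro Ck_on_affine bounded_linear_compose[OF bounded_linear_fst bounded_linear_snd]) auto
    moreover have "Ck_on k UNIV (\<lambda>p. flat 0 (n * (- \<alpha> * ?t p - ?x p) + n * R))"
      using smooth_flat by (intro Ck_on_affine bounded_linear_const_mult bounded_linear_sub
          bounded_linear_compose[OF bounded_linear_fst bounded_linear_snd] bounded_linear_fst) auto
    moreover have "Ck_on k UNIV (\<lambda>p. flat 0 (n * (- \<alpha> * ?t p + ?x p) + n * R))"
      using smooth_flat by (intro Ck_on_affine bounded_linear_const_mult bounded_linear_add
          bounded_linear_compose[OF bounded_linear_fst bounded_linear_snd] bounded_linear_fst) auto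
    moreover have "Ck_on k UNIV (\<lambda>p. \<xi> (?y p + 0))"
      using \<xi>(1) by (intro Ck_on_affine bounded_linear_compose[OF bounded_linear_snd bounded_linear_snd]) auto
    ultimately have "Ck_on k UNIV (\<lambda>p. A (?t p + 0) * (flat 0 (n * (- \<alpha> * ?t p - ?x p) + n * R) *
        flat 0 (n * (- \<alpha> * ?t p + ?x p) + n * R)) * \<xi> (?y p + 0))"
      by (intro Ck_on_mult)
    moreover have "n * (- \<alpha> * ?t p - ?x p) + n * R = ?m p" "n * (- \<alpha> * ?t p + ?x p) + n * R = ?p p" for p
      by (simp_all add: algebra_simps)
    ultimately show "Ck_on k UNIV ?\<psi>" by (simp only: cone_cutoff_def add_0_right)
  qed
  have fd: "(flat 0 has_real_derivative flat 2 z) (at z)" for z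
    using flat_has_derivative[of 0 z] by (simp add: numeral_2_eq_2)
  have dt: "((\<lambda>s. ?\<psi> (x, s, y)) has_real_derivative ?\<psi>t (x, t, y)) (at t)" for x t y
  proof -
    have m: "((\<lambda>s. flat 0 (n * (R - \<alpha> * s - x))) has_real_derivative flat 2 (n * (R - \<alpha> * t - x)) * (n * - \<alpha>)) (at t)"
      by (rule DERIV_chain2[OF fd]) (auto intro!: derivative_eq_intros)
    have p: "((\<lambda>s. flat 0 (n * (R - \<alpha> * s + x))) has_real_derivative flat 2 (n * (R - \<alpha> * t + x)) * (n * - \<alpha>)) (at t)"
      by (rule DERIV_chain2[OF fd]) (auto intro!: derivative_eq_intros)
    show ?thesis
      unfolding cone_cutoff_def fst_conv snd_conv
      by (rule DERIV_cong[OF DERIV_cmult_right[OF DERIV_mult[OF A(2) DERIV_mult[OF m p]]]])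
         (simp add: algebra_simps)
  qed
  have dx: "((\<lambda>z. ?\<psi> (z, t, y)) has_real_derivative ?\<psi>x (x, t, y)) (at x)" for x t y
  proof -
    have m: "((\<lambda>z. flat 0 (n * (R - \<alpha> * t - z))) has_real_derivative flat 2 (n * (R - \<alpha> * t - x)) * (- n)) (at x)"
      by (rule DERIV_chain2[OF fd]) (auto intro!: derivative_eq_intros)
    have p: "((\<lambda>z. flat 0 (n * (R - \<alpha> * t + z))) has_real_derivative flat 2 (n * (R - \<alpha> * t + x)) * n) (at x)"
      by (rule DERIV_chain2[OF fd]) (auto intro!: derivative_eq_intros)
    show ?thesis
      unfolding cone_cutoff_def fst_conv snd_conv
      by (rule DERIV_cong[OF DERIV_cmult_right[OF DERIV_cmult[OF DERIV_mult[OF m p]]]])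
         (simp add: algebra_simps)
  qed
  have cc: "continuous_on UNIV (\<lambda>p. cone_cutoff n R (?x p) (?t p))"
    unfolding cone_cutoff_def by (intro continuous_on_mult flatc continuous_intros)
  have cw: "continuous_on UNIV ?w"
    by (intro continuous_on_mult continuous_on_add continuous_on_const flatc continuous_intros)
  have cA: "continuous_on UNIV (\<lambda>p. A (?t p))" "continuous_on UNIV (\<lambda>p. A' (?t p))" "continuous_on UNIV (\<lambda>p. \<xi> (?y p))"
  proof -
    have "continuous_on UNIV ?t" "continuous_on UNIV ?y" by (intro continuous_intros)+
    then show "continuous_on UNIV (\<lambda>p. A (?t p))" "continuous_on UNIV (\<lambda>p. A' (?t p))" "continuous_on UNIV (\<lambda>p. \<xi> (?y p))"
      using compc[OF smooth_continuous[OF A(1)], of ?t] compc[OF A(3), of ?t] compc[OF smooth_continuous[OF \<xi>(1)], of ?y]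
      by blast+
  qed
  have ct: "continuous_on UNIV ?\<psi>t"
    by (intro continuous_on_mult[OF _ cA(3)] continuous_on_diff continuous_on_mult continuous_on_const cA cc cw)
  have cx: "continuous_on UNIV ?\<psi>x"
    by (intro continuous_on_mult continuous_on_diff continuous_on_const cA flatc continuous_intros)
  have c0: "continuous_on UNIV (\<lambda>p. A' (?t p) * cone_cutoff n R (?x p) (?t p) * \<xi> (?y p))"
    by (intro continuous_on_mult cA cc)
  define B where "B = \<bar>R\<bar> + \<bar>b\<bar> + \<bar>Y\<bar>"
  have A'0: "A' t = 0" if "t < a \<or> t > b" for t
  proof -
    have "((\<lambda>_. 0) has_real_derivative 0) (at t)" by simp
    then have "(A has_real_derivative 0) (at t)"
      by (rule has_field_derivative_transform_within_open[of _ _ _ "{..<a} \<union> {b<..}"])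
         (use that A(5) in \<open>force+\<close>)
    then show ?thesis using A(2) DERIV_unique by blast
  qed
  have bnd: "norm (x, t, y) \<le> B" if "a \<le> t" "t \<le> b" "cone_cutoff n R x t \<noteq> 0" "\<xi> y \<noteq> 0" for x t and y :: "real ^ 'n"
  proof -
    have "0 \<le> \<alpha> * t" using \<alpha>(2) A(6) that(1) by auto
    then have "\<bar>x\<bar> \<le> \<bar>R\<bar>" using cone_support[OF n that(3)] by linarith
    moreover have "\<bar>t\<bar> \<le> \<bar>b\<bar>" using that A(6) by auto
    moreover have "norm y \<le> \<bar>Y\<bar>" using \<xi>(3)[OF that(4)] by linarith
    ultimately show ?thesis
      using norm_triple_le[of x t y] unfolding B_def by linarith
  qed
  have supp: "norm p \<le> B \<and> a \<le> ?t p" if "?\<psi> p \<noteq> 0" for p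
    using that A(5)[of "?t p"] bnd[of "?t p" "?x p" "?y p"] by (cases p) auto
  have ge: "0 \<le> (\<integral>p. (\<bar>u' p - v' p\<bar> * ?\<psi>t p + kflux (u' p) (v' p) * ?\<psi>x p) * (weight r p)\<^sup>2 \<partial>lborel)"
    by (rule kato_inequality[OF sm _ A(6) supp dt dx ct cx])
       (auto intro!: mult_nonneg_nonneg A(4) \<xi>(2) cone_bounds)
  have [measurable]: "(\<lambda>p. kflux (u' p) (v' p)) \<in> borel_measurable borel"
    using u'J v'J by (intro kflux_measurable) auto
  have far: "open (- cball 0 B :: (real \<times> real \<times> (real ^ 'n)) set)" by auto
  have "\<And>p. p \<in> - cball 0 B \<Longrightarrow> ?\<psi> p = 0" using supp by fastforce
  note van = partials_vanish[OF dt dx far this]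
  have uvb: "\<bar>u' p - v' p\<bar> \<le> 2 * M" for p using bJ[OF u'J[of p]] bJ[OF v'J[of p]] by linarith
  have int: "integrable lborel (\<lambda>p. (a p * h p) * (weight r p)\<^sup>2)"
    if [measurable]: "a \<in> borel_measurable borel" and a: "\<And>p. \<bar>a p\<bar> \<le> amax"
      and h: "continuous_on UNIV h" "\<And>p. p \<notin> cball 0 B \<Longrightarrow> h p = 0" for a amax h
  proof -
    have [measurable]: "h \<in> borel_measurable borel" using h(1) by (rule borel_measurable_continuous_onI)
    obtain H where H: "H > 0" "\<And>p. \<bar>h p\<bar> \<le> H"
      using continuous_bounded_support[OF h(1) bounded_cball h(2)] by blast
    show ?thesis
    proof (rule integrable_bounded_support[of _ "cball 0 B" "amax * H * C\<^sup>2"])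
      fix p
      have "0 \<le> amax" using a[of p] by linarith
      then show "\<bar>(a p * h p) * (weight r p)\<^sup>2\<bar> \<le> amax * H * C\<^sup>2"
        unfolding abs_mult using a[of p] H weight_bounds[OF r, of p]
        by (intro mult_mono mult_nonneg_nonneg) (auto intro: power_mono)
    qed (use h in auto)
  qed
  have kb: "\<bar>kflux (u' p) (v' p)\<bar> \<le> L * (2 * M)" for p
    using kflux_bound[OF u'J v'J, of p p] mult_left_mono[OF uvb L(2), of p] by linarith
  have i1: "integrable lborel (\<lambda>p. (\<bar>u' p - v' p\<bar> * ?\<psi>t p) * (weight r p)\<^sup>2)"
    using van(1) by (intro int[of "\<lambda>p. \<bar>u' p - v' p\<bar>" "2 * M"] ct) (auto simp: uvb)
  have i2: "integrable lborel (\<lambda>p. (kflux (u' p) (v' p) * ?\<psi>x p) * (weight r p)\<^sup>2)"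
    using van(2) by (intro int[of "\<lambda>p. kflux (u' p) (v' p)" "L * (2 * M)"] cx) (auto simp: kb)
  have "A' (?t p) * cone_cutoff n R (?x p) (?t p) * \<xi> (?y p) = 0" if "p \<notin> cball 0 B" for p
    using A'0[of "?t p"] bnd[of "?t p" "?x p" "?y p"] that by (cases p) (force simp: not_less)
  then have i3: "integrable lborel (\<lambda>p. (\<bar>u' p - v' p\<bar> * (A' (?t p) * cone_cutoff n R (?x p) (?t p) * \<xi> (?y p))) * (weight r p)\<^sup>2)"
    by (intro int[of "\<lambda>p. \<bar>u' p - v' p\<bar>" "2 * M"] c0) (auto simp: uvb)
  note ge
  also have "(\<integral>p. (\<bar>u' p - v' p\<bar> * ?\<psi>t p + kflux (u' p) (v' p) * ?\<psi>x p) * (weight r p)\<^sup>2 \<partial>lborel)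
    \<le> (\<integral>p. (\<bar>u' p - v' p\<bar> * (A' (?t p) * cone_cutoff n R (?x p) (?t p) * \<xi> (?y p))) * (weight r p)\<^sup>2 \<partial>lborel)"
  proof (rule integral_mono[OF _ i3])
    show "integrable lborel (\<lambda>p. (\<bar>u' p - v' p\<bar> * ?\<psi>t p + kflux (u' p) (v' p) * ?\<psi>x p) * (weight r p)\<^sup>2)"
      using Bochner_Integration.integrable_add[OF i1 i2] by (simp add: distrib_right)
    fix p
    let ?D = "\<bar>u' p - v' p\<bar>"
    have w0: "0 \<le> ?w p" using n by (intro mult_nonneg_nonneg add_nonneg_nonneg flat_nonneg) auto
    have "kflux (u' p) (v' p) * (n * (flat 0 (?m p) * flat 2 (?p p) - flat 2 (?m p) * flat 0 (?p p)))
        \<le> \<bar>kflux (u' p) (v' p)\<bar> * \<bar>n * (flat 0 (?m p) * flat 2 (?p p) - flat 2 (?m p) * flat 0 (?p p))\<bar>"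
      by (rule mult_le_abs_mult)
    also have "\<dots> \<le> (\<alpha> * ?D) * ?w p"
    proof (rule mult_mono)
      have "\<bar>kflux (u' p) (v' p)\<bar> \<le> L * ?D" by (rule kflux_bound[OF u'J v'J])
      also have "\<dots> \<le> \<alpha> * ?D" using \<alpha>(1) by (intro mult_right_mono) auto
      finally show "\<bar>kflux (u' p) (v' p)\<bar> \<le> \<alpha> * ?D" .
      have "0 \<le> flat 2 (?m p) * flat 0 (?p p)" "0 \<le> flat 0 (?m p) * flat 2 (?p p)"
        by (auto intro!: mult_nonneg_nonneg flat_nonneg)
      then have "\<bar>flat 0 (?m p) * flat 2 (?p p) - flat 2 (?m p) * flat 0 (?p p)\<bar>
          \<le> flat 2 (?m p) * flat 0 (?p p) + flat 0 (?m p) * flat 2 (?p p)" by linarith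
      then show "\<bar>n * (flat 0 (?m p) * flat 2 (?p p) - flat 2 (?m p) * flat 0 (?p p))\<bar> \<le> ?w p"
        using n unfolding abs_mult by (intro mult_mono) auto
    qed (use \<alpha>(2) w0 in auto)
    finally have k: "kflux (u' p) (v' p) * (n * (flat 0 (?m p) * flat 2 (?p p) - flat 2 (?m p) * flat 0 (?p p)))
      \<le> (\<alpha> * ?D) * ?w p" .
    have nn: "0 \<le> A (?t p) * \<xi> (?y p)" using A(4) \<xi>(2) by auto
    have alg: "D * ((a' * c - \<alpha> * A0 * w) * x) + k * (A0 * X * x) \<le> D * (a' * c * x)"
      if "(A0 * x) * (k * X) \<le> (A0 * x) * ((\<alpha> * D) * w)" for A0 x k X D w a' c :: real
      using that by (simp add: algebra_simps)
    have "?D * ?\<psi>t p + kflux (u' p) (v' p) * ?\<psi>x p \<le> ?D * (A' (?t p) * cone_cutoff n R (?x p) (?t p) * \<xi> (?y p))"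
      by (rule alg[OF mult_left_mono[OF k nn]])
    then show "(?D * ?\<psi>t p + kflux (u' p) (v' p) * ?\<psi>x p) * (weight r p)\<^sup>2
        \<le> (?D * (A' (?t p) * cone_cutoff n R (?x p) (?t p) * \<xi> (?y p))) * (weight r p)\<^sup>2"
      by (rule mult_right_mono) simp
  qed
  finally show ?thesis .
qed

end

section \<open>Iterated integrals and null sets in the variables (x, t, y)\<close>

lemma integral_product_functions:
  fixes a :: "'a::euclidean_space \<Rightarrow> real" and b :: "'b::euclidean_space \<Rightarrow> real"
  assumes "integrable lborel (\<lambda>z. a (fst z) * b (snd z))"
  shows "(\<integral>z. a (fst z) * b (snd z) \<partial>lborel) = (\<integral>x. a x \<partial>lborel) * (\<integral>y. b y \<partial>lborel)"
  using lborel_pair.integral_fst[of "\<lambda>x y. a x * b y"] assms by (simp add: lborel_prod case_prod_beta')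

lemma integral_x_last:
  fixes g :: "'a::euclidean_space \<times> 'b::euclidean_space \<Rightarrow> real"
  assumes "integrable lborel g"
  shows "(\<integral>p. g p \<partial>lborel) = (\<integral>z. (\<integral>x. g (x, z) \<partial>lborel) \<partial>lborel)"
  using lborel_pair.integral_snd[of "\<lambda>x z. g (x, z)"] assms by (simp add: lborel_prod case_prod_beta')

lemma integrable_triple:
  fixes g :: "real \<times> real \<times> 'b::euclidean_space \<Rightarrow> real"
  assumes "g \<in> borel_measurable borel" "\<And>p. \<bar>g p\<bar> \<le> B"
    and "\<And>x t y. g (x, t, y) \<noteq> 0 \<Longrightarrow> \<bar>x\<bar> \<le> a \<and> \<bar>t\<bar> \<le> b \<and> norm y \<le> c"
  shows "integrable lborel g"
proof (rule integrable_bounded_support[of g "cball 0 (a + b + c)" B])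
  show "g p = 0" if "p \<notin> cball 0 (a + b + c)" for p
  proof (rule ccontr)
    assume "g p \<noteq> 0"
    obtain x t y where p: "p = (x, t, y)" by (cases p)
    then show False
      using assms(3)[of x t y] \<open>g p \<noteq> 0\<close> norm_triple_le[of x t y] that by auto
  qed
qed (use assms in auto)

text \<open>Lets the representative of a function of \<open>(x, y)\<close>, such as an initial
  datum, be used under integrals over \<open>(x, t, y)\<close>.\<close>

lemma AE_lborel_xty:
  fixes P :: "'a::euclidean_space \<times> 'b::euclidean_space \<Rightarrow> bool"
  assumes "AE q in lborel. P q"
  shows "AE p in (lborel :: ('a \<times> 'c::euclidean_space \<times> 'b) measure). P (fst p, snd (snd p))"
proof -
  obtain N where N: "{q. \<not> P q} \<subseteq> N" "N \<in> null_sets lborel"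
    using assms by (auto simp: eventually_ae_filter)
  have [measurable]: "N \<in> sets borel" using N by auto
  have "AE q in lborel \<Otimes>\<^sub>M lborel. q \<notin> N"
    unfolding lborel_prod using N(2) by (rule AE_not_in)
  then have "AE x in lborel. AE y in lborel. (x, y) \<notin> N"
    by (rule lborel_pair.AE_pair)
  then have "AE x in lborel. AE z in (lborel :: ('c \<times> 'b) measure). (x, snd z) \<notin> N"
    by eventually_elim (rule AE_lborel_snd)
  moreover have "Measurable.pred (lborel \<Otimes>\<^sub>M lborel) (\<lambda>p :: 'a \<times> 'c \<times> 'b. (fst p, snd (snd p)) \<notin> N)"
    unfolding lborel_prod by measurable
  ultimately have "AE p in (lborel \<Otimes>\<^sub>M lborel :: ('a \<times> 'c \<times> 'b) measure). (fst p, snd (snd p)) \<notin> N"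
    by (intro lborel_pair.AE_pair_measure) (auto simp: pred_def)
  then show ?thesis
    unfolding lborel_prod by eventually_elim (use N(1) in auto)
qed

lemma AE_lborel_x_last:
  assumes "AE p in (lborel :: ('a::euclidean_space \<times> 'b::euclidean_space) measure). P p"
  shows "AE z in lborel. AE x in lborel. P (x, z)"
proof -
  obtain N where N: "{q. \<not> P q} \<subseteq> N" "N \<in> null_sets lborel"
    using assms by (auto simp: eventually_ae_filter)
  have [measurable]: "N \<in> sets borel" using N by auto
  have "AE q in lborel \<Otimes>\<^sub>M lborel. q \<notin> N"
    unfolding lborel_prod using N(2) by (rule AE_not_in)
  then have "AE x in lborel. AE z in lborel. (x, z) \<notin> N"
    by (rule lborel_pair.AE_pair)
  moreover have "Measurable.pred (lborel \<Otimes>\<^sub>M lborel) (\<lambda>p :: 'a \<times> 'b. (fst p, snd p) \<notin> N)"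
    unfolding lborel_prod by measurable
  ultimately have "AE z in lborel. AE x in lborel. (x, z) \<notin> N"
    by (subst lborel_pair.AE_commute[symmetric]) (auto simp: pred_def)
  then show ?thesis
    by eventually_elim (erule eventually_mono, use N(1) in auto)
qed

lemma AE_lborel_x_lastI:
  assumes "N \<in> sets borel" "AE z in lborel. AE x in lborel. (x, z) \<notin> N"
  shows "AE q in (lborel :: ('a::euclidean_space \<times> 'b::euclidean_space) measure). q \<notin> N"
proof -
  note [measurable] = assms(1)
  have "Measurable.pred (lborel \<Otimes>\<^sub>M lborel) (\<lambda>p :: 'a \<times> 'b. (fst p, snd p) \<notin> N)"
    unfolding lborel_prod by measurable
  then have m: "{p \<in> space (lborel \<Otimes>\<^sub>M lborel). (fst p, snd p) \<notin> N} \<in> sets (lborel \<Otimes>\<^sub>M lborel)"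
    by (simp add: pred_def)
  have "AE x in lborel. AE z in lborel. (x, z) \<notin> N"
    using assms(2) m by (subst lborel_pair.AE_commute) auto
  then have "AE q in lborel \<Otimes>\<^sub>M lborel. (fst q, snd q) \<notin> N"
    using m by (intro lborel_pair.AE_pair_measure) auto
  then show ?thesis unfolding lborel_prod by simp
qed

text \<open>The time variable stands between the other two, so \<open>x\<close> is split off first
  and then \<open>t\<close>; afterwards \<open>x\<close> and \<open>y\<close> are recombined by
  Fubini in the opposite order.\<close>

lemma AE_lborel_time_slice:
  fixes P :: "'a::euclidean_space \<times> 'c::euclidean_space \<times> 'b::euclidean_space \<Rightarrow> bool"
  assumes "AE p in lborel. P p"
  shows "AE t in lborel. AE q in lborel. P (fst q, t, snd q)"
proof -
  obtain N where N: "{q. \<not> P q} \<subseteq> N" "N \<in> null_sets lborel"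
    using assms by (auto simp: eventually_ae_filter)
  have [measurable]: "N \<in> sets borel" using N by auto
  have "AE z in lborel. AE x in lborel. (x, z) \<notin> N"
    using AE_not_in[OF N(2)] by (rule AE_lborel_x_last)
  then have "AE t in lborel. AE y in lborel. AE x in lborel. (x, t, y) \<notin> N"
    unfolding lborel_prod[symmetric] by (rule lborel_pair.AE_pair)
  then have "AE t in lborel. AE q in lborel. (fst q, t, snd q) \<notin> N"
  proof eventually_elim
    case (elim t)
    have "Measurable.pred (lborel \<Otimes>\<^sub>M lborel) (\<lambda>q :: 'a \<times> 'b. (fst q, t, snd q) \<notin> N)"
      unfolding lborel_prod by measurable
    then have m: "{q \<in> space (lborel \<Otimes>\<^sub>M lborel). (fst q, t, snd q) \<notin> N} \<in> sets (lborel \<Otimes>\<^sub>M lborel)"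
      by (simp add: pred_def)
    have "AE x in lborel. AE y in lborel. (x, t, y) \<notin> N"
      using elim m by (subst lborel_pair.AE_commute) auto
    then have "AE q in lborel \<Otimes>\<^sub>M lborel. (fst q, t, snd q) \<notin> N"
      using m by (intro lborel_pair.AE_pair_measure) auto
    then show ?case unfolding lborel_prod .
  qed
  then show ?thesis
    by eventually_elim (erule eventually_mono, use N(1) in auto)
qed

section \<open>Attainment of values in the mean\<close>

context entropy_pair
begin

text \<open>The integral in \<open>has_time_value\<close> for \<open>V = {-R..R}\<close>, expressed
  by Borel representatives; \<open>Gam\<close> enters through the support of
  \<open>r\<close>.\<close>

definition defect :: "real \<Rightarrow> real \<Rightarrow> real \<Rightarrow> (real \<times> real \<times> (real ^ 'n) \<Rightarrow> real) \<Rightarrow> (real \<times> (real ^ 'n) \<Rightarrow> real) \<Rightarrow> real" where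
  "defect R t0 T g w = (\<integral>p. indicator {-R..R} (fst p) * indicator {t0<..<t0 + T} (fst (snd p)) *
     (\<bar>g p - w (fst p, snd (snd p))\<bar> * r (snd (snd p))) \<partial>lborel)"

lemma defect_tendsto_0:
  assumes tv: "has_time_value \<rho> g t0 w" and t0: "t0 \<ge> 0"
    and g' [measurable]: "g' \<in> borel_measurable borel" and geq: "AE p in lborel. p \<in> Omega \<longrightarrow> g p = g' p"
    and w' [measurable]: "w' \<in> borel_measurable borel"
    and weq: "AE q in lborel. q \<in> UNIV \<times> Gam \<longrightarrow> w q = w' q"
  shows "((\<lambda>T. 1 / T * defect R t0 T g' w') \<longlongrightarrow> 0) (at_right 0)"
proof -
  have "{-R..R} \<Subset> (UNIV :: real set)" by (auto simp: compactly_inside_def)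
  then have lim: "((\<lambda>T. 1 / T * set_lebesgue_integral lebesgue ({-R..R} \<times> {t0<..<t0 + T} \<times> Gam)
              (\<lambda>(x, s, y). \<bar>g (x, s, y) - w (x, y)\<bar> * \<rho> y)) \<longlongrightarrow> 0) (at_right 0)"
    using tv unfolding has_time_value_def by blast
  have "set_lebesgue_integral lebesgue ({-R..R} \<times> {t0<..<t0 + T} \<times> Gam)
              (\<lambda>(x, s, y). \<bar>g (x, s, y) - w (x, y)\<bar> * \<rho> y) = defect R t0 T g' w'" for T
    unfolding defect_def
  proof (rule set_lebesgue_integral_eq_lborel)
    show "(\<lambda>p. indicator {-R..R} (fst p) * indicator {t0<..<t0 + T} (fst (snd p)) *
     (\<bar>g' p - w' (fst p, snd (snd p))\<bar> * r (snd (snd p)))) \<in> borel_measurable borel" by measurable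
    have "AE y in lborel. y \<in> Gam \<longrightarrow> \<rho> y = r y" using r by (simp add: density_version_def)
    from AE_lborel_snd[OF AE_lborel_snd[OF this]] AE_lborel_xty[OF weq] geq
    show "AE p in lborel. indicator ({-R..R} \<times> {t0<..<t0 + T} \<times> Gam) p *
       (case p of (x, s, y) \<Rightarrow> \<bar>g (x, s, y) - w (x, y)\<bar> * \<rho> y) =
      indicator {-R..R} (fst p) * indicator {t0<..<t0 + T} (fst (snd p)) *
     (\<bar>g' p - w' (fst p, snd (snd p))\<bar> * r (snd (snd p)))"
    proof eventually_elim
      case (elim p)
      obtain x t y where p: "p = (x, t, y)" by (cases p)
      show ?case
      proof (cases "y \<in> Gam")
        case True
        then show ?thesis using elim t0 by (auto simp: p indicator_def in_Omega_iff)
      next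
        case False
        then have "r y = 0" using r by (auto simp: density_version_def)
        then show ?thesis using False by (auto simp: p indicator_def)
      qed
    qed
  qed
  with lim show ?thesis by simp
qed

end

text \<open>The averages in \<open>has_time_value\<close> carry a factor \<open>1 / T\<close>, so
  the height of the time layer must be at most \<open>c / T\<close> with \<open>c\<close>
  independent of \<open>T\<close>. Support in \<open>(T, 2 * T)\<close> rather than
  \<open>(0, T)\<close> keeps the test functions away from \<open>t = 0\<close>.\<close>

lemma scaled_bump_exists:
  obtains c :: real where "c > 0"
    "\<And>T. T > 0 \<Longrightarrow> \<exists>\<tau>. smooth \<tau> \<and> (\<forall>s. 0 \<le> \<tau> s \<and> \<tau> s \<le> c / T) \<and>
      (\<forall>s. \<tau> s \<noteq> 0 \<longrightarrow> T < s \<and> s < 2 * T) \<and> (\<integral>s. \<tau> s \<partial>lborel) = 1"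
proof -
  let ?b = "bump 1 2 :: real \<Rightarrow> real"
  define i where "i = (\<integral>s. ?b s \<partial>lborel)"
  have i: "i > 0" unfolding i_def by (rule bump_integral_pos) (simp add: box_real)
  have "\<exists>\<tau>. smooth \<tau> \<and> (\<forall>s. 0 \<le> \<tau> s \<and> \<tau> s \<le> (1 / i) / T) \<and>
      (\<forall>s. \<tau> s \<noteq> 0 \<longrightarrow> T < s \<and> s < 2 * T) \<and> (\<integral>s. \<tau> s \<partial>lborel) = 1" if T: "T > 0" for T
  proof -
    let ?\<tau> = "\<lambda>s. (1 / i / T) * ?b ((1 / T) * s + 0)"
    have "smooth ?\<tau>"
      using smooth_bump[of "1::real" 2]
      by (intro allI Ck_on_mult Ck_on_const Ck_on_affine bounded_linear_mult_right) auto
    moreover have "0 \<le> ?\<tau> s \<and> ?\<tau> s \<le> (1 / i) / T" for s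
    proof
      show "0 \<le> ?\<tau> s" using i T by (intro mult_nonneg_nonneg bump_nonneg) auto
      have "?\<tau> s \<le> (1 / i / T) * 1" using i T by (intro mult_left_mono bump_le_1) auto
      then show "?\<tau> s \<le> (1 / i) / T" by simp
    qed
    moreover have "T < s \<and> s < 2 * T" if "?\<tau> s \<noteq> 0" for s
    proof -
      have "(1 / T) * s + 0 \<in> box 1 2" using that bump_eq_0_iff[of "1::real" 2] by (metis mult_zero_right)
      then show ?thesis using T by (auto simp: box_real field_simps)
    qed
    moreover have "(\<integral>s. ?\<tau> s \<partial>lborel) = 1"
    proof -
      have "i = (1 / T) * (\<integral>s. ?b ((1 / T) * s) \<partial>lborel)"
        unfolding i_def using lborel_integral_real_affine[of "1 / T" ?b 0] T by simp
      then have "(\<integral>s. ?b ((1 / T) * s) \<partial>lborel) = i * T" using T by (simp add: field_simps)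
      then show ?thesis using i T by simp
    qed
    ultimately show ?thesis by blast
  qed
  then show ?thesis using that[of "1 / i"] i by simp
qed

section \<open>Mass of the difference in the cone and at the initial time\<close>

context entropy_pair
begin

definition mass :: "real \<Rightarrow> (real \<times> (real ^ 'n) \<Rightarrow> real) \<Rightarrow> (real \<times> (real ^ 'n) \<Rightarrow> real) \<Rightarrow> real ^ 'n \<Rightarrow> real" where
  "mass R g w y = (\<integral>x. indicator {-R..R} x * \<bar>g (x, y) - w (x, y)\<bar> \<partial>lborel) * (r y)\<^sup>2"

text \<open>Here \<open>z\<close> is the pair \<open>(t, y)\<close>. Integrating out
  \<open>x\<close> alone leaves a bounded Borel function of the other variables, to which
  \<open>nonneg_if_mollified_nonneg\<close> can be applied.\<close>

definition cone_mass :: "real \<Rightarrow> real \<Rightarrow> real \<times> (real ^ 'n) \<Rightarrow> real" where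
  "cone_mass n R z = indicator {0<..} (fst z) *
     (\<integral>x. cone_cutoff n R x (fst z) * \<bar>u' (x, z) - v' (x, z)\<bar> \<partial>lborel) * (r (snd z))\<^sup>2"

lemma mass_measurable [measurable]:
  assumes [measurable]: "g \<in> borel_measurable borel" "w \<in> borel_measurable borel"
  shows "mass R g w \<in> borel_measurable borel"
  unfolding mass_def[abs_def] by measurable

lemma cone_mass_measurable [measurable]: "cone_mass n R \<in> borel_measurable borel"
  unfolding cone_mass_def[abs_def] by measurable

lemma integrable_slice:
  fixes h :: "real \<Rightarrow> real"
  assumes "h \<in> borel_measurable borel" "\<And>x. \<bar>h x\<bar> \<le> B"
  shows "integrable lborel (\<lambda>x. indicator {-R..R} x * h x)"
  using assms by (intro integrable_bounded_support[of _ "{-R..R}" B]) (auto simp: indicator_def)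

lemma slice_integral_bounds:
  fixes h :: "real \<Rightarrow> real"
  assumes "h \<in> borel_measurable borel" "\<And>x. 0 \<le> h x" "\<And>x. h x \<le> B" "R \<ge> 0"
  shows "0 \<le> (\<integral>x. indicator {-R..R} x * h x \<partial>lborel)" "(\<integral>x. indicator {-R..R} x * h x \<partial>lborel) \<le> 2 * R * B"
proof -
  show "0 \<le> (\<integral>x. indicator {-R..R} x * h x \<partial>lborel)"
    using assms by (intro integral_nonneg_AE) auto
  have "(\<integral>x. indicator {-R..R} x * h x \<partial>lborel) \<le> (\<integral>x. indicator {-R..R} x * B \<partial>lborel)"
    using assms by (intro integral_mono integrable_slice[where B=B]) (auto simp: indicator_def intro: order_trans)
  also have "\<dots> = 2 * R * B" using assms(4) by simp
  finally show "(\<integral>x. indicator {-R..R} x * h x \<partial>lborel) \<le> 2 * R * B" .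
qed

lemma mass_bounds:
  assumes [measurable]: "g \<in> borel_measurable borel" "w \<in> borel_measurable borel"
    and b: "\<And>q. \<bar>g q\<bar> \<le> B" "\<And>q. \<bar>w q\<bar> \<le> B" and R: "R \<ge> 0"
  shows "0 \<le> mass R g w y" "mass R g w y \<le> 2 * R * (2 * B) * C\<^sup>2"
proof -
  have le: "\<bar>g (x, y) - w (x, y)\<bar> \<le> 2 * B" for x using b(1)[of "(x, y)"] b(2)[of "(x, y)"] by linarith
  note s = slice_integral_bounds[of "\<lambda>x. \<bar>g (x, y) - w (x, y)\<bar>" "2 * B", OF _ _ le R]
  show "0 \<le> mass R g w y" unfolding mass_def using s by (intro mult_nonneg_nonneg) auto
  have "0 \<le> B" using b(1)[of 0] by linarith
  then show "mass R g w y \<le> 2 * R * (2 * B) * C\<^sup>2" unfolding mass_def using s r_nonneg r_le R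
    by (intro mult_mono power_mono) auto
qed

lemma cone_le_indicator:
  assumes "n > 0" "t \<ge> 0" shows "cone_cutoff n R x t \<le> indicator {-R..R} x"
proof (cases "cone_cutoff n R x t = 0")
  case False
  have "0 \<le> \<alpha> * t" using \<alpha>(2) assms(2) by auto
  then have "x \<in> {-R..R}" using cone_support[OF assms(1) False] by auto
  then show ?thesis using cone_bounds(2) by auto
qed simp

lemma diff_le: "\<bar>u' p - v' p\<bar> \<le> 2 * M"
  using bJ[OF u'J[of p]] bJ[OF v'J[of p]] by linarith

lemma cone_mass_bounds:
  assumes "n > 0" "R \<ge> 0"
  shows "0 \<le> cone_mass n R z" "cone_mass n R z \<le> 2 * R * (2 * M) * C\<^sup>2"
proof -
  have i0: "0 \<le> (\<integral>x. cone_cutoff n R x (fst z) * \<bar>u' (x, z) - v' (x, z)\<bar> \<partial>lborel)"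
    using cone_bounds by (intro integral_nonneg_AE) auto
  then show "0 \<le> cone_mass n R z" unfolding cone_mass_def by (intro mult_nonneg_nonneg) auto
  show "cone_mass n R z \<le> 2 * R * (2 * M) * C\<^sup>2"
  proof (cases "0 < fst z")
    case True
    have "(\<integral>x. cone_cutoff n R x (fst z) * \<bar>u' (x, z) - v' (x, z)\<bar> \<partial>lborel)
      \<le> (\<integral>x. indicator {-R..R} x * \<bar>u' (x, z) - v' (x, z)\<bar> \<partial>lborel)"
    proof (rule integral_mono_AE')
      show "integrable lborel (\<lambda>x. indicator {-R..R} x * \<bar>u' (x, z) - v' (x, z)\<bar>)"
        using diff_le by (intro integrable_slice[where B="2 * M"]) auto
      show "AE x in lborel. cone_cutoff n R x (fst z) * \<bar>u' (x, z) - v' (x, z)\<bar> \<le> indicator {-R..R} x * \<bar>u' (x, z) - v' (x, z)\<bar>"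
        using cone_le_indicator[OF assms(1)] True by (intro AE_I2 mult_right_mono) auto
    qed auto
    also have "\<dots> \<le> 2 * R * (2 * M)"
      using diff_le assms by (intro slice_integral_bounds) auto
    finally show ?thesis
      unfolding cone_mass_def using True r_nonneg r_le i0 assms M_nonneg by (simp, intro mult_mono power_mono) auto
  next
    case False
    then show ?thesis using assms M_nonneg by (simp add: cone_mass_def)
  qed
qed

context
  fixes u0' v0' :: "real \<times> (real ^ 'n) \<Rightarrow> real" and M0 R :: real
  assumes u0' [measurable]: "u0' \<in> borel_measurable borel" and v0' [measurable]: "v0' \<in> borel_measurable borel"
    and b0: "\<And>q. \<bar>u0' q\<bar> \<le> M0" "\<And>q. \<bar>v0' q\<bar> \<le> M0" and R: "R > 0"
    and init: "((\<lambda>T. 1 / T * defect R 0 T u' u0') \<longlongrightarrow> 0) (at_right 0)"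
      "((\<lambda>T. 1 / T * defect R 0 T v' v0') \<longlongrightarrow> 0) (at_right 0)"
begin

text \<open>The integrand of \<open>cone_inequality\<close> with a general time profile
  \<open>a\<close> in place of \<open>A'\<close>. It is linear in \<open>a\<close>, so a derivative
  that is a difference of two layers splits into two such integrals.\<close>

definition slab :: "real \<Rightarrow> (real \<Rightarrow> real) \<Rightarrow> (real ^ 'n \<Rightarrow> real) \<Rightarrow> real \<times> real \<times> (real ^ 'n) \<Rightarrow> real" where
  "slab n a \<xi> p = \<bar>u' p - v' p\<bar> * (a (fst (snd p)) * cone_cutoff n R (fst p) (fst (snd p)) * \<xi> (snd (snd p))) * (weight r p)\<^sup>2"

lemma slab_integrable:
  assumes n: "n > 0" and [measurable]: "a \<in> borel_measurable borel" "\<xi> \<in> borel_measurable borel"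
    and a: "\<And>t. \<bar>a t\<bar> \<le> Ca" "\<And>t. a t \<noteq> 0 \<Longrightarrow> 0 \<le> t \<and> t \<le> b"
    and \<xi>: "\<And>y. \<bar>\<xi> y\<bar> \<le> Cx" "\<And>y. \<xi> y \<noteq> 0 \<Longrightarrow> norm y \<le> Y"
  shows "integrable lborel (slab n a \<xi>)"
proof (rule integrable_triple[of _ "2 * M * (Ca * 1 * Cx) * C\<^sup>2" R b Y])
  show "slab n a \<xi> \<in> borel_measurable borel" unfolding slab_def[abs_def] by measurable
  fix p
  have "0 \<le> Ca" "0 \<le> Cx" using a(1)[of 0] \<xi>(1)[of 0] by linarith+
  then show "\<bar>slab n a \<xi> p\<bar> \<le> 2 * M * (Ca * 1 * Cx) * C\<^sup>2"
    unfolding slab_def abs_mult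
    using diff_le[of p] a(1) \<xi>(1) cone_bounds weight_bounds[OF r, of p] M_nonneg
    by (intro mult_mono mult_nonneg_nonneg) (auto intro: power_mono)
next
  fix x t y assume "slab n a \<xi> (x, t, y) \<noteq> 0"
  then have nz: "a t \<noteq> 0" "cone_cutoff n R x t \<noteq> 0" "\<xi> y \<noteq> 0" by (auto simp: slab_def)
  have t: "0 \<le> t" "t \<le> b" using a(2)[OF nz(1)] by auto
  have "0 \<le> \<alpha> * t" using \<alpha>(2) t by auto
  then show "\<bar>x\<bar> \<le> R \<and> \<bar>t\<bar> \<le> b \<and> norm y \<le> Y"
    using cone_support[OF n nz(2)] \<xi>(2)[OF nz(3)] t by auto
qed

text \<open>In the layer \<open>(T, 2 * T)\<close> both solutions are compared with their data by
  the triangle inequality. The height \<open>c / T\<close>, the bound \<open>Cx\<close> of \<xi> and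
  \<open>(r y)\<^sup>2 \<le> C * r y\<close> produce the factor of the defects. The data do not
  depend on time, so in the main term \<tau> integrates to 1.\<close>

lemma slab_initial:
  assumes n: "n > 0" and T: "T > 0" and \<tau>: "continuous_on UNIV \<tau>" "\<And>s. 0 \<le> \<tau> s \<and> \<tau> s \<le> c / T"
      "\<And>s. \<tau> s \<noteq> 0 \<Longrightarrow> T < s \<and> s < 2 * T" "(\<integral>s. \<tau> s \<partial>lborel) = 1"
    and [measurable]: "\<xi> \<in> borel_measurable borel" and \<xi>: "\<And>y. 0 \<le> \<xi> y" "\<And>y. \<xi> y \<le> Cx" "\<And>y. \<xi> y \<noteq> 0 \<Longrightarrow> norm y \<le> Y"
  shows "(\<integral>p. slab n \<tau> \<xi> p \<partial>lborel) \<le> (\<integral>y. \<xi> y * mass R u0' v0' y \<partial>lborel) +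
      c * Cx * C * (1 / T * defect R 0 (2 * T) u' u0' + 1 / T * defect R 0 (2 * T) v' v0')"
proof -
  have [measurable]: "\<tau> \<in> borel_measurable borel" using \<tau>(1) by (rule borel_measurable_continuous_onI)
  have c0: "0 \<le> c / T" using \<tau>(2)[of 0] by linarith
  have Cx0: "0 \<le> Cx" using \<xi>(1,2)[of 0] by linarith
  have M00: "0 \<le> M0" using b0(1)[of 0] by linarith
  let ?G = "\<lambda>g w p. indicator {-R..R} (fst p) * indicator {0<..<0 + 2 * T} (fst (snd p)) *
     (\<bar>g p - w (fst p, snd (snd p))\<bar> * r (snd (snd p)))"
  let ?H = "\<lambda>p. \<tau> (fst (snd p)) * \<xi> (snd (snd p)) * (indicator {-R..R} (fst p) * \<bar>u0' (fst p, snd (snd p)) - v0' (fst p, snd (snd p))\<bar> * (r (snd (snd p)))\<^sup>2)"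
  obtain Y' where Y': "\<And>y :: real ^ 'n. y \<in> Gam \<Longrightarrow> norm y \<le> Y'"
    using compact_imp_bounded[OF Gam_compact] unfolding bounded_iff by blast
  have iG: "integrable lborel (?G g w)" if [measurable]: "g \<in> borel_measurable borel" "w \<in> borel_measurable borel"
    and b: "\<And>p. \<bar>g p\<bar> \<le> M" "\<And>q. \<bar>w q\<bar> \<le> M0" for g w
  proof (rule integrable_triple[of _ "(M + M0) * C" R "2 * T" Y'])
    fix p
    have "\<bar>g p - w (fst p, snd (snd p))\<bar> \<le> M + M0"
      using b(1)[of p] b(2)[of "(fst p, snd (snd p))"] by linarith
    then have "\<bar>g p - w (fst p, snd (snd p))\<bar> * r (snd (snd p)) \<le> (M + M0) * C"
      using r_nonneg r_le M_nonneg M00 by (intro mult_mono) auto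
    moreover have "0 \<le> (M + M0) * C" using M_nonneg M00 C_nonneg by auto
    ultimately show "\<bar>?G g w p\<bar> \<le> (M + M0) * C"
      using r_nonneg by (auto simp: indicator_def abs_mult)
  next
    fix x t y assume "?G g w (x, t, y) \<noteq> 0"
    then have "x \<in> {-R..R}" "0 < t" "t < 2 * T" "r y \<noteq> 0" by (auto simp: indicator_def split: if_splits)
    moreover have "y \<in> Gam" using \<open>r y \<noteq> 0\<close> r by (auto simp: density_version_def)
    ultimately show "\<bar>x\<bar> \<le> R \<and> \<bar>t\<bar> \<le> 2 * T \<and> norm y \<le> Y'" using Y' by auto
  qed measurable
  have iH: "integrable lborel ?H"
  proof (rule integrable_triple[of _ "(c / T) * Cx * (1 * (2 * M0) * C\<^sup>2)" R "2 * T" Y])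
    fix p :: "real \<times> real \<times> (real ^ 'n)"
    have "\<bar>u0' (fst p, snd (snd p)) - v0' (fst p, snd (snd p))\<bar> \<le> 2 * M0"
      using b0(1)[of "(fst p, snd (snd p))"] b0(2)[of "(fst p, snd (snd p))"] by linarith
    then show "\<bar>?H p\<bar> \<le> (c / T) * Cx * (1 * (2 * M0) * C\<^sup>2)"
      unfolding abs_mult using \<tau>(2) \<xi> r_nonneg r_le c0 Cx0 M00
      by (intro mult_mono mult_nonneg_nonneg) (auto simp: indicator_def intro: power_mono)
  next
    fix x t y assume "?H (x, t, y) \<noteq> 0"
    then have "\<tau> t \<noteq> 0" "\<xi> y \<noteq> 0" "x \<in> {-R..R}" by (auto simp: indicator_def split: if_splits)
    then show "\<bar>x\<bar> \<le> R \<and> \<bar>t\<bar> \<le> 2 * T \<and> norm y \<le> Y" using \<tau>(3)[of t] \<xi>(3)[of y] T by auto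
  qed measurable
  have uM: "\<bar>u' p\<bar> \<le> M" "\<bar>v' p\<bar> \<le> M" for p using bJ u'J v'J by auto
  note iGu = iG[OF u' u0' uM(1) b0(1)] and iGv = iG[OF v' v0' uM(2) b0(2)]
  let ?k = "c / T * Cx * C"
  have k0: "0 \<le> ?k" using c0 Cx0 C_nonneg by (intro mult_nonneg_nonneg)
  have "(\<integral>p. slab n \<tau> \<xi> p \<partial>lborel) \<le> (\<integral>p. ?H p + ?k * (?G u' u0' p + ?G v' v0' p) \<partial>lborel)"
  proof (rule integral_mono)
    show "integrable lborel (slab n \<tau> \<xi>)"
      using \<tau> \<xi> T by (intro slab_integrable[OF n, where Ca="c / T" and b="2 * T" and Cx=Cx and Y=Y]) (auto intro: less_imp_le less_trans[OF T])
    show "integrable lborel (\<lambda>p. ?H p + ?k * (?G u' u0' p + ?G v' v0' p))"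
      using iH iGu iGv by (intro Bochner_Integration.integrable_add integrable_mult_right) auto
    fix p :: "real \<times> real \<times> (real ^ 'n)"
    obtain x t y where p: "p = (x, t, y)" by (cases p)
    have G0: "0 \<le> ?G u' u0' p + ?G v' v0' p" using r_nonneg by (auto simp: indicator_def)
    show "slab n \<tau> \<xi> p \<le> ?H p + ?k * (?G u' u0' p + ?G v' v0' p)"
    proof (cases "\<tau> t = 0")
      case True
      then show ?thesis using mult_nonneg_nonneg[OF k0 G0] by (simp add: slab_def p)
    next
      case False
      then have t: "T < t" "t < 2 * T" using \<tau>(3) by auto
      then have t0: "0 < t" using T by linarith
      let ?i = "indicator {-R..R} x :: real"
      let ?a = "\<bar>u' p - u0' (x, y)\<bar>" and ?b = "\<bar>v' p - v0' (x, y)\<bar>" and ?d = "\<bar>u0' (x, y) - v0' (x, y)\<bar>"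
      have \<tau>\<xi>: "0 \<le> \<tau> t * \<xi> y" using \<tau>(2)[of t] \<xi>(1)[of y] by auto
      have \<tau>\<xi>': "\<tau> t * \<xi> y \<le> c / T * Cx" using \<tau>(2)[of t] \<xi>(1,2)[of y] c0 by (intro mult_mono) auto
      have i0: "0 \<le> ?i" by simp
      have rr: "0 \<le> r y" "r y \<le> C" using r_nonneg r_le by auto
      have "slab n \<tau> \<xi> p = (\<tau> t * \<xi> y) * (cone_cutoff n R x t * \<bar>u' p - v' p\<bar>) * (r y)\<^sup>2"
        using t0 by (simp add: slab_def p weight_def)
      also have "\<dots> \<le> (\<tau> t * \<xi> y) * (?i * (?d + (?a + ?b))) * (r y)\<^sup>2"
        using cone_le_indicator[OF n, of t R x] t0 \<tau>\<xi> cone_bounds(1)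
        by (intro mult_right_mono mult_left_mono mult_mono) auto
      also have "\<dots> = (\<tau> t * \<xi> y) * (?i * ?d * (r y)\<^sup>2) + (\<tau> t * \<xi> y) * r y * (?i * (?a * r y + ?b * r y))"
        by (simp add: algebra_simps power2_eq_square)
      also have "\<dots> \<le> (\<tau> t * \<xi> y) * (?i * ?d * (r y)\<^sup>2) + ?k * (?i * (?a * r y + ?b * r y))"
      proof (intro add_left_mono mult_right_mono mult_mono)
        show "0 \<le> c / T * Cx" using c0 Cx0 by (intro mult_nonneg_nonneg)
      qed (use \<tau>(2)[of t] \<xi>(1,2)[of y] c0 rr in auto)
      also have "\<dots> = ?H p + ?k * (?G u' u0' p + ?G v' v0' p)"
        using t t0 by (simp add: p algebra_simps)
      finally show ?thesis .
    qed
  qed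
  also have "\<dots> = (\<integral>p. ?H p \<partial>lborel) + ?k * (defect R 0 (2 * T) u' u0' + defect R 0 (2 * T) v' v0')"
    unfolding defect_def using iH iGu iGv
    by (subst Bochner_Integration.integral_add) (auto intro!: integrable_mult_right)
  also have "(\<integral>p. ?H p \<partial>lborel) = (\<integral>y. \<xi> y * mass R u0' v0' y \<partial>lborel)"
  proof -
    have slice: "(\<integral>x. ?H (x, z) \<partial>lborel) = \<tau> (fst z) * (\<xi> (snd z) * mass R u0' v0' (snd z))" for z
    proof -
      have "(\<integral>x. ?H (x, z) \<partial>lborel) = (\<integral>x. (\<tau> (fst z) * \<xi> (snd z) * (r (snd z))\<^sup>2) *
          (indicator {-R..R} x * \<bar>u0' (x, snd z) - v0' (x, snd z)\<bar>) \<partial>lborel)"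
        by (rule Bochner_Integration.integral_cong) (auto simp: mult_ac)
      then show ?thesis
        by (simp only: integral_mult_right_zero mass_def) (simp only: mult.assoc mult.commute mult.left_commute)
    qed
    have "(\<integral>p. ?H p \<partial>lborel) = (\<integral>z. \<tau> (fst z) * (\<xi> (snd z) * mass R u0' v0' (snd z)) \<partial>lborel)"
      unfolding integral_x_last[OF iH] slice ..
    also have "\<dots> = (\<integral>s. \<tau> s \<partial>lborel) * (\<integral>y. \<xi> y * mass R u0' v0' y \<partial>lborel)"
    proof (rule integral_product_functions)
      have "integrable (lborel \<Otimes>\<^sub>M lborel) (\<lambda>(x, z). ?H (x, z))"
        using iH by (simp add: lborel_prod case_prod_beta')
      from lborel_pair.integrable_snd[OF this]
      show "integrable lborel (\<lambda>z. \<tau> (fst z) * (\<xi> (snd z) * mass R u0' v0' (snd z)))"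
        by (simp only: slice)
    qed
    finally show ?thesis using \<tau>(4) by simp
  qed
  finally show ?thesis by (simp add: algebra_simps)
qed

text \<open>The time cutoff rises in \<open>(T, 2 * T)\<close> and falls along \<kappa> around
  \<open>t1\<close>. As \<open>T\<close> tends to 0 the defects disappear and the initial mass
  remains. Because \<kappa> has integral 1, that mass may be written under the time integral as
  well, which gives a mollification at the point \<open>(t1, y1)\<close>.\<close>

lemma contraction_mollified:
  assumes n: "n > 0" and \<kappa>: "smooth \<kappa>" "mollifier h \<kappa>" and \<xi>: "smooth \<xi>" "mollifier h \<xi>" and t1: "h < t1"
  shows "0 \<le> (\<integral>z. (\<kappa> (fst z - t1) * \<xi> (snd z - y1)) * (mass R u0' v0' (snd z) - cone_mass n R z) \<partial>lborel)"
proof -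
  let ?a = "\<lambda>s. \<kappa> (s - t1)" and ?\<xi> = "\<lambda>y. \<xi> (y - y1)"
  have \<kappa>0: "0 \<le> \<kappa> s" "\<kappa> s \<noteq> 0 \<Longrightarrow> norm s < h" and \<xi>0: "0 \<le> \<xi> y" "\<xi> y \<noteq> 0 \<Longrightarrow> norm y < h" for s y
    using \<kappa>(2) \<xi>(2) by (auto simp: mollifier_def)
  obtain Ca where Ca: "\<And>s. \<bar>\<kappa> s\<bar> \<le> Ca" using mollifier_bounded[OF \<kappa>(2)] by blast
  obtain Cx where Cx: "\<And>y. \<bar>\<xi> y\<bar> \<le> Cx" using mollifier_bounded[OF \<xi>(2)] by blast
  note [measurable] = mollifier_measurable[OF \<kappa>(2)] mollifier_measurable[OF \<xi>(2)]
  have a_supp: "0 \<le> s \<and> s \<le> t1 + h" "t1 - h \<le> s \<and> s \<le> t1 + h" if "?a s \<noteq> 0" for s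
    using \<kappa>0(2)[OF that] t1 by auto
  have \<xi>_supp: "norm y \<le> norm y1 + h" if "?\<xi> y \<noteq> 0" for y
    using \<xi>0(2)[OF that] norm_triangle_ineq2[of y y1] by linarith
  have oneK: "(\<integral>s. ?a s \<partial>lborel) = 1"
    using lborel_integral_shift[of \<kappa> "- t1"] \<kappa>(2) by (simp add: mollifier_def)
  have sa: "smooth ?a"
  proof
    fix k
    have "Ck_on k UNIV (\<lambda>s. \<kappa> (id s + - t1))"
      using \<kappa>(1) by (intro Ck_on_affine) (auto simp: id_def)
    then show "Ck_on k UNIV ?a" by simp
  qed
  have sx: "smooth ?\<xi>"
  proof
    fix k
    have "Ck_on k UNIV (\<lambda>y. \<xi> (id y + - y1))"
      using \<xi>(1) by (intro Ck_on_affine) (auto simp: id_def)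
    then show "Ck_on k UNIV ?\<xi>" by simp
  qed
  have ia: "integrable lborel (slab n ?a ?\<xi>)"
    using Ca Cx a_supp \<xi>_supp by (intro slab_integrable[OF n]) auto
  let ?X = "\<integral>p. slab n ?a ?\<xi> p \<partial>lborel" and ?Z = "\<integral>y. ?\<xi> y * mass R u0' v0' y \<partial>lborel"
  obtain c :: real where c: "c > 0" and \<tau>ex: "\<And>T. T > 0 \<Longrightarrow> \<exists>\<tau>. smooth \<tau> \<and> (\<forall>s. 0 \<le> \<tau> s \<and> \<tau> s \<le> c / T) \<and>
      (\<forall>s. \<tau> s \<noteq> 0 \<longrightarrow> T < s \<and> s < 2 * T) \<and> (\<integral>s. \<tau> s \<partial>lborel) = 1"
    using scaled_bump_exists by blast
  let ?f = "\<lambda>T. ?Z + c * Cx * C * (1 / T * defect R 0 (2 * T) u' u0' + 1 / T * defect R 0 (2 * T) v' v0')"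
  \<comment> \<open>The bound on \<open>T\<close> makes the first layer, which ends at
    \<open>2 * T\<close>, finish before \<open>t1 - h\<close>, where the second may start.\<close>
  have le: "?X \<le> ?f T" if T: "0 < T" "T < (t1 - h) / 2" for T
  proof -
    obtain \<tau> where \<tau>: "smooth \<tau>" "\<And>s. 0 \<le> \<tau> s \<and> \<tau> s \<le> c / T"
      "\<And>s. \<tau> s \<noteq> 0 \<Longrightarrow> T < s \<and> s < 2 * T" "(\<integral>s. \<tau> s \<partial>lborel) = 1"
      using \<tau>ex[OF T(1)] by blast
    have [measurable]: "\<tau> \<in> borel_measurable borel"
      using smooth_continuous[OF \<tau>(1)] by (rule borel_measurable_continuous_onI)
    have \<tau>s: "T \<le> s \<and> s \<le> 2 * T" if "\<tau> s \<noteq> 0" for s using \<tau>(3)[OF that] by simp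
    have T2: "T \<le> t1 - h" "2 * T < t1 - h" using T by (auto simp: field_simps)
    have \<tau>nn: "\<And>s. 0 \<le> \<tau> s" using \<tau>(2) by blast
    obtain A where A: "smooth A" "\<And>t. (A has_real_derivative \<tau> t - ?a t) (at t)" "\<And>t. 0 \<le> A t"
      "\<And>t. A t \<noteq> 0 \<Longrightarrow> T \<le> t \<and> t \<le> t1 + h"
      using time_cutoff_exists[OF \<tau>(1) \<tau>nn \<tau>s \<tau>(4) sa \<kappa>0(1) a_supp(2) oneK T2] by blast
    have it: "integrable lborel (slab n \<tau> ?\<xi>)"
    proof (rule slab_integrable[OF n])
      show "\<bar>\<tau> t\<bar> \<le> c / T" for t using \<tau>(2)[of t] by auto
      show "0 \<le> t \<and> t \<le> 2 * T" if "\<tau> t \<noteq> 0" for t using \<tau>(3)[OF that] T by auto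
      show "\<bar>\<xi> (y - y1)\<bar> \<le> Cx" for y by (rule Cx)
      show "norm y \<le> norm y1 + h" if "\<xi> (y - y1) \<noteq> 0" for y using \<xi>_supp[OF that] .
    qed measurable
    have "0 \<le> (\<integral>p. \<bar>u' p - v' p\<bar> * ((\<tau> (fst (snd p)) - ?a (fst (snd p))) * cone_cutoff n R (fst p) (fst (snd p)) * ?\<xi> (snd (snd p)))
        * (weight r p)\<^sup>2 \<partial>lborel)"
      using cone_inequality[OF A(1,2) _ A(3,4) T(1) sx \<xi>0(1) \<xi>_supp n]
        continuous_on_diff[OF smooth_continuous[OF \<tau>(1)] smooth_continuous[OF sa]] by blast
    also have "\<dots> = (\<integral>p. slab n \<tau> ?\<xi> p - slab n ?a ?\<xi> p \<partial>lborel)"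
      by (rule Bochner_Integration.integral_cong) (simp_all add: slab_def algebra_simps)
    also have "\<dots> = (\<integral>p. slab n \<tau> ?\<xi> p \<partial>lborel) - ?X"
      by (rule Bochner_Integration.integral_diff[OF it ia])
    finally have "?X \<le> (\<integral>p. slab n \<tau> ?\<xi> p \<partial>lborel)" by simp
    also have "\<dots> \<le> ?f T"
    proof (rule slab_initial[OF n T(1) smooth_continuous[OF \<tau>(1)] \<tau>(2,3,4)])
      show "\<xi> (y - y1) \<le> Cx" for y using Cx[of "y - y1"] by linarith
      show "norm y \<le> norm y1 + h" if "\<xi> (y - y1) \<noteq> 0" for y using \<xi>_supp[OF that] .
    qed (auto simp: \<xi>0)
    finally show ?thesis .
  qed
  \<comment> \<open>The layer extends to \<open>2 * T\<close> while the average is taken with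
    \<open>1 / T\<close>; the substitution costs a factor 2 on a quantity that tends to 0.\<close>
  have scale: "((\<lambda>T. 1 / T * D (2 * T)) \<longlongrightarrow> 0) (at_right 0)" if "((\<lambda>T. 1 / T * D T) \<longlongrightarrow> 0) (at_right 0)" for D :: "real \<Rightarrow> real"
  proof -
    have "filterlim (\<lambda>T::real. 2 * T) (at_right 0) (at_right 0)"
      unfolding filterlim_at
      by (auto intro!: tendsto_eq_intros simp: eventually_at_filter)
    from tendsto_mult_right_zero[OF filterlim_compose[OF that this], of 2] show ?thesis by simp
  qed
  have "(?f \<longlongrightarrow> ?Z + c * Cx * C * (0 + 0)) (at_right 0)"
    by (intro tendsto_add tendsto_mult_left tendsto_const scale init)
  then have "(?f \<longlongrightarrow> ?Z) (at_right 0)" by simp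
  moreover have "\<forall>\<^sub>F T in at_right 0. ?X \<le> ?f T"
    using le t1 by (intro eventually_at_rightI[of 0 "(t1 - h) / 2"]) auto
  ultimately have XZ: "?X \<le> ?Z"
    by (rule tendsto_lowerbound) simp
  have mb: "\<bar>mass R u0' v0' y\<bar> \<le> 2 * R * (2 * M0) * C\<^sup>2" for y
    using mass_bounds[OF u0' v0' b0, of R y] R by auto
  have cb: "\<bar>cone_mass n R z\<bar> \<le> 2 * R * (2 * M) * C\<^sup>2" for z
    using cone_mass_bounds[OF n, of R z] R by auto
  have iz: "integrable lborel (\<lambda>z. ?a (fst z) * ?\<xi> (snd z) * g z)"
    if [measurable]: "g \<in> borel_measurable borel" and g: "\<And>z. \<bar>g z\<bar> \<le> B" for g and B :: real
  proof (rule integrable_bounded_support[of _ "cball 0 (\<bar>t1\<bar> + h + (norm y1 + h))" "Ca * Cx * B"])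
    fix z :: "real \<times> (real ^ 'n)"
    have "0 \<le> Ca" "0 \<le> Cx" using Ca[of 0] Cx[of 0] by linarith+
    then show "\<bar>?a (fst z) * ?\<xi> (snd z) * g z\<bar> \<le> Ca * Cx * B"
      unfolding abs_mult using Ca Cx g by (intro mult_mono mult_nonneg_nonneg) auto
    assume z: "z \<notin> cball 0 (\<bar>t1\<bar> + h + (norm y1 + h))"
    show "?a (fst z) * ?\<xi> (snd z) * g z = 0"
    proof (rule ccontr)
      assume "\<not> ?thesis"
      then have nz: "?a (fst z) \<noteq> 0" "?\<xi> (snd z) \<noteq> 0" by auto
      have "norm z \<le> norm (fst z) + norm (snd z)" using norm_Pair_le[of "fst z" "snd z"] by simp
      moreover have "\<bar>fst z\<bar> \<le> \<bar>t1\<bar> + h" using a_supp[OF nz(1)] by auto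
      ultimately show False using \<xi>_supp[OF nz(2)] z by auto
    qed
  qed auto
  have im: "integrable lborel (\<lambda>z. ?a (fst z) * ?\<xi> (snd z) * mass R u0' v0' (snd z))"
    using mb by (intro iz) auto
  have ic: "integrable lborel (\<lambda>z. ?a (fst z) * ?\<xi> (snd z) * cone_mass n R z)"
    using cb by (intro iz) auto
  have "(\<integral>z. ?a (fst z) * ?\<xi> (snd z) * mass R u0' v0' (snd z) \<partial>lborel) = ?Z"
    using integral_product_functions[of ?a "\<lambda>y. ?\<xi> y * mass R u0' v0' y"] im oneK by (simp add: mult.assoc)
  moreover have "(\<integral>z. ?a (fst z) * ?\<xi> (snd z) * cone_mass n R z \<partial>lborel) = ?X"
  proof -
    have "?X = (\<integral>z. (\<integral>x. slab n ?a ?\<xi> (x, z) \<partial>lborel) \<partial>lborel)" by (rule integral_x_last[OF ia])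
    also have "\<dots> = (\<integral>z. ?a (fst z) * ?\<xi> (snd z) * cone_mass n R z \<partial>lborel)"
    proof (rule Bochner_Integration.integral_cong[OF refl])
      fix z :: "real \<times> (real ^ 'n)"
      have "(\<integral>x. slab n ?a ?\<xi> (x, z) \<partial>lborel) = (\<integral>x. (?a (fst z) * ?\<xi> (snd z) * (indicator {0<..} (fst z) * (r (snd z))\<^sup>2))
          * (cone_cutoff n R x (fst z) * \<bar>u' (x, z) - v' (x, z)\<bar>) \<partial>lborel)"
        by (rule Bochner_Integration.integral_cong) (auto simp: slab_def weight_def indicator_def)
      then show "(\<integral>x. slab n ?a ?\<xi> (x, z) \<partial>lborel) = ?a (fst z) * ?\<xi> (snd z) * cone_mass n R z"
        by (simp only: integral_mult_right_zero cone_mass_def) (simp only: mult.assoc mult.commute mult.left_commute)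
    qed
    finally show ?thesis by simp
  qed
  ultimately have "(\<integral>z. ?a (fst z) * ?\<xi> (snd z) * mass R u0' v0' (snd z) - ?a (fst z) * ?\<xi> (snd z) * cone_mass n R z \<partial>lborel) = ?Z - ?X"
    using im ic by simp
  then show ?thesis using XZ by (simp add: right_diff_distrib)
qed

text \<open>The sets \<open>?S j\<close> exhaust the positive times. On each of them the time is at
  least \<open>1 / Suc j\<close>, so kernels of smaller radius never reach \<open>t \<le> 0\<close>,
  and the mollified inequality is available at every point of the set.\<close>

lemma cone_mass_le_AE:
  assumes n: "n > 0"
  shows "AE z in lborel. 0 < fst z \<longrightarrow> cone_mass n R z \<le> mass R u0' v0' (snd z)"
proof -
  let ?g = "\<lambda>z. mass R u0' v0' (snd z) - cone_mass n R z"
  let ?S = "\<lambda>j::nat. cball 0 (real j) \<inter> {z :: real \<times> (real ^ 'n). 1 / real (Suc j) \<le> fst z}"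
  have "AE z in lborel. z \<in> ?S j \<longrightarrow> 0 \<le> ?g z" for j
  proof (rule nonneg_if_mollified_nonneg)
    show "?g \<in> borel_measurable borel" by measurable
    show "\<bar>?g z\<bar> \<le> 2 * R * (2 * M0) * C\<^sup>2 + 2 * R * (2 * M) * C\<^sup>2" for z
      using mass_bounds[OF u0' v0' b0, of R "snd z"] cone_mass_bounds[OF n, of R z] R by auto
    show "bounded (?S j)" by (rule bounded_subset[OF bounded_cball]) auto
    show "?S j \<in> sets borel"
      by (intro borel_closed closed_Int closed_cball closed_Collect_le continuous_intros)
    fix d :: real assume "d > 0"
    \<comment> \<open>Both factors of the product kernel get radius \<open>h\<close>. With
      \<open>2 * h \<le> d\<close> their product is supported in the ball of radius
      \<open>d\<close>, and \<open>h < 1 / Suc j\<close> keeps it at positive times.\<close>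
    define h where "h = min (d / 2) (1 / real (Suc j) / 2)"
    have "0 < min (d / 2) (e / 2) \<and> 2 * min (d / 2) (e / 2) \<le> d \<and> min (d / 2) (e / 2) < e" if "e > 0" for e
      using that \<open>d > 0\<close> by (auto simp: min_def)
    from this[of "1 / real (Suc j)"] have h: "h > 0" "2 * h \<le> d" "h < 1 / real (Suc j)"
      unfolding h_def by auto
    obtain \<kappa> :: "real \<Rightarrow> real" where \<kappa>: "mollifier h \<kappa>" "smooth \<kappa>" using mollifier_exists[OF h(1)] by blast
    obtain \<xi> :: "real ^ 'n \<Rightarrow> real" where \<xi>: "mollifier h \<xi>" "smooth \<xi>" using mollifier_exists[OF h(1)] by blast
    let ?K = "\<lambda>z. \<kappa> (fst z) * \<xi> (snd z)"
    have supp: "norm z < d" if "?K z \<noteq> 0" for z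
    proof -
      have "norm z \<le> norm (fst z) + norm (snd z)" using norm_Pair_le[of "fst z" "snd z"] by simp
      moreover have "norm (fst z) < h" "norm (snd z) < h" using that \<kappa>(1) \<xi>(1) by (auto simp: mollifier_def)
      ultimately show ?thesis using h(2) by linarith
    qed
    have cK: "continuous_on UNIV ?K"
    proof (rule continuous_on_mult)
      show "continuous_on UNIV (\<lambda>z. \<kappa> (fst z))"
        by (rule continuous_on_compose2[OF smooth_continuous[OF \<kappa>(2)]]) (auto intro: continuous_intros)
      show "continuous_on UNIV (\<lambda>z. \<xi> (snd z))"
        by (rule continuous_on_compose2[OF smooth_continuous[OF \<xi>(2)]]) (auto intro: continuous_intros)
    qed
    have "integrable lborel ?K"
    proof -
      obtain B where "\<And>z. \<bar>?K z\<bar> \<le> B"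
        using continuous_bounded_support[OF cK bounded_ball[of 0 d]] supp by (metis mem_ball_0)
      then show ?thesis
        using supp cK by (intro integrable_bounded_support[of ?K "ball 0 d" B])
          (auto intro: borel_measurable_continuous_onI simp del: mult_eq_0_iff)
    qed
    from integral_product_functions[OF this] have "mollifier d ?K"
      using \<kappa>(1) \<xi>(1) cK supp unfolding mollifier_def by simp
    moreover have "0 \<le> (\<integral>q. ?K (q - p) * ?g q \<partial>lborel)" if "p \<in> ?S j" for p
      using contraction_mollified[OF n \<kappa>(2,1) \<xi>(2,1), of "fst p" "snd p"] that h(3) by auto
    ultimately show "\<exists>K. mollifier d K \<and> (\<forall>p\<in>?S j. 0 \<le> (\<integral>q. K (q - p) * ?g q \<partial>lborel))" by blast
  qed
  then have "AE z in lborel. \<forall>j. z \<in> ?S j \<longrightarrow> 0 \<le> ?g z" unfolding AE_all_countable by blast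
  then show ?thesis
  proof eventually_elim
    case (elim z)
    show ?case
    proof
      assume "0 < fst z"
      obtain i where i: "norm z \<le> real i" using real_arch_simple by blast
      obtain k where k: "1 / real (Suc k) < fst z" using \<open>0 < fst z\<close> nat_approx_posE by blast
      have "1 / real (Suc (max i k)) \<le> 1 / real (Suc k)" by (intro divide_left_mono) auto
      then have "z \<in> ?S (max i k)" using i k by auto
      then show "cone_mass n R z \<le> mass R u0' v0' (snd z)" using elim by force
    qed
  qed
qed

end

end

section \<open>Passage from masses to local distances\<close>

lemma UNIV_Gam_borel [measurable]: "UNIV \<times> Gam \<in> sets (borel :: (real \<times> (real ^ 'n)) measure)"
proof -
  have "(UNIV \<times> Gam :: (real \<times> (real ^ 'n)) set) = {q. snd q \<in> Gam}" by auto
  also have "\<dots> \<in> sets borel" by measurable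
  finally show ?thesis .
qed

lemma Linf_borel_version:
  fixes g :: "'a::euclidean_space \<Rightarrow> real"
  assumes "S \<in> sets borel" "Linf S g"
  obtains g' B where "g' \<in> borel_measurable borel" "\<And>p. \<bar>g' p\<bar> \<le> B" "AE p in lborel. p \<in> S \<longrightarrow> g p = g' p"
proof -
  obtain B where "AE p in lebesgue_on S. \<bar>g p\<bar> \<le> B" and g: "g \<in> borel_measurable (lebesgue_on S)"
    using assms(2) by (auto simp: Linf_def)
  then have "AE p in lebesgue_on S. g p \<in> {- \<bar>B\<bar>..\<bar>B\<bar>}"
    by (auto elim!: eventually_mono)
  from borel_version[OF assms(1) g this] obtain g' where
    "g' \<in> borel_measurable borel" "\<And>p. g' p \<in> {- \<bar>B\<bar>..\<bar>B\<bar>}" "AE p in lborel. p \<in> S \<longrightarrow> g p = g' p"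
    by auto
  then show ?thesis using that[of g' "\<bar>B\<bar>"] by (simp add: abs_le_iff minus_le_iff)
qed

lemma flat_scaled_tendsto_1:
  assumes "d > 0" shows "(\<lambda>n. flat 0 (real (Suc n) * d)) \<longlonglongrightarrow> 1"
proof -
  have "(\<lambda>n. exp (- (inverse (real (Suc n)) * (1 / d)))) \<longlonglongrightarrow> exp (- (0 * (1 / d)))"
    by (intro tendsto_intros LIMSEQ_inverse_real_of_nat)
  moreover have "exp (- (inverse (real (Suc n)) * (1 / d))) = flat 0 (real (Suc n) * d)" for n
    using assms by (simp add: flat_def field_simps add_pos_nonneg not_le)
  ultimately show ?thesis by simp
qed

context entropy_pair
begin

text \<open>The strips \<open>S < \<bar>x\<bar> \<le> R\<close> have total length
  \<open>2 * (R - S)\<close>; on them the difference is at most \<open>2 * B\<close> and the squared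
  weight at most \<open>C\<^sup>2\<close>. The estimate serves twice: to pass from rational to real
  radii, and to compare the radii belonging to nearby times.\<close>

lemma mass_lipschitz:
  assumes [measurable]: "g \<in> borel_measurable borel" "w \<in> borel_measurable borel"
    and b: "\<And>q. \<bar>g q\<bar> \<le> B" "\<And>q. \<bar>w q\<bar> \<le> B" and S: "0 \<le> S" "S \<le> R"
  shows "mass R g w y \<le> mass S g w y + (R - S) * (4 * B * C\<^sup>2)"
proof -
  let ?h = "\<lambda>x. \<bar>g (x, y) - w (x, y)\<bar>"
  have h: "?h x \<le> 2 * B" for x using b(1)[of "(x, y)"] b(2)[of "(x, y)"] by linarith
  have B0: "0 \<le> B" using b(1)[of 0] by linarith
  have i: "integrable lborel (\<lambda>x. indicator {-R..R} x * ?h x)" for R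
    using h by (intro integrable_slice[where B="2 * B"]) auto
  have j: "integrable lborel (\<lambda>x. indicator {-R..R} x * (2 * B))" for R :: real
    by (rule integrable_slice[where B="\<bar>2 * B\<bar>"]) auto
  have "(\<integral>x. indicator {-R..R} x * ?h x \<partial>lborel) \<le> (\<integral>x. indicator {-S..S} x * ?h x +
      (indicator {-R..R} x * (2 * B) - indicator {-S..S} x * (2 * B)) \<partial>lborel)"
    using h S by (intro integral_mono i Bochner_Integration.integrable_add Bochner_Integration.integrable_diff j)
      (auto simp: indicator_def)
  also have "\<dots> = (\<integral>x. indicator {-S..S} x * ?h x \<partial>lborel) + 4 * B * (R - S)"
    using i[of S] S by (simp add: algebra_simps)
  finally have "mass R g w y \<le> ((\<integral>x. indicator {-S..S} x * ?h x \<partial>lborel) + 4 * B * (R - S)) * (r y)\<^sup>2"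
    unfolding mass_def by (intro mult_right_mono) auto
  also have "\<dots> = mass S g w y + 4 * B * (R - S) * (r y)\<^sup>2"
    by (simp add: mass_def distrib_right)
  also have "4 * B * (R - S) * (r y)\<^sup>2 \<le> 4 * B * (R - S) * C\<^sup>2"
    using r_nonneg r_le B0 S by (intro mult_left_mono power_mono) auto
  finally show ?thesis by (simp add: algebra_simps)
qed

text \<open>A set of parameters is only Lebesgue measurable, so it is exchanged for a Borel set
  \<open>G'\<close> that agrees with it up to a null set. In this form a comparison of masses that
  is pointwise in \<open>y\<close> passes to every set of parameters.\<close>

lemma local_distance_eq:
  assumes [measurable]: "g' \<in> borel_measurable borel" "w' \<in> borel_measurable borel" "G' \<in> sets borel"
    and b: "\<And>q. \<bar>g' q\<bar> \<le> B" "\<And>q. \<bar>w' q\<bar> \<le> B"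
    and eq: "AE q in lborel. q \<in> UNIV \<times> Gam \<longrightarrow> g q = g' q" "AE q in lborel. q \<in> UNIV \<times> Gam \<longrightarrow> w q = w' q"
    and G: "G' \<subseteq> Gam" "AE y in lborel. y \<in> G \<longleftrightarrow> y \<in> G'"
  shows "local_distance \<rho> m G g w = (\<integral>y. indicator G' y * mass m g' w' y \<partial>lborel)"
proof -
  let ?h = "\<lambda>q. indicator {-m..m} (fst q) * \<bar>g' q - w' q\<bar> * (indicator G' (snd q) * (r (snd q))\<^sup>2)"
  have \<rho>eq: "AE y in lborel. y \<in> Gam \<longrightarrow> \<rho> y = r y" using r by (simp add: density_version_def)
  have "local_distance \<rho> m G g w = (\<integral>q. ?h q \<partial>lborel)"
    unfolding local_distance_def
  proof (rule set_lebesgue_integral_eq_lborel)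
    have [measurable]: "(\<lambda>q::real \<times> (real ^ 'n). indicat_real G' (snd q)) \<in> borel_measurable borel"
      by (rule measurable_compose[OF borel_measurable_continuous_onI[OF continuous_on_snd[OF continuous_on_id]]])
         (rule borel_measurable_indicator, fact)
    show "?h \<in> borel_measurable borel" by measurable
    from eq AE_lborel_snd[OF G(2)] AE_lborel_snd[OF \<rho>eq]
    show "AE q in lborel. indicator ({x. \<bar>x\<bar> \<le> m} \<times> G) q * (case q of (x, y) \<Rightarrow> \<bar>g (x, y) - w (x, y)\<bar> * (\<rho> y)\<^sup>2) = ?h q"
    proof eventually_elim
      case (elim q)
      obtain x y where q: "q = (x, y)" by fastforce
      show ?case
        using elim G(1) by (cases "y \<in> G'") (auto simp: q indicator_def abs_le_iff)
    qed
  qed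
  also have "\<dots> = (\<integral>y. (\<integral>x. ?h (x, y) \<partial>lborel) \<partial>lborel)"
  proof (rule integral_x_last, rule integrable_bounded_support[of _ "{-m..m} \<times> Gam" "2 * B * C\<^sup>2"])
    have [measurable]: "(\<lambda>q::real \<times> (real ^ 'n). indicat_real G' (snd q)) \<in> borel_measurable borel"
      by (rule measurable_compose[OF borel_measurable_continuous_onI[OF continuous_on_snd[OF continuous_on_id]]])
         (rule borel_measurable_indicator, fact)
    show "?h \<in> borel_measurable borel" by measurable
    show "bounded ({-m..m} \<times> (Gam :: (real ^ 'n) set))"
      by (intro bounded_Times compact_imp_bounded[OF Gam_compact]) auto
    fix q :: "real \<times> (real ^ 'n)"
    have "\<bar>g' q - w' q\<bar> \<le> 2 * B" "0 \<le> B" using b[of q] by linarith+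
    then have "\<bar>?h q\<bar> \<le> 1 * (2 * B) * (1 * C\<^sup>2)"
      unfolding abs_mult using r_nonneg r_le
      by (intro mult_mono mult_nonneg_nonneg) (auto simp: indicator_def intro: power_mono)
    then show "\<bar>?h q\<bar> \<le> 2 * B * C\<^sup>2" by simp
    show "?h q = 0" if "q \<notin> {-m..m} \<times> Gam" using that G(1) by (cases q) (auto simp: indicator_def)
  qed
  also have "\<dots> = (\<integral>y. indicator G' y * mass m g' w' y \<partial>lborel)"
    by (simp only: fst_conv snd_conv integral_mult_left_zero mass_def)
       (simp only: mult.assoc mult.commute mult.left_commute)
  finally show ?thesis .
qed

lemma Gam_subset_borel_version:
  assumes "G \<Subset> (Gam :: (real ^ 'n) set)"
  obtains G' where "G' \<in> sets borel" "G' \<subseteq> Gam" "AE y in lborel. y \<in> G \<longleftrightarrow> y \<in> G'"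
proof -
  have "G \<in> sets (completion lborel)" "G \<subseteq> Gam"
    using assms closure_subset unfolding compactly_inside_def by auto
  then obtain S N N' where S: "G = S \<union> N" "N \<subseteq> N'" "N' \<in> null_sets lborel" "S \<in> sets lborel"
    by (elim sets_completionE)
  have "AE y in lborel. y \<notin> N'" using S(3) by (rule AE_not_in)
  then have "AE y in lborel. y \<in> G \<longleftrightarrow> y \<in> S \<inter> Gam"
    by eventually_elim (use S(1,2) \<open>G \<subseteq> Gam\<close> in auto)
  then show ?thesis using that[of "S \<inter> Gam"] S(4) by auto
qed

lemma integrable_Gam:
  fixes h :: "real ^ 'n \<Rightarrow> real" and B :: real
  assumes "h \<in> borel_measurable borel" "\<And>y. \<bar>h y\<bar> \<le> B" "G' \<in> sets borel" "G' \<subseteq> Gam"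
  shows "integrable lborel (\<lambda>y :: real ^ 'n. indicator G' y * h y)"
  using assms by (intro integrable_bounded_support[of _ G' B])
    (auto intro: bounded_subset[OF compact_imp_bounded[OF Gam_compact]] simp: indicator_def)

definition slice :: "(real \<times> real \<times> (real ^ 'n) \<Rightarrow> real) \<Rightarrow> real \<Rightarrow> real \<times> (real ^ 'n) \<Rightarrow> real" where
  "slice g t q = g (fst q, t, snd q)"

lemma slice_measurable [measurable]:
  assumes [measurable]: "g \<in> borel_measurable borel" shows "slice g t \<in> borel_measurable borel"
  unfolding slice_def[abs_def] by measurable

lemma slice_le: "\<bar>slice u' t q\<bar> \<le> M" "\<bar>slice v' t q\<bar> \<le> M"
  using bJ u'J v'J by (auto simp: slice_def)

context
  fixes u0' v0' :: "real \<times> (real ^ 'n) \<Rightarrow> real" and M0 :: real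
  assumes u0' [measurable]: "u0' \<in> borel_measurable borel" and v0' [measurable]: "v0' \<in> borel_measurable borel"
    and b0: "\<And>q. \<bar>u0' q\<bar> \<le> M0" "\<And>q. \<bar>v0' q\<bar> \<le> M0"
    and init: "\<And>R. ((\<lambda>T. 1 / T * defect R 0 T u' u0') \<longlongrightarrow> 0) (at_right 0)"
      "\<And>R. ((\<lambda>T. 1 / T * defect R 0 T v' v0') \<longlongrightarrow> 0) (at_right 0)"
begin

text \<open>One null set of \<open>(t, y)\<close> has to serve all \<open>m\<close>, hence the
  countable families of sharpness parameters \<open>n\<close> and rational radii. At a fixed point
  outside it, \<open>n\<close> tends to infinity and the radius then decreases to
  \<open>m + \<alpha> * t\<close>, the latter by \<open>mass_lipschitz\<close>.\<close>

lemma mass_contraction_AE: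
  "AE z in lborel. 0 < fst z \<longrightarrow> (\<forall>m>0. mass m (slice u' (fst z)) (slice v' (fst z)) (snd z)
      \<le> mass (m + \<alpha> * fst z) u0' v0' (snd z))"
proof -
  have "AE z in lborel. \<forall>(n::nat) (q::rat). 0 < real_of_rat q \<longrightarrow> 0 < fst z \<longrightarrow>
      cone_mass (real (Suc n)) (real_of_rat q) z \<le> mass (real_of_rat q) u0' v0' (snd z)"
    unfolding AE_all_countable
  proof (intro allI)
    fix n :: nat and q :: rat
    show "AE z in lborel. 0 < real_of_rat q \<longrightarrow> 0 < fst z \<longrightarrow>
      cone_mass (real (Suc n)) (real_of_rat q) z \<le> mass (real_of_rat q) u0' v0' (snd z)"
    proof (cases "0 < real_of_rat q")
      case True
      have "AE z in lborel. 0 < fst z \<longrightarrow>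
          cone_mass (real (Suc n)) (real_of_rat q) z \<le> mass (real_of_rat q) u0' v0' (snd z)"
        by (rule cone_mass_le_AE[OF u0' v0' b0 True init]) simp
      then show ?thesis by eventually_elim auto
    qed auto
  qed
  then show ?thesis
  proof eventually_elim
    case (elim z)
    show ?case
    proof (intro impI allI)
      fix m :: real assume t: "0 < fst z" and m: "m > 0"
      let ?t = "fst z" and ?y = "snd z"
      let ?D = "\<lambda>x. \<bar>u' (x, z) - v' (x, z)\<bar>"
      let ?m = "mass m (slice u' ?t) (slice v' ?t) ?y"
      have mass_eq: "?m = (\<integral>x. indicator {-m..m} x * ?D x \<partial>lborel) * (r ?y)\<^sup>2"
        by (simp add: mass_def slice_def)
      define S where "S = m + \<alpha> * ?t"
      have S: "0 < S" using m t \<alpha>(2) by (auto simp: S_def intro!: add_pos_pos)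
      have le: "?m \<le> mass R u0' v0' ?y" if R: "R = real_of_rat q" "S < R" for R q
      proof -
        let ?e = "\<lambda>n. flat 0 (real (Suc n) * (R - S))"
        have "(?e n * ?e n) * ?m \<le> mass R u0' v0' ?y" for n
        proof -
          let ?n = "real (Suc n)"
          \<comment> \<open>At time \<open>?t\<close> every \<open>x\<close> with
            \<open>\<bar>x\<bar> \<le> m\<close> lies at distance at least \<open>R - S\<close> from
            both edges of the cone.\<close>
          have cl: "?e n * ?e n * indicator {-m..m} x \<le> cone_cutoff ?n R x ?t" for x
          proof (cases "x \<in> {-m..m}")
            case True
            then have "?n * (R - S) \<le> ?n * (R - \<alpha> * ?t - x)" "?n * (R - S) \<le> ?n * (R - \<alpha> * ?t + x)"
              by (auto intro!: mult_left_mono simp: S_def)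
            then show ?thesis
              unfolding cone_cutoff_def using True by (simp add: mult_mono flat_0_mono flat_nonneg)
          qed (simp add: cone_bounds)
          have "(?e n * ?e n) * (\<integral>x. indicator {-m..m} x * ?D x \<partial>lborel)
              = (\<integral>x. (?e n * ?e n * indicator {-m..m} x) * ?D x \<partial>lborel)"
            by (simp add: mult.assoc)
          also have "\<dots> \<le> (\<integral>x. cone_cutoff ?n R x ?t * ?D x \<partial>lborel)"
          proof (rule integral_mono_AE')
            show "integrable lborel (\<lambda>x. cone_cutoff ?n R x ?t * ?D x)"
            proof (rule integrable_bounded_support[of _ "{-R..R}" "1 * (2 * M)"])
              fix x
              show "\<bar>cone_cutoff ?n R x ?t * ?D x\<bar> \<le> 1 * (2 * M)"
                unfolding abs_mult using cone_bounds[of ?n R x ?t] diff_le[of "(x, z)"] by (intro mult_mono) auto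
              show "cone_cutoff ?n R x ?t * ?D x = 0" if "x \<notin> {-R..R}"
                using cone_le_indicator[of ?n ?t R x] cone_bounds(1)[of ?n R x ?t] t that by auto
            qed auto
            show "AE x in lborel. ?e n * ?e n * indicator {-m..m} x * ?D x \<le> cone_cutoff ?n R x ?t * ?D x"
              using cl by (intro AE_I2 mult_right_mono) auto
            show "AE x in lborel. 0 \<le> cone_cutoff ?n R x ?t * ?D x"
              using cone_bounds by auto
          qed
          finally have "(?e n * ?e n) * (\<integral>x. indicator {-m..m} x * ?D x \<partial>lborel) * (r ?y)\<^sup>2
              \<le> cone_mass ?n R z"
            unfolding cone_mass_def using t by (auto intro: mult_right_mono)
          also have "\<dots> \<le> mass R u0' v0' ?y"
          proof -
            have pos: "0 < real_of_rat q" using R S by linarith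
            show ?thesis unfolding R(1) by (rule elim[rule_format, OF pos t])
          qed
          finally show ?thesis by (simp add: mass_eq mult.assoc)
        qed
        moreover have "(\<lambda>n. (?e n * ?e n) * ?m) \<longlonglongrightarrow> (1 * 1) * ?m"
          using R(2) by (intro tendsto_intros flat_scaled_tendsto_1) auto
        ultimately show ?thesis
          using LIMSEQ_le_const2[of "\<lambda>n. (?e n * ?e n) * ?m" "(1 * 1) * ?m"] by auto
      qed
      let ?K = "4 * M0 * C\<^sup>2"
      have K0: "0 \<le> ?K" using b0(1)[of 0] by auto
      have "?m \<le> mass S u0' v0' ?y + e" if "e > 0" for e
      proof -
        have "0 < e / (?K + 1)" using that K0 by (intro divide_pos_pos) auto
        then obtain q where q: "S < real_of_rat q" "real_of_rat q < S + e / (?K + 1)"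
          using of_rat_dense[of S "S + e / (?K + 1)"] by auto
        have "?m \<le> mass (real_of_rat q) u0' v0' ?y" using le[OF refl q(1)] .
        also have "\<dots> \<le> mass S u0' v0' ?y + (real_of_rat q - S) * ?K"
          using S q(1) by (intro mass_lipschitz[OF u0' v0' b0]) auto
        also have "(real_of_rat q - S) * ?K \<le> e / (?K + 1) * (?K + 1)"
          using q K0 by (intro mult_mono) auto
        also have "\<dots> = e" using K0 by simp
        finally show ?thesis by simp
      qed
      then have "?m \<le> mass S u0' v0' ?y" by (rule field_le_epsilon)
      then show "?m \<le> mass (m + \<alpha> * ?t) u0' v0' ?y" by (simp add: S_def)
    qed
  qed
qed

end


context
  fixes u0 v0 u0' v0' :: "real \<times> (real ^ 'n) \<Rightarrow> real" and M0 :: real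
  assumes u0' [measurable]: "u0' \<in> borel_measurable borel" and v0' [measurable]: "v0' \<in> borel_measurable borel"
    and b0: "\<And>q. \<bar>u0' q\<bar> \<le> M0" "\<And>q. \<bar>v0' q\<bar> \<le> M0"
    and init: "\<And>R. ((\<lambda>T. 1 / T * defect R 0 T u' u0') \<longlongrightarrow> 0) (at_right 0)"
      "\<And>R. ((\<lambda>T. 1 / T * defect R 0 T v' v0') \<longlongrightarrow> 0) (at_right 0)"
    and eq0: "AE q in lborel. q \<in> UNIV \<times> Gam \<longrightarrow> u0 q = u0' q" "AE q in lborel. q \<in> UNIV \<times> Gam \<longrightarrow> v0 q = v0' q"
begin

lemmas contraction = mass_contraction_AE[OF u0' v0' b0 init]

lemma mass_integrable:
  assumes [measurable]: "g \<in> borel_measurable borel" "w \<in> borel_measurable borel"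
    and b: "\<And>q. \<bar>g q\<bar> \<le> B" "\<And>q. \<bar>w q\<bar> \<le> B" and R: "R \<ge> 0" and G': "G' \<in> sets borel" "G' \<subseteq> Gam"
  shows "integrable lborel (\<lambda>y. indicator G' y * mass R g w y)"
  using mass_bounds[OF assms(1,2) b R] G' by (intro integrable_Gam[where B="2 * R * (2 * B) * C\<^sup>2"]) auto

text \<open>The masses are compared for almost every \<open>y\<close> and all \<open>m\<close>
  simultaneously, so the integration over \<open>G\<close> takes place after the null set of times
  has been fixed. That set depends neither on \<open>m\<close> nor on \<open>G\<close>.\<close>

lemma distance_contraction_AE:
  "AE t in lebesgue_on {0<..}. \<forall>m>0. \<forall>G. G \<Subset> Gam \<longrightarrow>
     local_distance \<rho> m G (\<lambda>(x, y). u (x, t, y)) (\<lambda>(x, y). v (x, t, y))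
       \<le> local_distance \<rho> (m + \<alpha> * t) G u0 v0"
proof -
  have "AE t in lborel. AE y in lborel. 0 < t \<longrightarrow> (\<forall>m>0. mass m (slice u' t) (slice v' t) y \<le> mass (m + \<alpha> * t) u0' v0' y)"
    using lborel_pair.AE_pair[OF contraction[folded lborel_prod]] by simp
  with AE_lborel_time_slice[OF u'eq] AE_lborel_time_slice[OF v'eq]
  have "AE t in lborel. t \<in> {0<..} \<longrightarrow> (\<forall>m>0. \<forall>G. G \<Subset> Gam \<longrightarrow>
     local_distance \<rho> m G (\<lambda>(x, y). u (x, t, y)) (\<lambda>(x, y). v (x, t, y))
       \<le> local_distance \<rho> (m + \<alpha> * t) G u0 v0)"
  proof eventually_elim
    case (elim t)
    show ?case
    proof (intro impI allI)
      fix m :: real and G :: "(real ^ 'n) set"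
      assume t: "t \<in> {0<..}" and m: "m > 0" and "G \<Subset> Gam"
      then obtain G' where G': "G' \<in> sets borel" "G' \<subseteq> Gam" "AE y in lborel. y \<in> G \<longleftrightarrow> y \<in> G'"
        using Gam_subset_borel_version by blast
      note [measurable] = G'(1)
      have ue: "AE q in lborel. q \<in> UNIV \<times> Gam \<longrightarrow> (case q of (x, y) \<Rightarrow> u (x, t, y)) = slice u' t q"
        using elim(1) by eventually_elim (use t in \<open>auto simp: slice_def in_Omega_iff\<close>)
      have ve: "AE q in lborel. q \<in> UNIV \<times> Gam \<longrightarrow> (case q of (x, y) \<Rightarrow> v (x, t, y)) = slice v' t q"
        using elim(2) by eventually_elim (use t in \<open>auto simp: slice_def in_Omega_iff\<close>)
      have mt: "0 \<le> m + \<alpha> * t" using m t \<alpha>(2) by auto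
      have "local_distance \<rho> m G (\<lambda>(x, y). u (x, t, y)) (\<lambda>(x, y). v (x, t, y))
          = (\<integral>y. indicator G' y * mass m (slice u' t) (slice v' t) y \<partial>lborel)"
        by (rule local_distance_eq[where B=M]) (use slice_le ue ve G' in auto)
      also have "\<dots> \<le> (\<integral>y. indicator G' y * mass (m + \<alpha> * t) u0' v0' y \<partial>lborel)"
      proof (rule integral_mono_AE)
        show "integrable lborel (\<lambda>y. indicator G' y * mass m (slice u' t) (slice v' t) y)"
          by (rule mass_integrable[where B=M]) (use slice_le m G' in auto)
        show "integrable lborel (\<lambda>y. indicator G' y * mass (m + \<alpha> * t) u0' v0' y)"
          by (rule mass_integrable[OF u0' v0' b0 mt G'(1,2)])
        show "AE y in lborel. indicator G' y * mass m (slice u' t) (slice v' t) y \<le> indicator G' y * mass (m + \<alpha> * t) u0' v0' y"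
          using elim(3) by eventually_elim (use t m in \<open>auto intro!: mult_left_mono\<close>)
      qed
      also have "\<dots> = local_distance \<rho> (m + \<alpha> * t) G u0 v0"
        by (rule local_distance_eq[OF u0' v0' G'(1) b0 eq0 G'(2,3), symmetric])
      finally show "local_distance \<rho> m G (\<lambda>(x, y). u (x, t, y)) (\<lambda>(x, y). v (x, t, y))
          \<le> local_distance \<rho> (m + \<alpha> * t) G u0 v0" .
    qed
  qed
  then show ?thesis by (simp add: AE_lebesgue_on_iff)
qed

text \<open>A time value is attained only in the mean over \<open>(t, t + T)\<close>, so everything
  is averaged over this interval. Replacing time values by solutions costs defects. The contraction
  applies at almost every time of the interval, with a radius that exceeds
  \<open>m + \<alpha> * t\<close> by at most \<open>\<alpha> * T\<close>;
  \<open>mass_lipschitz\<close> turns this excess into a term of order \<open>T\<close>.\<close>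

lemma distance_contraction_time_value:
  assumes t: "t > 0" and [measurable]: "ut' \<in> borel_measurable borel" "vt' \<in> borel_measurable borel"
    and bt: "\<And>q. \<bar>ut' q\<bar> \<le> Mt" "\<And>q. \<bar>vt' q\<bar> \<le> Mt"
    and lim: "((\<lambda>T. 1 / T * defect m t T u' ut') \<longlongrightarrow> 0) (at_right 0)"
      "((\<lambda>T. 1 / T * defect m t T v' vt') \<longlongrightarrow> 0) (at_right 0)"
    and eqt: "AE q in lborel. q \<in> UNIV \<times> Gam \<longrightarrow> ut q = ut' q" "AE q in lborel. q \<in> UNIV \<times> Gam \<longrightarrow> vt q = vt' q"
    and m: "m > 0" and G: "G \<Subset> Gam"
  shows "local_distance \<rho> m G ut vt \<le> local_distance \<rho> (m + \<alpha> * t) G u0 v0"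
proof -
  obtain G' where G': "G' \<in> sets borel" "G' \<subseteq> Gam" "AE y in lborel. y \<in> G \<longleftrightarrow> y \<in> G'"
    using Gam_subset_borel_version[OF G] by blast
  note [measurable] = G'(1)
  have indG [measurable]: "(\<lambda>q::real \<times> real \<times> (real ^ 'n). indicat_real G' (snd (snd q))) \<in> borel_measurable borel"
      "(\<lambda>q::real \<times> (real ^ 'n). indicat_real G' (snd q)) \<in> borel_measurable borel"
    by (rule measurable_compose[OF borel_measurable_continuous_onI borel_measurable_indicator[OF G'(1)]],
        intro continuous_intros)+
  define S where "S = m + \<alpha> * t"
  have S0: "0 \<le> S" using m t \<alpha>(2) by (auto simp: S_def)
  let ?X = "\<integral>y. indicator G' y * mass m ut' vt' y \<partial>lborel" and ?Z = "\<integral>y. indicator G' y * mass S u0' v0' y \<partial>lborel"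
  let ?K = "4 * M0 * C\<^sup>2"
  have K0: "0 \<le> ?K" using b0(1)[of 0] by auto
  have Mt0: "0 \<le> Mt" using bt(1)[of 0] by linarith
  obtain Y' where Y': "\<And>y :: real ^ 'n. y \<in> Gam \<Longrightarrow> norm y \<le> Y'"
    using compact_imp_bounded[OF Gam_compact] unfolding bounded_iff by blast
  have uM: "\<bar>u' p\<bar> \<le> M" "\<bar>v' p\<bar> \<le> M" for p using bJ u'J v'J by auto
  let ?V = "\<integral>y. indicat_real G' y \<partial>lborel"
  have iV: "integrable lborel (indicat_real G')"
    using integrable_Gam[of "\<lambda>_. 1" 1 G'] G' by simp
  \<comment> \<open>The factor \<open>C\<close> arises because the distances carry two powers of the
    weight and the defects only one.\<close>
  let ?f = "\<lambda>T. C * (1 / T * defect m t T u' ut' + 1 / T * defect m t T v' vt') + ?Z + (\<alpha> * T * ?K) * ?V"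
  have le: "?X \<le> ?f T" if T: "T > 0" for T
  proof -
    let ?i = "\<lambda>s. indicat_real {t<..<t + T} s"
    have iT: "(\<integral>s. ?i s \<partial>lborel) = T" using T by simp
    have ii: "integrable lborel ?i"
      by (rule integrable_bounded_support[of _ "{t<..<t + T}" 1]) auto
    let ?A = "\<lambda>p. indicator {-m..m} (fst p) * ?i (fst (snd p)) * (indicator G' (snd (snd p)) * (r (snd (snd p)))\<^sup>2)"
    let ?G = "\<lambda>g w p. indicator {-m..m} (fst p) * ?i (fst (snd p)) *
     (\<bar>g p - w (fst p, snd (snd p))\<bar> * r (snd (snd p)))"
    have int: "integrable lborel (\<lambda>p. ?A p * h p)"
      if [measurable]: "h \<in> borel_measurable borel" and h: "\<And>p. \<bar>h p\<bar> \<le> B" for h B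
    proof (rule integrable_triple[of _ "1 * 1 * (1 * C\<^sup>2) * B" m "t + T" Y'])
      show "(\<lambda>p. ?A p * h p) \<in> borel_measurable borel" by measurable
      fix p
      show "\<bar>?A p * h p\<bar> \<le> 1 * 1 * (1 * C\<^sup>2) * B"
        unfolding abs_mult using h r_nonneg r_le
        by (intro mult_mono mult_nonneg_nonneg) (auto simp: indicator_def intro: power_mono)
    next
      fix x s y assume "?A (x, s, y) * h (x, s, y) \<noteq> 0"
      then have "x \<in> {-m..m}" "s \<in> {t<..<t + T}" "y \<in> G'" by (auto simp: indicator_def split: if_splits)
      then show "\<bar>x\<bar> \<le> m \<and> \<bar>s\<bar> \<le> t + T \<and> norm y \<le> Y'" using G'(2) Y' t by auto
    qed
    have iG: "integrable lborel (?G g w)" if [measurable]: "g \<in> borel_measurable borel" "w \<in> borel_measurable borel"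
      and b: "\<And>p. \<bar>g p\<bar> \<le> M" "\<And>q. \<bar>w q\<bar> \<le> Mt" for g w
    proof (rule integrable_triple[of _ "1 * 1 * ((M + Mt) * C)" m "t + T" Y'])
      fix p
      have "\<bar>g p - w (fst p, snd (snd p))\<bar> \<le> M + Mt"
        using b(1)[of p] b(2)[of "(fst p, snd (snd p))"] by linarith
      then show "\<bar>?G g w p\<bar> \<le> 1 * 1 * ((M + Mt) * C)"
        unfolding abs_mult using r_nonneg r_le M_nonneg Mt0 C_nonneg
        by (intro mult_mono mult_nonneg_nonneg) (auto simp: indicator_def)
    next
      fix x s y assume "?G g w (x, s, y) \<noteq> 0"
      then have "x \<in> {-m..m}" "s \<in> {t<..<t + T}" "r y \<noteq> 0" by (auto simp: indicator_def split: if_splits)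
      moreover have "y \<in> Gam" using \<open>r y \<noteq> 0\<close> r by (auto simp: density_version_def)
      ultimately show "\<bar>x\<bar> \<le> m \<and> \<bar>s\<bar> \<le> t + T \<and> norm y \<le> Y'" using Y' t by auto
    qed measurable
    note iGu = iG[OF u' assms(2) uM(1) bt(1)] and iGv = iG[OF v' assms(3) uM(2) bt(2)]
    let ?t = "\<lambda>p. \<bar>ut' (fst p, snd (snd p)) - vt' (fst p, snd (snd p))\<bar>"
    let ?d = "\<lambda>p. \<bar>u' p - v' p\<bar>"
    have tb: "\<bar>?t p\<bar> \<le> 2 * Mt" for p
      using bt(1)[of "(fst p, snd (snd p))"] bt(2)[of "(fst p, snd (snd p))"] by linarith
    have it: "integrable lborel (\<lambda>p. ?A p * ?t p)" by (rule int[OF _ tb]) measurable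
    have id: "integrable lborel (\<lambda>p. ?A p * ?d p)" using diff_le by (intro int[where B="2 * M"]) auto
    have prod: "integrable lborel (\<lambda>z::real \<times> (real ^ 'n). ?i (fst z) * h (snd z))"
      if "integrable lborel h" for h
    proof -
      have "integrable (lborel \<Otimes>\<^sub>M lborel) (\<lambda>z::real \<times> (real ^ 'n). ?i (fst z) * h (snd z))"
      proof (rule lborel_pair.Fubini_integrable)
        show "(\<lambda>z::real \<times> (real ^ 'n). ?i (fst z) * h (snd z)) \<in> borel_measurable (lborel \<Otimes>\<^sub>M lborel)"
          using borel_measurable_integrable[OF that] by measurable
        have "(\<integral>y. norm (?i s * h y) \<partial>lborel) = ?i s * (\<integral>y. \<bar>h y\<bar> \<partial>lborel)" for s
          by (simp add: abs_mult)
        then show "integrable lborel (\<lambda>x. \<integral>y. norm (?i (fst (x, y)) * h (snd (x, y))) \<partial>lborel)"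
          using ii by simp
        show "AE x in lborel. integrable lborel (\<lambda>y. ?i (fst (x, y)) * h (snd (x, y)))"
          using that by simp
      qed
      then show ?thesis by (simp add: lborel_prod)
    qed
    have imt: "integrable lborel (\<lambda>y. indicator G' y * mass m ut' vt' y)"
      using m by (intro mass_integrable[OF assms(2,3) bt _ G'(1,2)]) auto
    have imS: "integrable lborel (\<lambda>y. indicator G' y * mass S u0' v0' y)"
      by (rule mass_integrable[OF u0' v0' b0 S0 G'(1,2)])
    have sl_t: "(\<integral>x. ?A (x, z) * ?t (x, z) \<partial>lborel) = ?i (fst z) * (indicator G' (snd z) * mass m ut' vt' (snd z))" for z
    proof -
      have "(\<integral>x. ?A (x, z) * ?t (x, z) \<partial>lborel) = (\<integral>x. (?i (fst z) * indicator G' (snd z) * (r (snd z))\<^sup>2) *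
          (indicator {-m..m} x * \<bar>ut' (x, snd z) - vt' (x, snd z)\<bar>) \<partial>lborel)"
        by (rule Bochner_Integration.integral_cong) (auto simp: mult_ac)
      then show ?thesis
        by (simp only: integral_mult_right_zero mass_def) (simp only: mult.assoc mult.commute mult.left_commute)
    qed
    have sl_d: "(\<integral>x. ?A (x, z) * ?d (x, z) \<partial>lborel) = ?i (fst z) * (indicator G' (snd z) *
        mass m (slice u' (fst z)) (slice v' (fst z)) (snd z))" for z
    proof -
      have "(\<integral>x. ?A (x, z) * ?d (x, z) \<partial>lborel) = (\<integral>x. (?i (fst z) * indicator G' (snd z) * (r (snd z))\<^sup>2) *
          (indicator {-m..m} x * \<bar>slice u' (fst z) (x, snd z) - slice v' (fst z) (x, snd z)\<bar>) \<partial>lborel)"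
        by (rule Bochner_Integration.integral_cong) (auto simp: mult_ac slice_def)
      then show ?thesis
        by (simp only: integral_mult_right_zero mass_def) (simp only: mult.assoc mult.commute mult.left_commute)
    qed
    have "T * ?X = (\<integral>p. ?A p * ?t p \<partial>lborel)"
      unfolding integral_x_last[OF it] sl_t integral_product_functions[OF prod[OF imt], unfolded iT] ..
    also have "\<dots> \<le> (\<integral>p. C * (?G u' ut' p + ?G v' vt' p) + ?A p * ?d p \<partial>lborel)"
    proof (rule integral_mono[OF it])
      show "integrable lborel (\<lambda>p. C * (?G u' ut' p + ?G v' vt' p) + ?A p * ?d p)"
        using iGu iGv id by (intro Bochner_Integration.integrable_add integrable_mult_right)
      fix p :: "real \<times> real \<times> (real ^ 'n)"
      let ?j = "indicat_real {-m..m} (fst p) * ?i (fst (snd p))" and ?g = "indicat_real G' (snd (snd p))" and ?r = "r (snd (snd p))"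
      let ?a = "\<bar>u' p - ut' (fst p, snd (snd p))\<bar>" and ?b = "\<bar>v' p - vt' (fst p, snd (snd p))\<bar>"
      have j0: "0 \<le> ?j" by simp
      have rr: "0 \<le> ?r" "?r \<le> C" using r_nonneg r_le by auto
      have A0: "0 \<le> ?A p" by simp
      have "?A p * ?t p \<le> ?A p * ((?a + ?b) + ?d p)" using A0 by (intro mult_left_mono) auto
      also have "\<dots> = (?g * ?r) * (?j * (?a * ?r + ?b * ?r)) + ?A p * ?d p"
        by (simp add: algebra_simps power2_eq_square)
      also have "\<dots> \<le> C * (?j * (?a * ?r + ?b * ?r)) + ?A p * ?d p"
      proof (intro add_right_mono mult_right_mono)
        show "?g * ?r \<le> C" using rr C_nonneg by (auto simp: indicator_def)
        show "0 \<le> ?j * (?a * ?r + ?b * ?r)" using j0 rr by (intro mult_nonneg_nonneg add_nonneg_nonneg) auto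
      qed
      also have "\<dots> = C * (?G u' ut' p + ?G v' vt' p) + ?A p * ?d p" by (simp add: algebra_simps)
      finally show "?A p * ?t p \<le> C * (?G u' ut' p + ?G v' vt' p) + ?A p * ?d p" .
    qed
    also have "\<dots> = C * (defect m t T u' ut' + defect m t T v' vt') + (\<integral>p. ?A p * ?d p \<partial>lborel)"
      unfolding defect_def using iGu iGv id
      by (subst Bochner_Integration.integral_add) (auto intro!: integrable_mult_right)
    also have "(\<integral>p. ?A p * ?d p \<partial>lborel) \<le> (\<integral>z. ?i (fst z) * (indicator G' (snd z) * mass S u0' v0' (snd z)
        + (\<alpha> * T * ?K) * indicator G' (snd z)) \<partial>lborel)"
      unfolding integral_x_last[OF id] sl_d
    proof (rule integral_mono_AE)
      have "integrable (lborel \<Otimes>\<^sub>M lborel) (\<lambda>(x, z). ?A (x, z) * ?d (x, z))"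
        using id by (simp add: lborel_prod case_prod_beta')
      from lborel_pair.integrable_snd[OF this]
      show "integrable lborel (\<lambda>z. ?i (fst z) * (indicator G' (snd z) * mass m (slice u' (fst z)) (slice v' (fst z)) (snd z)))"
        by (simp only: sl_d)
      show "integrable lborel (\<lambda>z. ?i (fst z) * (indicator G' (snd z) * mass S u0' v0' (snd z)
        + (\<alpha> * T * ?K) * indicator G' (snd z)))"
        using imS iV by (intro prod Bochner_Integration.integrable_add integrable_mult_right)
      show "AE z in lborel. ?i (fst z) * (indicator G' (snd z) * mass m (slice u' (fst z)) (slice v' (fst z)) (snd z))
          \<le> ?i (fst z) * (indicator G' (snd z) * mass S u0' v0' (snd z) + (\<alpha> * T * ?K) * indicator G' (snd z))"
        using contraction
      proof eventually_elim
        case (elim z)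
        show ?case
        proof (cases "fst z \<in> {t<..<t + T} \<and> snd z \<in> G'")
          case True
          then have s: "t < fst z" "fst z < t + T" by auto
          have "mass m (slice u' (fst z)) (slice v' (fst z)) (snd z) \<le> mass (m + \<alpha> * fst z) u0' v0' (snd z)"
            using elim s t m by auto
          also have "\<dots> \<le> mass S u0' v0' (snd z) + (m + \<alpha> * fst z - S) * ?K"
            using s \<alpha>(2) S0 by (intro mass_lipschitz[OF u0' v0' b0]) (auto simp: S_def)
          also have "(m + \<alpha> * fst z - S) * ?K \<le> (\<alpha> * T) * ?K"
          proof (rule mult_right_mono[OF _ K0])
            have "\<alpha> * (fst z - t) \<le> \<alpha> * T" using s \<alpha>(2) by (intro mult_left_mono) auto
            then show "m + \<alpha> * fst z - S \<le> \<alpha> * T" by (simp add: S_def algebra_simps)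
          qed
          finally show ?thesis using True by simp
        qed auto
      qed
    qed
    also have "\<dots> = T * (?Z + (\<alpha> * T * ?K) * ?V)"
    proof -
      have "integrable lborel (\<lambda>y. indicator G' y * mass S u0' v0' y + (\<alpha> * T * ?K) * indicator G' y)"
        using imS iV by (intro Bochner_Integration.integrable_add integrable_mult_right)
      from integral_product_functions[OF prod[OF this], unfolded iT] show ?thesis
        using imS iV by simp
    qed
    finally have "T * ?X \<le> C * (defect m t T u' ut' + defect m t T v' vt') + T * (?Z + (\<alpha> * T * ?K) * ?V)" by simp
    then have "?X \<le> (C * (defect m t T u' ut' + defect m t T v' vt') + T * (?Z + (\<alpha> * T * ?K) * ?V)) / T"
      using T by (simp add: pos_le_divide_eq mult.commute)
    also have "\<dots> = ?f T" using T by (simp add: add_divide_distrib distrib_left)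
    finally show ?thesis .
  qed
  have "(?f \<longlongrightarrow> C * (0 + 0) + ?Z + (\<alpha> * 0 * ?K) * ?V) (at_right 0)"
    by (intro tendsto_add tendsto_mult tendsto_const lim tendsto_ident_at)
  moreover have "\<forall>\<^sub>F T in at_right 0. ?X \<le> ?f T"
    using le by (intro eventually_at_rightI[of 0 1]) auto
  ultimately have "?X \<le> C * (0 + 0) + ?Z + (\<alpha> * 0 * ?K) * ?V"
    by (rule tendsto_lowerbound) simp
  then have "?X \<le> ?Z" by simp
  moreover have "local_distance \<rho> m G ut vt = ?X"
    by (rule local_distance_eq[OF assms(2,3) G'(1) bt eqt G'(2,3)])
  moreover have "local_distance \<rho> (m + \<alpha> * t) G u0 v0 = ?Z"
    unfolding S_def by (rule local_distance_eq[OF u0' v0' G'(1) b0 eq0 G'(2,3)])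
  ultimately show ?thesis by simp
qed

text \<open>With equal data the initial mass is 0 for every radius, so the mass of the difference
  vanishes on every bounded interval. Positivity of \<open>r\<close> almost everywhere on
  \<open>Gam\<close> then allows division by its square.\<close>

lemma solutions_equal_AE:
  assumes same: "u0' = v0'" and pos: "AE y in lborel. y \<in> Gam \<longrightarrow> 0 < r y"
  shows "AE p in lborel. p \<in> Omega \<longrightarrow> u p = v p"
proof -
  have "AE z in lborel. AE x in lborel. (x, z) \<notin> {p \<in> Omega. u' p \<noteq> v' p}"
    using contraction AE_lborel_snd[OF pos]
  proof eventually_elim
    case (elim z)
    show ?case
    proof (cases "0 < fst z \<and> snd z \<in> Gam")
      case False
      then show ?thesis by (auto simp: in_Omega_iff)
    next
      case True
      let ?D = "\<lambda>x. \<bar>u' (x, z) - v' (x, z)\<bar>"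
      have "AE x in lborel. indicator {- real (Suc j)..real (Suc j)} x * ?D x = 0" for j
      proof -
        let ?I = "\<integral>x. indicator {- real (Suc j)..real (Suc j)} x * ?D x \<partial>lborel"
        have "mass (real (Suc j)) (slice u' (fst z)) (slice v' (fst z)) (snd z)
            \<le> mass (real (Suc j) + \<alpha> * fst z) u0' v0' (snd z)"
          using elim(1) True by (metis of_nat_0_less_iff zero_less_Suc)
        also have "\<dots> = 0" by (simp add: same mass_def)
        finally have "mass (real (Suc j)) (slice u' (fst z)) (slice v' (fst z)) (snd z) \<le> 0" .
        then have "?I * (r (snd z))\<^sup>2 \<le> 0" by (simp add: mass_def slice_def)
        moreover have "0 < (r (snd z))\<^sup>2" using elim(2) True by simp
        ultimately have "?I \<le> 0" by (simp add: mult_le_0_iff not_le)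
        moreover have "0 \<le> ?I" by (intro integral_nonneg_AE) auto
        ultimately have "?I = 0" by (rule order_antisym)
        moreover have "integrable lborel (\<lambda>x. indicator {- real (Suc j)..real (Suc j)} x * ?D x)"
          using diff_le by (intro integrable_slice[where B="2 * M"]) auto
        ultimately show ?thesis
          by (subst (asm) integral_nonneg_eq_0_iff_AE) auto
      qed
      then have "AE x in lborel. \<forall>j. indicator {- real (Suc j)..real (Suc j)} x * ?D x = 0"
        unfolding AE_all_countable by blast
      then show ?thesis
      proof eventually_elim
        case (elim x)
        obtain j where "\<bar>x\<bar> \<le> real j" using real_arch_simple by blast
        then have "x \<in> {- real (Suc j)..real (Suc j)}" by auto
        then show ?case using elim[rule_format, of j] by simp
      qed
    qed
  qed
  then have "AE p in lborel. p \<notin> {p \<in> Omega. u' p \<noteq> v' p}"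
  proof (rule AE_lborel_x_lastI[rotated])
    show "{p \<in> Omega. u' p \<noteq> v' p} \<in> sets borel" by measurable
  qed
  with u'eq v'eq show ?thesis by eventually_elim auto
qed

end

end

section \<open>Application to weak entropy solutions\<close>

text \<open>What holds almost everywhere on \<open>Omega\<close> holds somewhere. The set of
  admissible values is therefore nonempty and offers a constant for filling exceptional
  sets.\<close>

lemma Omega_not_null: "\<not> (AE p in lborel. p \<notin> (Omega :: (real \<times> real \<times> (real ^ 'n)) set))"
proof
  assume "AE p in lborel. p \<notin> (Omega :: (real \<times> real \<times> (real ^ 'n)) set)"
  then have "emeasure lborel (Omega :: (real \<times> real \<times> (real ^ 'n)) set) = 0"
    by (subst AE_iff_measurable[symmetric, where P="\<lambda>p. p \<notin> Omega"]) auto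
  then have neg: "negligible (Omega :: (real \<times> real \<times> (real ^ 'n)) set)"
    by (auto simp: negligible_iff_emeasure0 emeasure_completion)
  let ?U = "UNIV \<times> {0<..} \<times> box (\<chi> j. -1) (\<chi> j. 1) :: (real \<times> real \<times> (real ^ 'n)) set"
  have "open ?U" by (intro open_Times) auto
  moreover have "?U \<subseteq> Omega" unfolding Omega_def Gam_cbox using box_subset_cbox by blast
  moreover have "(0, 1, 0) \<in> ?U" by (auto simp: mem_box_cart)
  ultimately show False
    using open_not_negligible negligible_subset[OF neg] by (metis empty_iff)
qed

lemma entropy_pair_exists:
  fixes \<rho> :: "real ^ 'n \<Rightarrow> real"
  assumes sf: "scalar_flux I J f f' L" and pd: "product_density \<rho>"
    and u: "weak_entropy_solution \<rho> I f u0 u" "AE p in lebesgue_on Omega. u p \<in> J"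
    and v: "weak_entropy_solution \<rho> I f v0 v" "AE p in lebesgue_on Omega. v p \<in> J"
  obtains J' r C M u' v' where "entropy_pair I J' f f' L \<rho> r C M (L + 1) u v u' v'"
proof -
  obtain r C where r: "density_version \<rho> r C" using density_version_exists[OF pd] by blast
  obtain A where A: "AE p in lebesgue_on Omega. \<bar>u p\<bar> \<le> A" and um: "u \<in> borel_measurable (lebesgue_on Omega)"
    using u(1) by (auto simp: weak_entropy_solution_def Linf_def)
  obtain B where B: "AE p in lebesgue_on Omega. \<bar>v p\<bar> \<le> B" and vm: "v \<in> borel_measurable (lebesgue_on Omega)"
    using v(1) by (auto simp: weak_entropy_solution_def Linf_def)
  define M where "M = max A B"
  \<comment> \<open>The estimates need bounded values, and the solutions provide a bound
    \<open>M\<close>. The constant \<open>L\<close> remains the one of \<open>J\<close>, so the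
    speed \<open>L + 1\<close> does not depend on the solutions.\<close>
  define J' where "J' = J \<inter> {-M..M}"
  have sf': "scalar_flux I J' f f' L"
    using sf unfolding scalar_flux_def J'_def by (auto intro: convex_Int)
  have "convex J'" using sf' by (simp add: scalar_flux_def)
  then have J'b: "J' \<in> sets borel" by (rule convex_real_borel)
  have uJ: "AE p in lebesgue_on Omega. u p \<in> J'"
    using A u(2) by eventually_elim (auto simp: J'_def M_def)
  have vJ: "AE p in lebesgue_on Omega. v p \<in> J'"
    using B v(2) by eventually_elim (auto simp: J'_def M_def)
  have "J' \<noteq> {}"
  proof
    assume "J' = {}"
    then have "AE p in lborel. p \<notin> (Omega :: (real \<times> real \<times> (real ^ 'n)) set)"
      using uJ unfolding AE_lebesgue_on_iff[OF Omega_borel] by simp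
    then show False using Omega_not_null by blast
  qed
  obtain u' where u': "u' \<in> borel_measurable borel" "\<And>p. u' p \<in> J'" "AE p in lborel. p \<in> Omega \<longrightarrow> u p = u' p"
    using borel_version[OF Omega_borel um uJ J'b \<open>J' \<noteq> {}\<close>] by blast
  obtain v' where v': "v' \<in> borel_measurable borel" "\<And>p. v' p \<in> J'" "AE p in lborel. p \<in> Omega \<longrightarrow> v p = v' p"
    using borel_version[OF Omega_borel vm vJ J'b \<open>J' \<noteq> {}\<close>] by blast
  have "0 \<le> L" using sf by (simp add: scalar_flux_def)
  have "entropy_pair I J' f f' L \<rho> r C M (L + 1) u v u' v'"
    unfolding entropy_pair_def entropy_pair_axioms_def
    using sf' r u' v' u(1) v(1) \<open>0 \<le> L\<close> by (auto simp: J'_def weak_entropy_solution_def)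
  then show ?thesis using that by blast
qed

context entropy_pair
begin

lemma initial_version:
  assumes "initial_datum I g0" "has_time_value \<rho> g 0 g0"
    and "g' \<in> borel_measurable borel" "AE p in lborel. p \<in> Omega \<longrightarrow> g p = g' p"
  obtains g0' B where "g0' \<in> borel_measurable borel" "\<And>q. \<bar>g0' q\<bar> \<le> B"
    "AE q in lborel. q \<in> UNIV \<times> Gam \<longrightarrow> g0 q = g0' q"
    "\<And>R. ((\<lambda>T. 1 / T * defect R 0 T g' g0') \<longlongrightarrow> 0) (at_right 0)"
proof -
  have "Linf (UNIV \<times> Gam) g0" using assms(1) by (simp add: initial_datum_def)
  then obtain g0' B where g0': "g0' \<in> borel_measurable borel" "\<And>q. \<bar>g0' q\<bar> \<le> B"
    "AE q in lborel. q \<in> UNIV \<times> Gam \<longrightarrow> g0 q = g0' q"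
    using Linf_borel_version[OF UNIV_Gam_borel] by blast
  then show ?thesis
    using that defect_tendsto_0[OF assms(2) _ assms(3,4) g0'(1,3)] by auto
qed

lemma contraction_of_solutions:
  assumes u: "weak_entropy_solution \<rho> I f u0 u" and v: "weak_entropy_solution \<rho> I f v0 v"
  shows "AE t in lebesgue_on {0<..}. \<forall>m>0. \<forall>G. G \<Subset> Gam \<longrightarrow>
      local_distance \<rho> m G (\<lambda>(x, y). u (x, t, y)) (\<lambda>(x, y). v (x, t, y))
        \<le> local_distance \<rho> (m + \<alpha> * t) G u0 v0" (is ?AE)
    and "\<lbrakk>t > 0; Linf (UNIV \<times> Gam) ut; has_time_value \<rho> u t ut; Linf (UNIV \<times> Gam) vt;
        has_time_value \<rho> v t vt; m > 0; G \<Subset> Gam\<rbrakk> \<Longrightarrow>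
      local_distance \<rho> m G ut vt \<le> local_distance \<rho> (m + \<alpha> * t) G u0 v0"
proof -
  have iu: "initial_datum I u0" "has_time_value \<rho> u 0 u0" and iv: "initial_datum I v0" "has_time_value \<rho> v 0 v0"
    using u v by (auto simp: weak_entropy_solution_def)
  obtain u0' A where u0': "u0' \<in> borel_measurable borel" "\<And>q. \<bar>u0' q\<bar> \<le> A"
    "AE q in lborel. q \<in> UNIV \<times> Gam \<longrightarrow> u0 q = u0' q"
    "\<And>R. ((\<lambda>T. 1 / T * defect R 0 T u' u0') \<longlongrightarrow> 0) (at_right 0)"
    using initial_version[OF iu u' u'eq] by blast
  obtain v0' B where v0': "v0' \<in> borel_measurable borel" "\<And>q. \<bar>v0' q\<bar> \<le> B"
    "AE q in lborel. q \<in> UNIV \<times> Gam \<longrightarrow> v0 q = v0' q"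
    "\<And>R. ((\<lambda>T. 1 / T * defect R 0 T v' v0') \<longlongrightarrow> 0) (at_right 0)"
    using initial_version[OF iv v' v'eq] by blast
  have b: "\<And>q. \<bar>u0' q\<bar> \<le> max A B" "\<And>q. \<bar>v0' q\<bar> \<le> max A B"
    using u0'(2) v0'(2) by (auto simp: le_max_iff_disj)
  show ?AE
    by (rule distance_contraction_AE[OF u0'(1) v0'(1) b u0'(4) v0'(4) u0'(3) v0'(3)])
  assume t: "t > 0" and ut: "Linf (UNIV \<times> Gam) ut" "has_time_value \<rho> u t ut"
    and vt: "Linf (UNIV \<times> Gam) vt" "has_time_value \<rho> v t vt" and m: "m > 0" and G: "G \<Subset> Gam"
  obtain ut' A' where ut': "ut' \<in> borel_measurable borel" "\<And>q. \<bar>ut' q\<bar> \<le> A'"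
    "AE q in lborel. q \<in> UNIV \<times> Gam \<longrightarrow> ut q = ut' q"
    using Linf_borel_version[OF UNIV_Gam_borel ut(1)] by blast
  obtain vt' B' where vt': "vt' \<in> borel_measurable borel" "\<And>q. \<bar>vt' q\<bar> \<le> B'"
    "AE q in lborel. q \<in> UNIV \<times> Gam \<longrightarrow> vt q = vt' q"
    using Linf_borel_version[OF UNIV_Gam_borel vt(1)] by blast
  have b': "\<And>q. \<bar>ut' q\<bar> \<le> max A' B'" "\<And>q. \<bar>vt' q\<bar> \<le> max A' B'"
    using ut'(2) vt'(2) by (auto simp: le_max_iff_disj)
  have t0: "t \<ge> 0" using t by simp
  show "local_distance \<rho> m G ut vt \<le> local_distance \<rho> (m + \<alpha> * t) G u0 v0"
    by (rule distance_contraction_time_value[OF u0'(1) v0'(1) b u0'(4) v0'(4) u0'(3) v0'(3) t ut'(1) vt'(1) b'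
          defect_tendsto_0[OF ut(2) t0 u' u'eq ut'(1,3)] defect_tendsto_0[OF vt(2) t0 v' v'eq vt'(1,3)]
          ut'(3) vt'(3) m G])
qed

lemma uniqueness_of_solutions:
  assumes u: "weak_entropy_solution \<rho> I f u0 u" and v: "weak_entropy_solution \<rho> I f u0 v"
    and pd: "product_density \<rho>"
  shows "AE p in lebesgue_on Omega. u p = v p"
proof -
  have i: "initial_datum I u0" "has_time_value \<rho> u 0 u0" "has_time_value \<rho> v 0 u0"
    using u v by (auto simp: weak_entropy_solution_def)
  obtain u0' A where u0': "u0' \<in> borel_measurable borel" "\<And>q. \<bar>u0' q\<bar> \<le> A"
    "AE q in lborel. q \<in> UNIV \<times> Gam \<longrightarrow> u0 q = u0' q"
    "\<And>R. ((\<lambda>T. 1 / T * defect R 0 T u' u0') \<longlongrightarrow> 0) (at_right 0)"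
    using initial_version[OF i(1,2) u' u'eq] by blast
  \<comment> \<open>Both solutions are compared with the same representative of the common datum, so
    the initial mass is exactly 0.\<close>
  have v0: "\<And>R. ((\<lambda>T. 1 / T * defect R 0 T v' u0') \<longlongrightarrow> 0) (at_right 0)"
    by (rule defect_tendsto_0[OF i(3) _ v' v'eq u0'(1,3)]) simp
  have "AE y in lborel. y \<in> Gam \<longrightarrow> 0 < \<rho> y" "AE y in lborel. y \<in> Gam \<longrightarrow> \<rho> y = r y"
    using pd r by (auto simp: product_density_def density_version_def AE_lebesgue_on_iff)
  then have "AE y in lborel. y \<in> Gam \<longrightarrow> 0 < r y" by eventually_elim auto
  then show ?thesis
    unfolding AE_lebesgue_on_iff[OF Omega_borel]
    by (rule solutions_equal_AE[OF u0'(1) u0'(1) u0'(2) u0'(2) u0'(4) v0 u0'(3) u0'(3) refl])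
qed

end

text \<open>The speed has to bound \<open>f'\<close>, which may be unbounded on \<open>I\<close>; it
  is therefore chosen for a set \<open>J\<close> of values on which \<open>f'\<close> is bounded,
  before the density, the data and the solutions. Elements of an L-infinity space have no time
  slices, hence one form for almost every \<open>t\<close>, with a null set independent of
  \<open>m\<close> and the parameter set, and one for every \<open>t\<close> at which both solutions
  have a time value. The projection \<open>I\<close> need not be closed, so \<open>f'\<close> can be
  unbounded even on a bounded part of \<open>I\<close>; the uniqueness part excludes this.\<close>

theorem theorem2p4:
  fixes D :: "(real \<times> real) set" and f1 :: "real \<times> real \<Rightarrow> real"
    and e f :: "real \<Rightarrow> real" and I :: "real set"
  assumes D: "open D" "convex D"
    and I: "I = fst ` closure D"
    and f1: "Ck_on 2 (closure D) f1"
    and e: "Ck_on 2 I e" "\<forall>v\<in>I. (v, e v) \<in> closure D"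
    and f: "\<forall>v\<in>I. f v = f1 (v, e v)"
  shows
    "(\<forall>J. J \<subseteq> I \<and> convex J \<and> bounded (deriv_in I f ` J) \<longrightarrow>
       (\<exists>\<alpha>>0. \<forall>(\<rho> :: real ^ 'n \<Rightarrow> real) u0 v0 u v.
          product_density \<rho> \<and>
          weak_entropy_solution \<rho> I f u0 u \<and> (AE p in lebesgue_on Omega. u p \<in> J) \<and>
          weak_entropy_solution \<rho> I f v0 v \<and> (AE p in lebesgue_on Omega. v p \<in> J) \<longrightarrow>
          (AE t in lebesgue_on {0<..}. \<forall>m>0. \<forall>\<Gamma>\<^sub>1. \<Gamma>\<^sub>1 \<Subset> Gam \<longrightarrow>
             local_distance \<rho> m \<Gamma>\<^sub>1 (\<lambda>(x, y). u (x, t, y)) (\<lambda>(x, y). v (x, t, y))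
               \<le> local_distance \<rho> (m + \<alpha> * t) \<Gamma>\<^sub>1 u0 v0) \<and>
          (\<forall>t>0. \<forall>u\<^sub>t v\<^sub>t.
             Linf (UNIV \<times> Gam) u\<^sub>t \<and> has_time_value \<rho> u t u\<^sub>t \<and>
             Linf (UNIV \<times> Gam) v\<^sub>t \<and> has_time_value \<rho> v t v\<^sub>t \<longrightarrow>
             (\<forall>m>0. \<forall>\<Gamma>\<^sub>1. \<Gamma>\<^sub>1 \<Subset> Gam \<longrightarrow>
                local_distance \<rho> m \<Gamma>\<^sub>1 u\<^sub>t v\<^sub>t \<le> local_distance \<rho> (m + \<alpha> * t) \<Gamma>\<^sub>1 u0 v0)))) \<and>
     ((\<forall>M. bounded (deriv_in I f ` (I \<inter> {-M..M}))) \<longrightarrow>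
       (\<forall>(\<rho> :: real ^ 'n \<Rightarrow> real) u0 u v.
          product_density \<rho> \<and>
          weak_entropy_solution \<rho> I f u0 u \<and> weak_entropy_solution \<rho> I f u0 v \<longrightarrow>
          (AE p in lebesgue_on Omega. u p = v p)))"
proof -
  obtain f' where f': "\<And>v. v \<in> I \<Longrightarrow> (f has_real_derivative f' v) (at v within I)"
    "continuous_on I f'" "\<And>v. v \<in> I \<Longrightarrow> at v within I \<noteq> bot" "convex I"
    using composed_flux_C1[OF D I f1 e f] by blast
  \<comment> \<open>For \<open>J = {}\<close> the bound is vacuous. The interpretation supplies
    \<open>deriv_in_f\<close>, a fact about \<open>I\<close> alone, from which the bound for an
    actual \<open>J\<close> is derived.\<close>
  interpret trivial: scalar_flux I "{}" f f' 0
    using f' by unfold_locales auto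
  have flux: "\<exists>L. scalar_flux I J f f' L" if J: "J \<subseteq> I" "convex J" "bounded (deriv_in I f ` J)" for J
  proof -
    obtain B where "\<And>v. v \<in> J \<Longrightarrow> \<bar>deriv_in I f v\<bar> \<le> B"
      using J(3) unfolding bounded_iff by auto
    \<comment> \<open>\<open>J\<close> may be empty, in which case \<open>B\<close> may be
      negative.\<close>
    then have "\<bar>f' v\<bar> \<le> max B 0" if "v \<in> J" for v
      using trivial.deriv_in_f[of v] J(1) that by (fastforce simp: le_max_iff_disj)
    then have "scalar_flux I J f f' (max B 0)"
      using f' J by unfold_locales auto
    then show ?thesis by blast
  qed
  show ?thesis
  proof (intro conjI allI impI)
    fix J assume "J \<subseteq> I \<and> convex J \<and> bounded (deriv_in I f ` J)"
    then obtain L where L: "scalar_flux I J f f' L" using flux by blast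
    show "\<exists>\<alpha>>0. \<forall>(\<rho> :: real ^ 'n \<Rightarrow> real) u0 v0 u v.
          product_density \<rho> \<and>
          weak_entropy_solution \<rho> I f u0 u \<and> (AE p in lebesgue_on Omega. u p \<in> J) \<and>
          weak_entropy_solution \<rho> I f v0 v \<and> (AE p in lebesgue_on Omega. v p \<in> J) \<longrightarrow>
          (AE t in lebesgue_on {0<..}. \<forall>m>0. \<forall>\<Gamma>\<^sub>1. \<Gamma>\<^sub>1 \<Subset> Gam \<longrightarrow>
             local_distance \<rho> m \<Gamma>\<^sub>1 (\<lambda>(x, y). u (x, t, y)) (\<lambda>(x, y). v (x, t, y))
               \<le> local_distance \<rho> (m + \<alpha> * t) \<Gamma>\<^sub>1 u0 v0) \<and>
          (\<forall>t>0. \<forall>u\<^sub>t v\<^sub>t.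
             Linf (UNIV \<times> Gam) u\<^sub>t \<and> has_time_value \<rho> u t u\<^sub>t \<and>
             Linf (UNIV \<times> Gam) v\<^sub>t \<and> has_time_value \<rho> v t v\<^sub>t \<longrightarrow>
             (\<forall>m>0. \<forall>\<Gamma>\<^sub>1. \<Gamma>\<^sub>1 \<Subset> Gam \<longrightarrow>
                local_distance \<rho> m \<Gamma>\<^sub>1 u\<^sub>t v\<^sub>t \<le> local_distance \<rho> (m + \<alpha> * t) \<Gamma>\<^sub>1 u0 v0))"
    \<comment> \<open>Any positive speed that is not below \<open>L\<close> serves; \<open>L\<close>
      itself may be 0.\<close>
    proof (intro exI[of _ "L + 1"] conjI[of "0 < L + 1"] allI impI, goal_cases)
      case 1
      then show ?case using L by (simp add: scalar_flux_def)
    next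
      case (2 \<rho> u0 v0 u v)
      then obtain J' r C M u' v' where "entropy_pair I J' f f' L \<rho> r C M (L + 1) u v u' v'"
        using entropy_pair_exists[OF L] by metis
      then interpret entropy_pair I J' f f' L \<rho> r C M "L + 1" u v u' v' .
      show ?case
        using contraction_of_solutions[of u0 v0] 2 by blast
    qed
  next
    fix \<rho> :: "real ^ 'n \<Rightarrow> real" and u0 u v
    assume bd: "\<forall>M. bounded (deriv_in I f ` (I \<inter> {-M..M}))"
      and sol: "product_density \<rho> \<and> weak_entropy_solution \<rho> I f u0 u \<and> weak_entropy_solution \<rho> I f u0 v"
    obtain A where A: "AE p in lebesgue_on Omega. \<bar>u p\<bar> \<le> A" "AE p in lebesgue_on Omega. u p \<in> I"
      using sol by (auto simp: weak_entropy_solution_def Linf_def)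
    obtain B where B: "AE p in lebesgue_on Omega. \<bar>v p\<bar> \<le> B" "AE p in lebesgue_on Omega. v p \<in> I"
      using sol by (auto simp: weak_entropy_solution_def Linf_def)
    \<comment> \<open>Two given solutions are bounded, so a bounded part of \<open>I\<close>
      contains the values of both. For uniqueness the speed may depend on this part.\<close>
    let ?J = "I \<inter> {- max A B..max A B}"
    have uJ: "AE p in lebesgue_on Omega. u p \<in> ?J" using A by eventually_elim auto
    have vJ: "AE p in lebesgue_on Omega. v p \<in> ?J" using B by eventually_elim auto
    obtain L where L: "scalar_flux I ?J f f' L"
      using flux[of ?J] bd f'(4) by (auto intro: convex_Int)
    obtain J' r C M u' v' where "entropy_pair I J' f f' L \<rho> r C M (L + 1) u v u' v'"
      using entropy_pair_exists[OF L, of \<rho> u0 u u0 v] sol uJ vJ by metis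
    then interpret entropy_pair I J' f f' L \<rho> r C M "L + 1" u v u' v' .
    show "AE p in lebesgue_on Omega. u p = v p"
      using uniqueness_of_solutions sol by blast
  qed
qed

end
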